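(* Let $\mathsf k$ be a field and let $U$ be a Galois $\Gamma$-ring in the invariant skew group ring $\mathcal K=\mathcal L^G$, $\mathcal L=L*\mathcal M$ (with $\mathcal M$ a group), such that $U$ is a prime PI $\mathsf k$-algebra. Suppose that $U$ is a Galois $\Gamma$-order. Then $U$ is integral over its center $Z$. Hence: (i) (Lying over) If $\mathfrak p\in\operatorname{Spec}Z$, there is $P\in\operatorname{Spec}U$ such that $P\cap Z=\mathfrak p$. (ii) (Going up) If $\mathfrak p_1,\mathfrak p_2\in\operatorname{Spec}Z$, $\mathfrak p_1\subset\mathfrak p_2$, and $P\in\operatorname{Spec}U$ is such that $P\cap Z=\mathfrak p_1$, then there is $Q\in\operatorname{Spec}U$ containing $P$ such that $Q\cap Z=\mathfrak p_2$. (iii) (Incomparability) If $P,Q\in\operatorname{Spec}U$ and $P\subsetneq Q$, then $P\cap Z\subsetneq Q\cap Z$. (iv) (Going down) If $\mathfrak p_1,\mathfrak p_2\in\operatorname{Spec}Z$, $\mathfrak p_1\supset\mathfrak p_2$, and $P\in\operatorname{Spec}U$ is such that $P\cap Z=\mathfrak p_1$, then there is $Q\in\operatorname{Spec}U$ contained in $P$ such that $Q\cap Z=\mathfrak p_2$.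
   Context: Setting: $\Lambda$ is an integrally closed (commutative) domain which is a $\mathsf k$-algebra, $G$ is a finite subgroup of the group $\operatorname{Aut}_{\mathsf k}(\Lambda)$ of $\mathsf k$-algebra automorphisms and $\mathcal M$ is a submonoid (here a subgroup) of $\operatorname{Aut}_{\mathsf k}(\Lambda)$ such that (1) $\mathcal M\mathcal M^{-1}\cap G=\{e\}$; (2) $G$ acts on $\mathcal M$ by conjugation, $g\cdot\mu=g\mu g^{-1}\in\mathcal M$; (3) $\Lambda$ is a Noetherian $\Lambda^G$-module. $\mathcal M$ is assumed finitely generated. Put $L=\operatorname{Frac}\Lambda$, $\Gamma=\Lambda^G$, $K=\operatorname{Frac}\Gamma=L^G$. The ring $\mathcal L=L*\mathcal M$ is the free left $L$-module on $\mathcal M$ with multiplication $(a\mu)(b\nu)=a\,\mu(b)\,\mu\nu$. The group $G$ acts on $\mathcal L$ via $a\mu\mapsto g(a)\,(g\cdot\mu)$, and $\mathcal K=\mathcal L^G$ is the fixed ring. A Galois $\Gamma$-ring in $\mathcal K$ is a subring $U\subseteq\mathcal K$ containing $\Gamma$ and finitely generated as a ring over $\Gamma$ such that $KU=UK=\mathcal K$. It is a Galois $\Gamma$-order if, for every finite-dimensional left (respectively right) $K$-subspace $W$ of $\mathcal K$, the intersection $W\cap U$ is a finitely generated left (respectively right) $\Gamma$-module. A $\mathsf k$-algebra $A$ is PI if some polynomial in the free associative unital algebra $\mathsf k\langle X\rangle$ with at least one monomial of maximal degree having coefficient $1$ vanishes under all substitutions from $A$. $\operatorname{Spec}$ denotes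 the set of (two-sided) prime ideals. $U$ is integral over $Z$ if every element of $U$ satisfies a monic polynomial with coefficients in $Z$. *)

theory Defs
  imports
    "HOL-Computational_Algebra.Polynomial_Factorial"
    "HOL-Library.Poly_Mapping"
    "HOL-Algebra.Embedded_Algebras"
    "HOL-Algebra.Polynomials"
    "HOL-Algebra.Ideal_Product"
    "HOL-Algebra.Generated_Rings"
begin

text \<open>
  The domain \<open>\<Lambda>\<close> is a type of class \<open>idom\<close>, so that \<open>L = Frac \<Lambda>\<close> is the library type of
  fractions, and the field \<open>k\<close> is a type of class \<open>field\<close> acting by a scalar multiplication \<open>s\<close>.
  The skew group ring, its invariants and the rings inside it depend on the sets of automorphisms
  \<open>G\<close> and \<open>M\<close>; they are HOL-Algebra ring records.
\<close>

section \<open>The commutative data\<close>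

definition k_algebra :: "('k::field \<Rightarrow> 'a::comm_ring_1 \<Rightarrow> 'a) \<Rightarrow> bool" where
  "k_algebra s \<longleftrightarrow> vector_space s \<and> (\<forall>c x y. s c (x * y) = s c x * y)"

definition aut_group :: "('k::field \<Rightarrow> 'a::comm_ring_1 \<Rightarrow> 'a) \<Rightarrow> ('a \<Rightarrow> 'a) monoid" where
  "aut_group s =
     \<lparr>carrier = {\<phi>. bij \<phi> \<and> Vector_Spaces.linear s s \<phi> \<and>
                    (\<forall>x y. \<phi> (x * y) = \<phi> x * \<phi> y) \<and> \<phi> 1 = 1},
      monoid.mult = (\<circ>), one = id\<rparr>"

definition integrally_closed :: "'a::idom itself \<Rightarrow> bool" where
  "integrally_closed _ \<longleftrightarrow>
     (\<forall>x::'a fract. (\<exists>p::'a poly. Polynomial.lead_coeff p = 1 \<and> poly (fract_poly p) x = 0) \<longrightarrow>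
        x \<in> range to_fract)"

definition fixed_subring :: "('a \<Rightarrow> 'a) set \<Rightarrow> 'a set" where
  "fixed_subring G = {x. \<forall>g\<in>G. g x = x}"

definition noetherian_over :: "'a::comm_ring_1 set \<Rightarrow> bool" where
  "noetherian_over A \<longleftrightarrow>
     (\<forall>N. 0 \<in> N \<and> (\<forall>x\<in>N. \<forall>y\<in>N. x + y \<in> N) \<and> (\<forall>a\<in>A. \<forall>x\<in>N. a * x \<in> N) \<longrightarrow>
        (\<exists>T. finite T \<and> T \<subseteq> N \<and> N = {(\<Sum>t\<in>T. c t * t) | c. \<forall>t\<in>T. c t \<in> A}))"

text \<open>
  Extension of an automorphism of \<open>\<Lambda>\<close> to \<open>L\<close>. The description is unambiguous for injective
  ring homomorphisms only.
\<close>

definition fract_ext :: "('a::idom \<Rightarrow> 'a) \<Rightarrow> 'a fract \<Rightarrow> 'a fract" where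
  "fract_ext \<phi> x = (THE y. \<exists>a b. b \<noteq> 0 \<and> x = Fract a b \<and> y = Fract (\<phi> a) (\<phi> b))"

lemma fract_ext_Fract:
  assumes "inj \<phi>" "\<And>x y. \<phi> (x * y) = \<phi> x * \<phi> y" "\<phi> 0 = 0" "b \<noteq> 0"
  shows "fract_ext \<phi> (Fract a b) = Fract (\<phi> a) (\<phi> b)"
proof -
  have nz: "\<phi> d \<noteq> 0" if "d \<noteq> 0" for d
    using that assms(1,3) by (metis injD)
  have "y = Fract (\<phi> a) (\<phi> b)"
    if "d \<noteq> 0" "Fract a b = Fract c d" "y = Fract (\<phi> c) (\<phi> d)" for y c d
  proof -
    have "a * d = c * b"
      using that assms(4) by (simp add: eq_fract)
    then have "\<phi> a * \<phi> d = \<phi> c * \<phi> b"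
      by (metis assms(2))
    then show ?thesis
      using that nz assms(4) by (simp add: eq_fract)
  qed
  then show ?thesis
    unfolding fract_ext_def using assms(4) by (intro the_equality) blast+
qed

section \<open>The skew group ring and its invariants\<close>

text \<open>
  The formal sum of the terms \<open>a \<mu>\<close> is the finitely supported function sending \<open>\<mu>\<close> to \<open>a\<close>; a
  single term \<open>a \<mu>\<close> is \<open>Poly_Mapping.single \<mu> a\<close>.
\<close>

type_synonym 'a skew = "('a \<Rightarrow> 'a) \<Rightarrow>\<^sub>0 'a fract"

definition skew_mult :: "'a::idom skew \<Rightarrow> 'a skew \<Rightarrow> 'a skew" where
  "skew_mult f g =
     (\<Sum>\<mu>\<in>Poly_Mapping.keys f. \<Sum>\<nu>\<in>Poly_Mapping.keys g.
        Poly_Mapping.single (\<mu> \<circ> \<nu>) (Poly_Mapping.lookup f \<mu> * fract_ext \<mu> (Poly_Mapping.lookup g \<nu>)))"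

definition skew_ring :: "('a::idom \<Rightarrow> 'a) set \<Rightarrow> 'a skew ring" where
  "skew_ring M =
     \<lparr>carrier = {f. Poly_Mapping.keys f \<subseteq> M}, monoid.mult = skew_mult, one = Poly_Mapping.single id 1,
      zero = 0, add = (+)\<rparr>"

definition skew_action :: "('a::idom \<Rightarrow> 'a) \<Rightarrow> 'a skew \<Rightarrow> 'a skew" where
  "skew_action g f =
     (\<Sum>\<mu>\<in>Poly_Mapping.keys f. Poly_Mapping.single (g \<circ> \<mu> \<circ> inv_into UNIV g) (fract_ext g (Poly_Mapping.lookup f \<mu>)))"

definition invariant_skew_ring :: "('a::idom \<Rightarrow> 'a) set \<Rightarrow> ('a \<Rightarrow> 'a) set \<Rightarrow> 'a skew ring" where
  "invariant_skew_ring G M =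
     (skew_ring M)\<lparr>carrier := {f \<in> carrier (skew_ring M). \<forall>g\<in>G. skew_action g f = f}\<rparr>"

definition skew_embed :: "'a::idom fract \<Rightarrow> 'a skew" where
  "skew_embed x = Poly_Mapping.single id x"

text \<open>\<open>\<Gamma> = \<Lambda>\<^sup>G\<close> and \<open>K = Frac \<Gamma>\<close> as subsets of the skew group ring.\<close>

definition Gamma_in :: "('a::idom \<Rightarrow> 'a) set \<Rightarrow> 'a skew set" where
  "Gamma_in G = {skew_embed (to_fract a) | a. a \<in> fixed_subring G}"

definition K_in :: "('a::idom \<Rightarrow> 'a) set \<Rightarrow> 'a skew set" where
  "K_in G = {skew_embed (Fract a b) | a b. a \<in> fixed_subring G \<and> b \<in> fixed_subring G \<and> b \<noteq> 0}"

section \<open>Galois rings and Galois orders\<close>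

text \<open>
  \<open>I \<cdot>\<^bsub>R\<^esub> J\<close> is the set of finite sums of products of elements of \<open>I\<close> and \<open>J\<close>; it is used here
  for subrings, not for ideals, to express \<open>K U\<close> and \<open>U K\<close>.
\<close>

definition galois_ring :: "('a::idom \<Rightarrow> 'a) set \<Rightarrow> ('a \<Rightarrow> 'a) set \<Rightarrow> 'a skew set \<Rightarrow> bool" where
  "galois_ring G M U \<longleftrightarrow>
     (let R = invariant_skew_ring G M in
        subring U R \<and> Gamma_in G \<subseteq> U \<and>
        (\<exists>S. finite S \<and> S \<subseteq> U \<and> U = generate_ring R (Gamma_in G \<union> S)) \<and>
        K_in G \<cdot>\<^bsub>R\<^esub> U = carrier R \<and> U \<cdot>\<^bsub>R\<^esub> K_in G = carrier R)"

definition opposite_ring :: "('r, 'm) ring_scheme \<Rightarrow> ('r, 'm) ring_scheme" where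
  "opposite_ring R = R\<lparr>monoid.mult := \<lambda>x y. y \<otimes>\<^bsub>R\<^esub> x\<rparr>"

definition fg_left_module :: "('r, 'm) ring_scheme \<Rightarrow> 'r set \<Rightarrow> 'r set \<Rightarrow> bool" where
  "fg_left_module R A N \<longleftrightarrow> (\<exists>us. set us \<subseteq> carrier R \<and> N = ring.Span R A us)"

text \<open>
  \<open>ring.finite_dimension\<close> and \<open>ring.Span\<close> refer to left multiplication by scalars and do not need
  the scalars to be central. Right subspaces and right modules are the left ones over the
  opposite ring.
\<close>

definition galois_order :: "('a::idom \<Rightarrow> 'a) set \<Rightarrow> ('a \<Rightarrow> 'a) set \<Rightarrow> 'a skew set \<Rightarrow> bool" where
  "galois_order G M U \<longleftrightarrow>
     galois_ring G M U \<and>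
     (let R = invariant_skew_ring G M in
        (\<forall>W. ring.finite_dimension R (K_in G) W \<longrightarrow>
           fg_left_module R (Gamma_in G) (W \<inter> U)) \<and>
        (\<forall>W. ring.finite_dimension (opposite_ring R) (K_in G) W \<longrightarrow>
           fg_left_module (opposite_ring R) (Gamma_in G) (W \<inter> U)))"

section \<open>Polynomial identities, primes and integrality\<close>

text \<open>
  An element of the free algebra \<open>k\<langle>X\<rangle>\<close> with \<open>X\<close> indexed by the natural numbers is a
  finitely supported function on words. The map \<open>\<iota>\<close> from \<open>k\<close> is the structure map of the
  algebra \<open>R\<close>.
\<close>

definition nc_eval ::
  "('k::zero \<Rightarrow> 'r) \<Rightarrow> ('r, 'm) ring_scheme \<Rightarrow> (nat list \<Rightarrow>\<^sub>0 'k) \<Rightarrow> (nat \<Rightarrow> 'r) \<Rightarrow> 'r" where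
  "nc_eval \<iota> R p a =
     (\<Oplus>\<^bsub>R\<^esub>w\<in>Poly_Mapping.keys p. \<iota> (Poly_Mapping.lookup p w) \<otimes>\<^bsub>R\<^esub> foldr (\<lambda>i r. a i \<otimes>\<^bsub>R\<^esub> r) w \<one>\<^bsub>R\<^esub>)"

definition PI_algebra :: "('k::zero_neq_one \<Rightarrow> 'r) \<Rightarrow> ('r, 'm) ring_scheme \<Rightarrow> bool" where
  "PI_algebra \<iota> R \<longleftrightarrow>
     (\<exists>p :: nat list \<Rightarrow>\<^sub>0 'k.
        (\<exists>w. Poly_Mapping.lookup p w = 1 \<and> (\<forall>v\<in>Poly_Mapping.keys p. length v \<le> length w)) \<and>
        (\<forall>a. (\<forall>i. a i \<in> carrier R) \<longrightarrow> nc_eval \<iota> R p a = \<zero>\<^bsub>R\<^esub>))"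

definition skew_scalar :: "('k \<Rightarrow> 'a::idom \<Rightarrow> 'a) \<Rightarrow> 'k \<Rightarrow> 'a skew" where
  "skew_scalar s c = skew_embed (to_fract (s c 1))"

definition Spec :: "('r, 'm) ring_scheme \<Rightarrow> 'r set set" where
  "Spec R = {P. ideal P R \<and> P \<noteq> carrier R \<and>
     (\<forall>I J. ideal I R \<longrightarrow> ideal J R \<longrightarrow> I \<cdot>\<^bsub>R\<^esub> J \<subseteq> P \<longrightarrow> I \<subseteq> P \<or> J \<subseteq> P)}"

definition prime_ring :: "('r, 'm) ring_scheme \<Rightarrow> bool" where
  "prime_ring R \<longleftrightarrow> {\<zero>\<^bsub>R\<^esub>} \<in> Spec R"

definition center :: "('r, 'm) ring_scheme \<Rightarrow> 'r set" where
  "center R = {z \<in> carrier R. \<forall>u\<in>carrier R. z \<otimes>\<^bsub>R\<^esub> u = u \<otimes>\<^bsub>R\<^esub> z}"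

text \<open>Polynomials are coefficient lists, leading coefficient first.\<close>

definition integral_over :: "('r, 'm) ring_scheme \<Rightarrow> 'r set \<Rightarrow> bool" where
  "integral_over R A \<longleftrightarrow>
     (\<forall>u\<in>carrier R. \<exists>cs. set cs \<subseteq> A \<and> ring.eval R (\<one>\<^bsub>R\<^esub> # cs) u = \<zero>\<^bsub>R\<^esub>)"

end

theory Submission
  imports Defs "Jordan_Normal_Form.Char_Poly" "HOL-Algebra.Algebraic_Closure_Type"
begin

text \<open>
  If \<open>M\<close> is infinite, then finitely many vectors of \<open>L\<^sup>G\<close> never separate the elements of \<open>U\<close>,
  and this freedom allows one to build a substitution violating any given polynomial identity; so
  \<open>M\<close> is finite. Then \<open>L * M\<close> is finite-dimensional, so the Galois order \<open>U\<close> is a finitely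
  generated left module over the Noetherian ring \<open>\<Gamma>\<close>. Cayley-Hamilton for right multiplication by
  \<open>u \<in> U\<close> gives a monic equation with coefficients in \<open>\<Gamma>\<close> on the left, and multiplying its
  conjugates under \<open>M\<close> moves the coefficients into the invariants of \<open>\<Lambda>\<close> under \<open>G\<close> and \<open>M\<close>,
  which form the center of \<open>U\<close>.

  Lying over, going up and incomparability hold for every left Noetherian ring integral over a
  central subring. For going down one uses in addition that the center is integrally closed: if
  \<open>a u \<in> \<pp> U\<close> with \<open>a\<close> central and outside \<open>\<pp>\<close>, then a power of \<open>u\<close> lies in \<open>\<pp> U\<close>, and a nil
  right ideal of a prime Noetherian ring is zero.
\<close>

hide_const (open) up_ring.coeff up_ring.monom module.smult Polynomials.degree Polynomials.lead_coeff

section \<open>Rings integral over a central subring\<close>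

text \<open>The skew setting offers neither a field generated by \<open>u\<close> nor commuting
  coefficients, and two devices replace them. Polynomials over \<open>L\<close> act on
  \<open>L * M\<close> with coefficients on the left and \<open>t\<close> acting as right
  multiplication by \<open>u\<close>. This action is \<open>L\<close>-linear, so a multiple of a
  polynomial that annihilates \<open>1\<close> annihilates \<open>1\<close> as well, and norms can
  be formed before any coefficient is central. For going down, minimal polynomials are replaced by a
  monic gcd over \<open>L\<close> of two equations of the same element: being unique, it is fixed by
  \<open>G\<close> and \<open>M\<close>, and integral closedness of \<Lambda> then puts its
  coefficients into the center. Cayley-Hamilton is proved with coefficients in a ring without unit.
  With \<Lambda> in that place it gives integrality; with the extension to \<Lambda> of a prime of
  the center it gives the sharper equation, with lower coefficients in the prime, that going down
  starts from. The condition on \<open>M M^-1\<close> and \<open>G\<close> enters through Dedekind's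
  lemma: distinct elements of \<open>M\<close> stay distinct on \<Gamma>, so an element of the skew
  ring is determined by its action on \<open>L^G\<close>.\<close>

definition left_ideal :: "'r set \<Rightarrow> ('r, 'm) ring_scheme \<Rightarrow> bool" where
  "left_ideal I R \<longleftrightarrow> additive_subgroup I R \<and> (\<forall>r\<in>carrier R. \<forall>x\<in>I. r \<otimes>\<^bsub>R\<^esub> x \<in> I)"

text \<open>The proofs below pick maximal members of families, such as a maximal left annihilator or
  a maximal ideal avoiding a set, so the maximum condition itself is the definition.\<close>

definition left_noetherian :: "('r, 'm) ring_scheme \<Rightarrow> bool" where
  "left_noetherian R \<longleftrightarrow>
     (\<forall>F. F \<noteq> {} \<longrightarrow> (\<forall>I\<in>F. left_ideal I R) \<longrightarrow> (\<exists>I\<in>F. \<forall>J\<in>F. I \<subseteq> J \<longrightarrow> J = I))"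

lemma left_noetherianD:
  assumes "left_noetherian R" "F \<noteq> {}" "\<And>I. I \<in> F \<Longrightarrow> left_ideal I R"
  obtains I where "I \<in> F" "\<And>J. J \<in> F \<Longrightarrow> I \<subseteq> J \<Longrightarrow> J = I"
  using assms unfolding left_noetherian_def by metis

context ring
begin

lemma additive_subgroupI:
  assumes "I \<subseteq> carrier R" "\<zero> \<in> I"
    and "\<And>x y. x \<in> I \<Longrightarrow> y \<in> I \<Longrightarrow> x \<oplus> y \<in> I" "\<And>x. x \<in> I \<Longrightarrow> \<ominus> x \<in> I"
  shows "additive_subgroup I R"
  using assms by (intro additive_subgroup.intro add.subgroupI) (auto simp: a_inv_def)

lemma two_sided_idealI:
  assumes "I \<subseteq> carrier R" "\<zero> \<in> I"
    and add: "\<And>x y. x \<in> I \<Longrightarrow> y \<in> I \<Longrightarrow> x \<oplus> y \<in> I"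
    and l: "\<And>x r. x \<in> I \<Longrightarrow> r \<in> carrier R \<Longrightarrow> r \<otimes> x \<in> I"
    and r: "\<And>x r. x \<in> I \<Longrightarrow> r \<in> carrier R \<Longrightarrow> x \<otimes> r \<in> I"
  shows "ideal I R"
proof -
  have "\<ominus> x \<in> I" if "x \<in> I" for x
    using l[OF that, of "\<ominus> \<one>"] that assms(1) l_minus[of \<one> x] by auto
  then have "additive_subgroup I R"
    using assms by (intro additive_subgroupI)
  then show ?thesis
    using assms by (intro idealI ring_axioms) (auto simp: additive_subgroup_def)
qed

lemma left_idealI:
  assumes "I \<subseteq> carrier R" "\<zero> \<in> I"
    and add: "\<And>x y. x \<in> I \<Longrightarrow> y \<in> I \<Longrightarrow> x \<oplus> y \<in> I"
    and l: "\<And>x r. x \<in> I \<Longrightarrow> r \<in> carrier R \<Longrightarrow> r \<otimes> x \<in> I"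
  shows "left_ideal I R"
proof -
  have "\<ominus> x \<in> I" if "x \<in> I" for x
    using l[OF that, of "\<ominus> \<one>"] that assms(1) l_minus[of \<one> x] by auto
  then show ?thesis
    using assms by (auto simp: left_ideal_def intro!: additive_subgroupI)
qed

lemma ideal_imp_left_ideal: "ideal I R \<Longrightarrow> left_ideal I R"
  by (simp add: left_ideal_def ideal.axioms(1) ideal.I_l_closed)

lemmas ideal_closed =
  ideal.Icarr additive_subgroup.zero_closed[OF ideal.axioms(1)]
  additive_subgroup.a_closed[OF ideal.axioms(1)]
  additive_subgroup.a_inv_closed[OF ideal.axioms(1)] ideal.I_l_closed ideal.I_r_closed

section \<open>Prime ideals of a noncommutative ring\<close>

lemma Spec_iff:
  "P \<in> Spec R \<longleftrightarrow> ideal P R \<and> \<one> \<notin> P \<and>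
     (\<forall>a\<in>carrier R. \<forall>b\<in>carrier R. (\<forall>r\<in>carrier R. a \<otimes> r \<otimes> b \<in> P) \<longrightarrow> a \<in> P \<or> b \<in> P)"
proof (intro iffI conjI ballI impI)
  assume P: "P \<in> Spec R"
  then show idl: "ideal P R"
    by (simp add: Spec_def)
  interpret P: ideal P R by (rule idl)
  show "\<one> \<notin> P"
    using P P.one_imp_carrier by (auto simp: Spec_def)
  fix a b assume ab: "a \<in> carrier R" "b \<in> carrier R" "\<forall>r\<in>carrier R. a \<otimes> r \<otimes> b \<in> P"
  \<comment> \<open>These two-sided ideals contain \<open>a\<close> and \<open>b\<close>, and their
    product lies in \<open>P\<close>. They stand in for the ideals generated by \<open>a\<close> and
    \<open>b\<close>, which then need no description.\<close>
  define I where "I = {x \<in> carrier R. \<forall>r\<in>carrier R. x \<otimes> r \<otimes> b \<in> P}"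
  define J where "J = {y \<in> carrier R. \<forall>x\<in>I. \<forall>r\<in>carrier R. x \<otimes> r \<otimes> y \<in> P}"
  have I: "ideal I R"
  proof (rule two_sided_idealI)
    fix x r assume x: "x \<in> I" and r: "r \<in> carrier R"
    have "r \<otimes> x \<otimes> t \<otimes> b = r \<otimes> (x \<otimes> t \<otimes> b)" "x \<otimes> r \<otimes> t \<otimes> b = x \<otimes> (r \<otimes> t) \<otimes> b"
      if "t \<in> carrier R" for t
      using x r that ab by (auto simp: I_def m_assoc)
    then show "r \<otimes> x \<in> I" "x \<otimes> r \<in> I"
      using x r by (auto simp: I_def P.I_l_closed)
  qed (auto simp: I_def l_distr ab)
  have J: "ideal J R"
  proof (rule two_sided_idealI)
    fix y r assume y: "y \<in> J" and r: "r \<in> carrier R"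
    have "x \<otimes> t \<otimes> (r \<otimes> y) = x \<otimes> (t \<otimes> r) \<otimes> y" "x \<otimes> t \<otimes> (y \<otimes> r) = x \<otimes> t \<otimes> y \<otimes> r"
      if "x \<in> I" "t \<in> carrier R" for x t
      using y r that by (auto simp: I_def J_def m_assoc)
    then show "r \<otimes> y \<in> J" "y \<otimes> r \<in> J"
      using y r by (auto simp: J_def P.I_r_closed)
  qed (auto simp: J_def I_def r_distr)
  have "s \<in> P" if "s \<in> I \<cdot> J" for s
    using that
  proof induction
    case (prod x y)
    then have "x \<otimes> \<one> \<otimes> y \<in> P" "x \<in> carrier R" unfolding J_def I_def by blast+
    then show ?case by simp
  qed (simp add: P.a_closed)
  then have "I \<cdot> J \<subseteq> P" by blast
  then have "I \<subseteq> P \<or> J \<subseteq> P"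
    using P I J by (auto simp: Spec_def)
  moreover have "a \<in> I" "b \<in> J"
    using ab by (auto simp: I_def J_def)
  ultimately show "a \<in> P \<or> b \<in> P" by blast
next
  assume P: "ideal P R \<and> \<one> \<notin> P \<and>
     (\<forall>a\<in>carrier R. \<forall>b\<in>carrier R. (\<forall>r\<in>carrier R. a \<otimes> r \<otimes> b \<in> P) \<longrightarrow> a \<in> P \<or> b \<in> P)"
  have "I \<subseteq> P \<or> J \<subseteq> P" if IJ: "ideal I R" "ideal J R" "I \<cdot> J \<subseteq> P" for I J
  proof (rule ccontr)
    assume "\<not> (I \<subseteq> P \<or> J \<subseteq> P)"
    then obtain a b where ab: "a \<in> I" "a \<notin> P" "b \<in> J" "b \<notin> P" by blast
    have "a \<otimes> r \<otimes> b \<in> P" if "r \<in> carrier R" for r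
      using IJ ab that ideal_prod.prod[of "a \<otimes> r" I b J] ideal.I_r_closed by fastforce
    then show False
      using P ab IJ by (meson ideal.Icarr)
  qed
  then show "P \<in> Spec R"
    using P by (auto simp: Spec_def)
qed

lemma ideal_add_ideal:
  assumes "ideal I R" "ideal J R"
  shows "ideal (I <+>\<^bsub>R\<^esub> J) R" "I \<subseteq> I <+>\<^bsub>R\<^esub> J" "J \<subseteq> I <+>\<^bsub>R\<^esub> J"
proof -
  show "ideal (I <+>\<^bsub>R\<^esub> J) R" using assms by (rule add_ideals)
  show "I \<subseteq> I <+>\<^bsub>R\<^esub> J"
  proof
    fix x assume "x \<in> I"
    then have "x = x \<oplus> \<zero>" "\<zero> \<in> J"
      using assms by (auto simp: ideal_closed)
    then show "x \<in> I <+>\<^bsub>R\<^esub> J"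
      using \<open>x \<in> I\<close> unfolding set_add_def' by blast
  qed
  show "J \<subseteq> I <+>\<^bsub>R\<^esub> J"
  proof
    fix x assume "x \<in> J"
    then have "x = \<zero> \<oplus> x" "\<zero> \<in> I"
      using assms by (auto simp: ideal_closed)
    then show "x \<in> I <+>\<^bsub>R\<^esub> J"
      using \<open>x \<in> J\<close> unfolding set_add_def' by blast
  qed
qed

text \<open>\<open>S\<close> is an m-system, the noncommutative form of a multiplicative set. Two
  ideals not inside a maximal \<open>P\<close> both meet \<open>S\<close> after \<open>P\<close> is
  added to them; if their product were inside \<open>P\<close>, the element of \<open>S\<close>
  formed from the two meeting points would lie in \<open>P\<close>. The maximality of
  \<open>P\<close> is exported because lying over enlarges \<open>P\<close> once more.\<close>

lemma exists_prime_avoiding: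
  assumes noeth: "left_noetherian R" and I0: "ideal I0 R" "I0 \<inter> S = {}" and "S \<noteq> {}" "S \<subseteq> carrier R"
    and msys: "\<And>x y. x \<in> S \<Longrightarrow> y \<in> S \<Longrightarrow> \<exists>r\<in>carrier R. x \<otimes> r \<otimes> y \<in> S"
  obtains P where "P \<in> Spec R" "I0 \<subseteq> P" "P \<inter> S = {}"
    "\<And>J. ideal J R \<Longrightarrow> P \<subset> J \<Longrightarrow> J \<inter> S \<noteq> {}"
proof -
  define F where "F = {J. ideal J R \<and> I0 \<subseteq> J \<and> J \<inter> S = {}}"
  obtain P where P: "P \<in> F" "\<And>J. J \<in> F \<Longrightarrow> P \<subseteq> J \<Longrightarrow> J = P"
    by (rule left_noetherianD[OF noeth, of F]) (use I0 in \<open>auto simp: F_def ideal_imp_left_ideal\<close>)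
  have max: "J \<inter> S \<noteq> {}" if "ideal J R" "P \<subset> J" for J
    using P that by (auto simp: F_def)
  have idl: "ideal P R" using P by (simp add: F_def)
  have "I \<subseteq> P \<or> J \<subseteq> P" if IJ: "ideal I R" "ideal J R" "I \<cdot> J \<subseteq> P" for I J
  proof (rule ccontr)
    assume n: "\<not> (I \<subseteq> P \<or> J \<subseteq> P)"
    have *: "(P <+>\<^bsub>R\<^esub> J) \<inter> S \<noteq> {}" if "ideal J R" "\<not> J \<subseteq> P" for J
      using max[of "P <+>\<^bsub>R\<^esub> J"] ideal_add_ideal[OF idl that(1)] that(2) by blast
    obtain p x q y where pxqy: "p \<in> P" "x \<in> I" "p \<oplus> x \<in> S" "q \<in> P" "y \<in> J" "q \<oplus> y \<in> S"
      using *[OF IJ(1)] *[OF IJ(2)] n unfolding set_add_def' by blast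
    then obtain r where r: "r \<in> carrier R" "(p \<oplus> x) \<otimes> r \<otimes> (q \<oplus> y) \<in> S"
      using msys by meson
    have c: "p \<in> carrier R" "x \<in> carrier R" "q \<in> carrier R" "y \<in> carrier R"
      using pxqy IJ idl by (auto simp: ideal_closed)
    have "x \<otimes> r \<otimes> y \<in> P"
      using IJ ideal_prod.prod[of "x \<otimes> r" I y J] pxqy r by (auto simp: ideal_closed)
    moreover have "(p \<oplus> x) \<otimes> r \<otimes> (q \<oplus> y) = p \<otimes> (r \<otimes> (q \<oplus> y)) \<oplus> (x \<otimes> r \<otimes> q \<oplus> x \<otimes> r \<otimes> y)"
      using c r by (simp add: l_distr r_distr m_assoc a_ac)
    moreover have "p \<otimes> (r \<otimes> (q \<oplus> y)) \<in> P" "x \<otimes> r \<otimes> q \<in> P"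
      using idl pxqy c r by (auto simp: ideal_closed)
    ultimately have "(p \<oplus> x) \<otimes> r \<otimes> (q \<oplus> y) \<in> P"
      using idl by (simp add: ideal_closed)
    then show False
      using r P by (auto simp: F_def)
  qed
  moreover have "P \<noteq> carrier R"
    using P \<open>S \<noteq> {}\<close> \<open>S \<subseteq> carrier R\<close> by (auto simp: F_def)
  ultimately have "P \<in> Spec R"
    using idl by (auto simp: Spec_def)
  then show thesis
    using that P max by (auto simp: F_def)
qed

lemma eval_commute:
  assumes "set xs \<subseteq> carrier R" "x \<in> carrier R" "\<And>c. c \<in> set xs \<Longrightarrow> c \<otimes> x = x \<otimes> c"
  shows "eval xs x \<otimes> x = x \<otimes> eval xs x"
  using assms
proof (induction xs rule: rev_induct)
  case (snoc c xs)
  have E: "eval xs x \<in> carrier R"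
    using snoc.prems by (intro eval_in_carrier) auto
  have "eval (xs @ [c]) x = eval xs x \<otimes> x \<oplus> c"
    using snoc.prems by (intro eval_append_aux) auto
  moreover have "eval xs x \<otimes> x = x \<otimes> eval xs x" "c \<otimes> x = x \<otimes> c"
    using snoc by auto
  ultimately show ?case
    using snoc.prems E by (simp add: l_distr r_distr m_assoc)
qed simp

lemma prime_ringD:
  assumes "prime_ring R" "a \<in> carrier R" "b \<in> carrier R" "\<And>r. r \<in> carrier R \<Longrightarrow> a \<otimes> r \<otimes> b = \<zero>"
  shows "a = \<zero> \<or> b = \<zero>"
  using assms unfolding prime_ring_def Spec_iff by blast

lemma prime_ring_one_neq_zero: "prime_ring R \<Longrightarrow> \<one> \<noteq> \<zero>"
  unfolding prime_ring_def Spec_iff by auto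

text \<open>Utumi's argument: an element of the right ideal with maximal left annihilator squares to
  zero through every element of the ring.\<close>

lemma nil_right_ideal_zero:
  assumes noeth: "left_noetherian R" and prime: "prime_ring R"
    and N: "N \<subseteq> carrier R" "\<And>x r. x \<in> N \<Longrightarrow> r \<in> carrier R \<Longrightarrow> x \<otimes> r \<in> N"
    and nil: "\<And>x. x \<in> N \<Longrightarrow> \<exists>n::nat. x [^] n = \<zero>"
  shows "N \<subseteq> {\<zero>}"
proof (rule ccontr)
  assume "\<not> N \<subseteq> {\<zero>}"
  define l where "l a = {y \<in> carrier R. y \<otimes> a = \<zero>}" for a
  have l: "left_ideal (l a) R" if "a \<in> carrier R" for a
    using that by (intro left_idealI) (auto simp: l_def l_distr m_assoc)
  obtain a where a: "a \<in> N" "a \<noteq> \<zero>" and max: "\<And>b. b \<in> N - {\<zero>} \<Longrightarrow> l a \<subseteq> l b \<Longrightarrow> l b = l a"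
  proof (rule left_noetherianD[OF noeth, of "l ` (N - {\<zero>})"])
    show "l ` (N - {\<zero>}) \<noteq> {}" using \<open>\<not> N \<subseteq> {\<zero>}\<close> by auto
    show "left_ideal I R" if "I \<in> l ` (N - {\<zero>})" for I using that l N by auto
  qed auto
  have aR: "a \<in> carrier R" using a N by auto
  have "a \<otimes> r \<otimes> a = \<zero>" if r: "r \<in> carrier R" for r
  proof -
    define x where "x = a \<otimes> r"
    have x: "x \<in> N" "x \<in> carrier R" using N(2)[OF a(1) r] N(1) by (auto simp: x_def)
    define k where "k = (LEAST n::nat. x [^] n = \<zero>)"
    have k: "x [^] k = \<zero>" unfolding k_def by (rule LeastI_ex) (use nil x in blast)
    have "k \<noteq> 0" using k prime_ring_one_neq_zero[OF prime] by (metis nat_pow_0)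
    then obtain m where m: "k = Suc m" by (cases k) auto
    have xm: "x [^] m \<noteq> \<zero>" using not_less_Least[of m "\<lambda>n. x [^] n = \<zero>"] m k_def by auto
    show ?thesis
    proof (cases m)
      case 0
      then show ?thesis using k m x aR by (simp add: x_def)
    next
      case (Suc j)
      have eq: "x [^] m = a \<otimes> (r \<otimes> x [^] j)"
        using nat_pow_Suc2[OF x(2), of j] aR r x Suc by (simp add: x_def m_assoc)
      have "x [^] m \<in> N" using N(2)[OF a(1), of "r \<otimes> x [^] j"] r x by (simp add: eq)
      \<comment> \<open>The last nonzero power of \<open>x\<close> begins with \<open>a\<close>, so
        its left annihilator contains that of \<open>a\<close>; by maximality they agree. As
        \<open>x\<close> kills this power, it kills \<open>a\<close>, that is,
        \<open>a r a = 0\<close>.\<close>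
      moreover have "l a \<subseteq> l (x [^] m)"
      proof
        fix y assume "y \<in> l a"
        then show "y \<in> l (x [^] m)"
          unfolding eq using aR r x m_assoc[of y a "r \<otimes> x [^] j"] by (auto simp: l_def)
      qed
      ultimately have "l (x [^] m) = l a" using max xm by auto
      moreover have "x \<in> l (x [^] m)"
        using k m nat_pow_Suc2[OF x(2), of m] x by (auto simp: l_def)
      ultimately show ?thesis by (auto simp: l_def x_def)
    qed
  qed
  then show False using prime_ringD[OF prime aR aR] a by blast
qed

end

section \<open>Factor rings by a two-sided ideal\<close>

lemma (in ideal) in_carrier_quotient_iff: "C \<in> carrier (R Quot I) \<longleftrightarrow> (\<exists>x\<in>carrier R. C = I +> x)"
  by (auto simp: FactRing_def A_RCOSETS_def')

lemma (in ideal) rcos_eq_zero_iff: "x \<in> carrier R \<Longrightarrow> I +> x = \<zero>\<^bsub>R Quot I\<^esub> \<longleftrightarrow> x \<in> I"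
  using a_rcos_const[of x] a_rcos_self[of x] by (auto simp: FactRing_def)

lemma (in ideal) prime_ring_quotient:
  assumes "I \<in> Spec R"
  shows "prime_ring (R Quot I)"
proof -
  interpret h: ring_hom_ring R "R Quot I" "(+>) I" by (rule rcos_ring_hom_ring)
  note zero = rcos_eq_zero_iff
  have P: "\<one> \<notin> I" "\<And>a b. a \<in> carrier R \<Longrightarrow> b \<in> carrier R \<Longrightarrow>
     (\<And>r. r \<in> carrier R \<Longrightarrow> a \<otimes> r \<otimes> b \<in> I) \<Longrightarrow> a \<in> I \<or> b \<in> I"
    using assms Spec_iff by auto
  show ?thesis
    unfolding prime_ring_def h.S.Spec_iff
  proof (intro conjI ballI impI)
    show "ideal {\<zero>\<^bsub>R Quot I\<^esub>} (R Quot I)" by (rule h.S.zeroideal)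
    show "\<one>\<^bsub>R Quot I\<^esub> \<notin> {\<zero>\<^bsub>R Quot I\<^esub>}" using P(1) zero[of \<one>] h.hom_one by simp
    fix A B assume AB: "A \<in> carrier (R Quot I)" "B \<in> carrier (R Quot I)"
      "\<forall>C\<in>carrier (R Quot I). A \<otimes>\<^bsub>R Quot I\<^esub> C \<otimes>\<^bsub>R Quot I\<^esub> B \<in> {\<zero>\<^bsub>R Quot I\<^esub>}"
    obtain a b where ab: "a \<in> carrier R" "A = I +> a" "b \<in> carrier R" "B = I +> b"
      using AB in_carrier_quotient_iff by auto
    have "a \<otimes> r \<otimes> b \<in> I" if "r \<in> carrier R" for r
    proof -
      have "I +> (a \<otimes> r \<otimes> b) = \<zero>\<^bsub>R Quot I\<^esub>"
        using AB(3)[rule_format, of "I +> r"] that ab h.hom_closed[OF that] by simp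
      then show ?thesis using zero[of "a \<otimes> r \<otimes> b"] that ab by simp
    qed
    then show "A \<in> {\<zero>\<^bsub>R Quot I\<^esub>} \<or> B \<in> {\<zero>\<^bsub>R Quot I\<^esub>}"
      using P(2)[OF ab(1,3)] zero ab by auto
  qed
qed

lemma (in ideal) left_noetherian_quotient:
  assumes "left_noetherian R"
  shows "left_noetherian (R Quot I)"
  unfolding left_noetherian_def
proof (intro allI impI)
  interpret h: ring_hom_ring R "R Quot I" "(+>) I" by (rule rcos_ring_hom_ring)
  fix F assume F: "F \<noteq> {}" "\<forall>J\<in>F. left_ideal J (R Quot I)"
  define pre where "pre J = {x \<in> carrier R. I +> x \<in> J}" for J
  have J: "additive_subgroup J (R Quot I)" if "J \<in> F" for J
    using F that by (simp add: left_ideal_def)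
  have pre: "left_ideal (pre J) R" if "J \<in> F" for J
    using J[OF that] F that
    by (intro left_idealI)
      (auto simp: pre_def left_ideal_def additive_subgroup.zero_closed additive_subgroup.a_closed)
  obtain K where K: "K \<in> pre ` F" "\<And>J'. J' \<in> pre ` F \<Longrightarrow> K \<subseteq> J' \<Longrightarrow> J' = K"
    by (rule left_noetherianD[OF assms, of "pre ` F"]) (use F(1) pre in auto)
  then obtain J where "J \<in> F" "K = pre J" by auto
  then have J': "J \<in> F" "\<And>J'. J' \<in> F \<Longrightarrow> pre J \<subseteq> pre J' \<Longrightarrow> pre J' = pre J"
    using K(2) by simp_all
  have "J' = J" if "J' \<in> F" "J \<subseteq> J'" for J'
  proof -
    have "pre J' = pre J" using J'(2)[OF that(1)] that(2) by (auto simp: pre_def)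
    moreover have "K = (+>) I ` pre K" if "K \<in> F" for K
    proof -
      have "K \<subseteq> carrier (R Quot I)" using J[OF that] by (rule additive_subgroup.a_subset)
      then have "\<exists>x\<in>pre K. C = I +> x" if "C \<in> K" for C
        using in_carrier_quotient_iff[of C] that by (auto simp: pre_def)
      then show ?thesis by (auto simp: pre_def)
    qed
    ultimately show ?thesis using that J'(1) by metis
  qed
  then show "\<exists>J\<in>F. \<forall>J'\<in>F. J \<subseteq> J' \<longrightarrow> J' = J" using J'(1) by blast
qed

text \<open>\<open>Z\<close> is any central subring rather than the whole center: the setting has to
  pass to factor rings, where the image of the center may be smaller than the center.\<close>

locale integral_extension = ring R for R (structure) +
  fixes Z
  assumes Z_subring: "subring Z R"
    and Z_central: "\<And>z r. z \<in> Z \<Longrightarrow> r \<in> carrier R \<Longrightarrow> z \<otimes> r = r \<otimes> z"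
    and integral: "integral_over R Z"
begin

lemmas Z_closed [simp, intro] = subringE(2-3,5-7)[OF Z_subring]

lemma Z_carr [simp]: "z \<in> Z \<Longrightarrow> z \<in> carrier R"
  using subringE(1)[OF Z_subring] by blast

lemma Z_pow [simp, intro]: "z \<in> Z \<Longrightarrow> z [^] (n::nat) \<in> Z"
  by (induction n) (auto simp: nat_pow_Suc)

lemma integralE:
  assumes "u \<in> carrier R"
  obtains cs where "set cs \<subseteq> Z" "eval (\<one> # cs) u = \<zero>"
  using integral assms unfolding integral_over_def by blast

lemma eval_Z_closed [simp]: "set xs \<subseteq> Z \<Longrightarrow> u \<in> carrier R \<Longrightarrow> eval xs u \<in> carrier R"
  by (rule eval_in_carrier) auto

lemma Spec_center_iff:
  "\<pp> \<in> Spec (R\<lparr>carrier := Z\<rparr>) \<longleftrightarrow> ideal \<pp> (R\<lparr>carrier := Z\<rparr>) \<and> \<one> \<notin> \<pp> \<and>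
     (\<forall>a\<in>Z. \<forall>b\<in>Z. a \<otimes> b \<in> \<pp> \<longrightarrow> a \<in> \<pp> \<or> b \<in> \<pp>)"
proof -
  interpret Z: ring "R\<lparr>carrier := Z\<rparr>" by (rule subring_is_ring[OF Z_subring])
  have "(\<forall>r\<in>Z. a \<otimes> r \<otimes> b \<in> \<pp>) \<longleftrightarrow> a \<otimes> b \<in> \<pp>"
    if "a \<in> Z" "b \<in> Z" "ideal \<pp> (R\<lparr>carrier := Z\<rparr>)" for a b
  proof -
    have "a \<otimes> r \<otimes> b = r \<otimes> (a \<otimes> b)" if "r \<in> Z" for r
      using that \<open>a \<in> Z\<close> \<open>b \<in> Z\<close> Z_central[of a r] by (simp add: m_assoc)
    moreover have "a \<otimes> b = \<one> \<otimes> (a \<otimes> b)" using that by simp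
    ultimately show ?thesis
      using ideal.I_l_closed[OF that(3), of "a \<otimes> b"] Z_closed(2)
      by (auto dest: bspec[of _ _ \<one>])
  qed
  then show ?thesis
    unfolding Z.Spec_iff by simp blast
qed

lemma Spec_centerD:
  assumes "\<pp> \<in> Spec (R\<lparr>carrier := Z\<rparr>)"
  shows "\<pp> \<subseteq> Z" "\<zero> \<in> \<pp>" "\<one> \<notin> \<pp>"
    and "\<And>a b. a \<in> \<pp> \<Longrightarrow> b \<in> \<pp> \<Longrightarrow> a \<oplus> b \<in> \<pp>"
    and "\<And>a. a \<in> \<pp> \<Longrightarrow> \<ominus> a \<in> \<pp>"
    and "\<And>a z. a \<in> \<pp> \<Longrightarrow> z \<in> Z \<Longrightarrow> z \<otimes> a \<in> \<pp>" "\<And>a z. a \<in> \<pp> \<Longrightarrow> z \<in> Z \<Longrightarrow> a \<otimes> z \<in> \<pp>"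
    and "\<And>a b. a \<in> Z \<Longrightarrow> b \<in> Z \<Longrightarrow> a \<otimes> b \<in> \<pp> \<Longrightarrow> a \<in> \<pp> \<or> b \<in> \<pp>"
    and "\<And>a n. a \<in> Z \<Longrightarrow> a [^] (n::nat) \<in> \<pp> \<Longrightarrow> a \<in> \<pp>"
proof -
  have i: "ideal \<pp> (R\<lparr>carrier := Z\<rparr>)" and "\<one> \<notin> \<pp>"
    and prime: "\<And>a b. a \<in> Z \<Longrightarrow> b \<in> Z \<Longrightarrow> a \<otimes> b \<in> \<pp> \<Longrightarrow> a \<in> \<pp> \<or> b \<in> \<pp>"
    using assms unfolding Spec_center_iff by auto
  show "\<pp> \<subseteq> Z" using ideal.Icarr[OF i] by auto
  show "\<zero> \<in> \<pp>" "\<And>a b. a \<in> \<pp> \<Longrightarrow> b \<in> \<pp> \<Longrightarrow> a \<oplus> b \<in> \<pp>"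
    using ideal_closed(2,3)[OF i] by auto
  show l: "\<And>a z. a \<in> \<pp> \<Longrightarrow> z \<in> Z \<Longrightarrow> z \<otimes> a \<in> \<pp>" "\<And>a z. a \<in> \<pp> \<Longrightarrow> z \<in> Z \<Longrightarrow> a \<otimes> z \<in> \<pp>"
    using ideal_closed(5,6)[OF i] by auto
  show "\<ominus> a \<in> \<pp>" if "a \<in> \<pp>" for a
    using l(1)[OF that, of "\<ominus> \<one>"] that \<open>\<pp> \<subseteq> Z\<close> l_minus[of \<one> a] by auto
  show "a \<in> \<pp>" if "a \<in> Z" "a [^] n \<in> \<pp>" for a and n :: nat
    using that(2) by (induction n) (use \<open>\<one> \<notin> \<pp>\<close> prime that(1) in \<open>auto simp: nat_pow_Suc\<close>)
qed (use assms Spec_center_iff in auto)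

section \<open>Lying over and going up\<close>

lemma left_mult_ideal:
  assumes "p \<in> Z"
  shows "ideal {p \<otimes> r |r. r \<in> carrier R} R"
proof (rule two_sided_idealI)
  have *: "r \<otimes> (p \<otimes> t) = p \<otimes> (r \<otimes> t)" if "r \<in> carrier R" "t \<in> carrier R" for r t
    using that assms Z_central[of p r] by (simp flip: m_assoc)
  show "r \<otimes> x \<in> {p \<otimes> r |r. r \<in> carrier R}"
    if "x \<in> {p \<otimes> r |r. r \<in> carrier R}" "r \<in> carrier R" for x r
    using that * by fastforce
  show "x \<otimes> r \<in> {p \<otimes> r |r. r \<in> carrier R}"
    if "x \<in> {p \<otimes> r |r. r \<in> carrier R}" "r \<in> carrier R" for x r
    using that assms m_assoc[of p] by (fastforce intro: m_closed)
  show "x \<oplus> y \<in> {p \<otimes> r |r. r \<in> carrier R}"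
    if "x \<in> {p \<otimes> r |r. r \<in> carrier R}" "y \<in> {p \<otimes> r |r. r \<in> carrier R}" for x y
    using that assms by (auto simp flip: r_distr)
  show "\<zero> \<in> {p \<otimes> r |r. r \<in> carrier R}" using assms r_null[of p] by force
qed (use assms in auto)

text \<open>Multiplying a monic equation of \<open>u\<close> by powers of the central element \<open>p\<close> turns it
  into an equation for \<open>p u\<close>, which is congruent to the central element \<open>a\<close>.\<close>

lemma eval_scaled_mod_ideal:
  assumes P: "ideal P R" and "p \<in> Z" "a \<in> Z" "u \<in> carrier R" "q \<in> P" "a = q \<oplus> p \<otimes> u"
    and "set xs \<subseteq> Z"
  shows "\<exists>b\<in>Z. p [^] length xs \<otimes> eval (\<one> # xs) u \<ominus> (a [^] length xs \<oplus> p \<otimes> b) \<in> P"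
  using \<open>set xs \<subseteq> Z\<close>
proof (induction xs rule: rev_induct)
  case Nil
  have "p [^] (0::nat) \<otimes> eval [\<one>] u \<ominus> (a [^] (0::nat) \<oplus> p \<otimes> \<zero>) = \<zero>"
    using assms by (simp add: minus_eq r_neg)
  then show ?case
    using ideal_closed(2)[OF P] by (metis Z_closed(1) list.size(3))
next
  case (snoc c xs)
  define n where "n = length xs"
  define E where "E = eval (\<one> # xs) u"
  have pR [simp]: "p \<in> carrier R" "a \<in> carrier R" "q \<in> carrier R" "u \<in> carrier R" "c \<in> carrier R"
    "p [^] n \<in> carrier R" "a [^] n \<in> carrier R"
    using assms snoc by (auto simp: ideal_closed)
  have E [simp]: "E \<in> carrier R" using snoc by (auto simp: E_def simp del: eval.simps)
  obtain b where b: "b \<in> Z" "p [^] n \<otimes> E \<ominus> (a [^] n \<oplus> p \<otimes> b) \<in> P"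
    using snoc by (auto simp: n_def E_def)
  have [simp]: "b \<in> carrier R" using b by simp
  define d where "d = p [^] n \<otimes> E \<ominus> (a [^] n \<oplus> p \<otimes> b)"
  have [simp]: "d \<in> carrier R" by (simp add: d_def)
  have dP: "d \<in> P" using b by (simp add: d_def)
  have Xd: "p [^] n \<otimes> E = d \<oplus> (a [^] n \<oplus> p \<otimes> b)"
    unfolding d_def by (simp add: minus_eq a_assoc l_neg)
  have pu: "p \<otimes> u = a \<ominus> q"
    using assms(6) pR by (metis a_comm add.inv_solve_right m_closed minus_eq)
  have ev: "eval (\<one> # xs @ [c]) u = E \<otimes> u \<oplus> c"
    using eval_append_aux[of "\<one> # xs" c u] snoc.prems Z_carr by (fastforce simp: E_def simp del: eval.simps)
  have pE: "p \<otimes> (E \<otimes> u) = E \<otimes> (p \<otimes> u)"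
    using Z_central[OF \<open>p \<in> Z\<close>, of E] by (simp flip: m_assoc)
  \<comment> \<open>Since \<open>p u = a - q\<close>, the new factor \<open>p u\<close> acts as
    \<open>a\<close> modulo \<open>P\<close>. The next witness is therefore
    \<open>b a + p^n c\<close>.\<close>
  have "p [^] Suc n \<otimes> eval (\<one> # xs @ [c]) u = (p [^] n \<otimes> E) \<otimes> (p \<otimes> u) \<oplus> p [^] n \<otimes> (p \<otimes> c)"
    unfolding ev by (simp add: nat_pow_Suc m_assoc r_distr pE)
  also have "\<dots> = d \<otimes> (p \<otimes> u) \<oplus> (a [^] n \<oplus> p \<otimes> b) \<otimes> (a \<ominus> q) \<oplus> p [^] n \<otimes> (p \<otimes> c)"
    unfolding Xd by (simp add: l_distr pu)
  also have "p [^] n \<otimes> (p \<otimes> c) = p \<otimes> (p [^] n \<otimes> c)"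
    using Z_central[OF \<open>p \<in> Z\<close>, of "p [^] n"] by (simp flip: m_assoc)
  finally have "p [^] Suc n \<otimes> eval (\<one> # xs @ [c]) u = (d \<otimes> (p \<otimes> u) \<ominus> (a [^] n \<oplus> p \<otimes> b) \<otimes> q) \<oplus>
      (a [^] Suc n \<oplus> p \<otimes> (b \<otimes> a \<oplus> p [^] n \<otimes> c))"
    by (simp add: nat_pow_Suc minus_eq l_distr r_distr m_assoc r_minus l_minus minus_add a_ac del: eval.simps)
  moreover have "(x \<oplus> y) \<ominus> y = x" if "x \<in> carrier R" "y \<in> carrier R" for x y
    using that by (simp add: minus_eq a_assoc r_neg)
  ultimately have eq: "p [^] Suc n \<otimes> eval (\<one> # xs @ [c]) u \<ominus> (a [^] Suc n \<oplus> p \<otimes> (b \<otimes> a \<oplus> p [^] n \<otimes> c))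
      = d \<otimes> (p \<otimes> u) \<ominus> (a [^] n \<oplus> p \<otimes> b) \<otimes> q"
    by simp
  have "d \<otimes> (p \<otimes> u) \<ominus> (a [^] n \<oplus> p \<otimes> b) \<otimes> q \<in> P"
    unfolding minus_eq using dP assms by (simp add: ideal_closed[OF P])
  moreover have "b \<otimes> a \<oplus> p [^] n \<otimes> c \<in> Z"
    using b assms snoc by auto
  ultimately have "\<exists>b\<in>Z. p [^] Suc n \<otimes> eval (\<one> # xs @ [c]) u \<ominus> (a [^] Suc n \<oplus> p \<otimes> b) \<in> P"
    using eq by metis
  then show ?case
    by (simp add: n_def del: eval.simps)
qed

text \<open>Let \<open>P\<close> be maximal among the ideals above \<open>I\<close> that avoid
  \<open>Z - \<pp>\<close>. If some \<open>p\<close> in \<open>\<pp>\<close> were outside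
  \<open>P\<close>, then \<open>P + p R\<close> would contain a central \<open>a = q + p u\<close>
  outside \<open>\<pp>\<close>; the monic equation of \<open>u\<close>, scaled by a power of
  \<open>p\<close>, puts \<open>a^n + p b\<close> into \<open>P\<close> and thus into
  \<open>\<pp>\<close>, so \<open>a\<close> would lie in \<open>\<pp>\<close>. A general
  \<open>I\<close> serves lying over and going up at once.\<close>

lemma exists_prime_over:
  assumes noeth: "left_noetherian R" and \<pp>: "\<pp> \<in> Spec (R\<lparr>carrier := Z\<rparr>)"
    and I: "ideal I R" "I \<inter> Z \<subseteq> \<pp>"
  obtains P where "P \<in> Spec R" "I \<subseteq> P" "P \<inter> Z = \<pp>"
proof -
  note p = Spec_centerD[OF \<pp>]
  obtain P where P: "P \<in> Spec R" "I \<subseteq> P" "P \<inter> (Z - \<pp>) = {}"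
    and max: "\<And>J. ideal J R \<Longrightarrow> P \<subset> J \<Longrightarrow> J \<inter> (Z - \<pp>) \<noteq> {}"
  proof (rule exists_prime_avoiding[OF noeth I(1)])
    show "I \<inter> (Z - \<pp>) = {}" using I by blast
    show "Z - \<pp> \<noteq> {}" using p by auto
    show "\<exists>r\<in>carrier R. x \<otimes> r \<otimes> y \<in> Z - \<pp>" if "x \<in> Z - \<pp>" "y \<in> Z - \<pp>" for x y
      using that p(8) by (intro bexI[of _ \<one>]) auto
  qed auto
  have idl: "ideal P R" using P by (simp add: Spec_def)
  have "p \<in> P" if "p \<in> \<pp>" for p
  proof (rule ccontr)
    assume "p \<notin> P"
    have pZ: "p \<in> Z" using that p by auto
    define J where "J = {p \<otimes> r |r. r \<in> carrier R}"
    have J: "ideal J R" unfolding J_def by (rule left_mult_ideal[OF pZ])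
    have "p \<in> J" using pZ r_one[of p] by (force simp: J_def)
    then have "P \<subset> P <+>\<^bsub>R\<^esub> J" using \<open>p \<notin> P\<close> ideal_add_ideal[OF idl J] by blast
    then obtain a where "a \<in> P <+>\<^bsub>R\<^esub> J" "a \<in> Z - \<pp>"
      using max ideal_add_ideal(1)[OF idl J] by blast
    then obtain q u where qu: "q \<in> P" "u \<in> carrier R" "a = q \<oplus> p \<otimes> u" "a \<in> Z" "a \<notin> \<pp>"
      unfolding set_add_def' J_def by blast
    obtain cs where cs: "set cs \<subseteq> Z" "eval (\<one> # cs) u = \<zero>"
      using integralE[OF qu(2)] by blast
    obtain b where b: "b \<in> Z" "p [^] length cs \<otimes> \<zero> \<ominus> (a [^] length cs \<oplus> p \<otimes> b) \<in> P"
      using eval_scaled_mod_ideal[OF idl pZ qu(4,2,1,3) cs(1)] cs(2) by auto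
    have abZ: "a [^] length cs \<oplus> p \<otimes> b \<in> Z" "a [^] length cs \<in> Z" "p \<otimes> b \<in> Z"
      using qu pZ b by auto
    have "\<ominus> (a [^] length cs \<oplus> p \<otimes> b) \<in> P"
      using b pZ abZ by (simp add: minus_eq)
    then have "\<ominus> (\<ominus> (a [^] length cs \<oplus> p \<otimes> b)) \<in> P"
      by (rule ideal_closed(4)[OF idl])
    then have "a [^] length cs \<oplus> p \<otimes> b \<in> P"
      using Z_carr[OF abZ(1)] by simp
    then have "a [^] length cs \<oplus> p \<otimes> b \<in> \<pp>"
      using abZ P by blast
    moreover have "a [^] length cs = (a [^] length cs \<oplus> p \<otimes> b) \<oplus> \<ominus> (p \<otimes> b)"
      using Z_carr[OF abZ(2)] Z_carr[OF abZ(3)] by (simp add: a_assoc r_neg)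
    ultimately have "a [^] length cs \<in> \<pp>"
      using p(4,5,7) b(1) that by metis
    then show False using p(9) qu by blast
  qed
  then have "P \<inter> Z = \<pp>" using P p by auto
  then show thesis using that P by blast
qed

section \<open>Nonzero ideals of a prime ring meet the central subring\<close>

lemma nonzero_central_cancel:
  assumes "prime_ring R" "c \<in> Z" "c \<noteq> \<zero>" "x \<in> carrier R" "c \<otimes> x = \<zero>"
  shows "x = \<zero>"
proof -
  have "c \<otimes> r \<otimes> x = \<zero>" if "r \<in> carrier R" for r
    using that assms Z_central[of c r] by (simp add: m_assoc)
  then show ?thesis
    using prime_ringD[OF assms(1), of c x] assms by auto
qed

lemma nonzero_central_mult:
  assumes "prime_ring R" "c \<in> Z" "c \<noteq> \<zero>" "d \<in> Z" "d \<noteq> \<zero>"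
  shows "c \<otimes> d \<in> Z - {\<zero>}"
  using nonzero_central_cancel[OF assms(1-3), of d] assms by auto

lemma nonzero_central_pow:
  assumes "prime_ring R" "c \<in> Z" "c \<noteq> \<zero>"
  shows "c [^] (n::nat) \<noteq> \<zero>"
  by (induction n)
    (use assms prime_ring_one_neq_zero nonzero_central_mult[OF assms(1) Z_pow[OF assms(2)] _ assms(2,3)]
      in \<open>auto simp: nat_pow_Suc\<close>)

text \<open>Powers of \<open>x\<close> are split off up to the lowest nonzero coefficient
  \<open>c\<close>. The remaining \<open>h\<close> is a polynomial in \<open>x\<close> over
  \<open>Z\<close> and so commutes with \<open>x\<close>.\<close>

lemma eval_lowest_term:
  assumes "set xs \<subseteq> Z" "\<exists>c\<in>set xs. c \<noteq> \<zero>" and x: "x \<in> carrier R"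
  shows "\<exists>k::nat. \<exists>c\<in>Z - {\<zero>}. \<exists>h\<in>carrier R. h \<otimes> x = x \<otimes> h \<and>
    eval xs x = x [^] k \<otimes> (c \<oplus> x \<otimes> h)"
  using assms(1,2)
proof (induction xs rule: rev_induct)
  case (snoc c xs)
  have xs: "set xs \<subseteq> carrier R" and c: "c \<in> Z" using snoc.prems Z_carr by auto
  have ev: "eval (xs @ [c]) x = eval xs x \<otimes> x \<oplus> c"
    using xs c x by (intro eval_append_aux) auto
  show ?case
  proof (cases "c = \<zero>")
    case False
    have E: "eval xs x \<in> carrier R" using xs x by (rule eval_in_carrier)
    have com: "eval xs x \<otimes> x = x \<otimes> eval xs x"
      using snoc.prems Z_central x xs by (intro eval_commute) auto
    have "eval (xs @ [c]) x = x [^] (0::nat) \<otimes> (c \<oplus> x \<otimes> eval xs x)"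
      using ev com x E c by (simp add: a_comm)
    then show ?thesis using False c com E by blast
  next
    case True
    then obtain k d h where IH: "d \<in> Z - {\<zero>}" "h \<in> carrier R" "h \<otimes> x = x \<otimes> h"
      "eval xs x = x [^] (k::nat) \<otimes> (d \<oplus> x \<otimes> h)"
      using snoc by auto
    have "(d \<oplus> x \<otimes> h) \<otimes> x = x \<otimes> (d \<oplus> x \<otimes> h)"
      using IH x Z_central[of d x] by (simp add: l_distr r_distr m_assoc)
    then have "eval (xs @ [c]) x = x [^] Suc k \<otimes> (d \<oplus> x \<otimes> h)"
      using ev True IH x by (simp add: nat_pow_Suc m_assoc)
    then show ?thesis using IH by blast
  qed
qed simp

text \<open>With \<open>x\<^sup>k (c + x h) = 0\<close> and \<open>w = - x h\<close> one has \<open>c\<^sup>j x\<^sup>k = x\<^sup>k w\<^sup>j\<close>, so that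
  \<open>e = w\<^sup>k\<^sup>+\<^sup>1\<close> satisfies \<open>e\<^sup>2 = c\<^sup>k\<^sup>+\<^sup>1 e\<close>.\<close>

lemma almost_idempotent:
  assumes prime: "prime_ring R" and x: "x \<in> carrier R" and "\<And>n::nat. x [^] n \<noteq> \<zero>"
  obtains v d where "v \<in> carrier R" "d \<in> Z - {\<zero>}" "x \<otimes> v \<noteq> \<zero>" "(x \<otimes> v) \<otimes> (x \<otimes> v) = d \<otimes> (x \<otimes> v)"
proof -
  obtain cs where cs: "set cs \<subseteq> Z" "eval (\<one> # cs) x = \<zero>"
    using integralE[OF x] by blast
  then obtain k :: nat and c h where h: "c \<in> Z - {\<zero>}" "h \<in> carrier R" "h \<otimes> x = x \<otimes> h"
      "x [^] k \<otimes> (c \<oplus> x \<otimes> h) = \<zero>"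
    using eval_lowest_term[of "\<one> # cs" x] x prime_ring_one_neq_zero[OF prime]
    by (fastforce simp del: eval.simps)
  define g where "g = \<ominus> h"
  have g: "g \<in> carrier R" "g \<otimes> x = x \<otimes> g" using h x by (simp_all add: g_def l_minus r_minus)
  define w where "w = x \<otimes> g"
  have w: "w \<in> carrier R" "w \<otimes> x = x \<otimes> w" using g x by (simp_all add: w_def m_assoc)
  have [simp]: "c \<in> carrier R" using h by simp
  have xk: "x [^] k \<in> carrier R" using x by simp
  have cxk: "c \<otimes> x [^] k = x [^] k \<otimes> w"
  proof -
    have "x [^] k \<otimes> c = \<ominus> (x [^] k \<otimes> (x \<otimes> h))"
      using h(4) x h(2) by (simp add: r_distr add.inv_equality minus_equality)
    also have "\<dots> = x [^] k \<otimes> w" using x h by (simp add: w_def g_def r_minus)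
    finally show ?thesis using Z_central[of c "x [^] k"] h x by simp
  qed
  have cj: "c [^] j \<otimes> x [^] k = x [^] k \<otimes> w [^] j" for j :: nat
  proof (induction j)
    case (Suc j)
    have "c [^] Suc j \<otimes> x [^] k = c [^] j \<otimes> (x [^] k \<otimes> w)"
      using x by (simp add: nat_pow_Suc m_assoc cxk)
    also have "\<dots> = x [^] k \<otimes> w [^] j \<otimes> w"
      using x w Suc by (simp flip: m_assoc)
    finally show ?case using x w by (simp add: nat_pow_Suc m_assoc)
  qed (use x in simp)
  define d where "d = c [^] Suc k"
  define e where "e = w [^] Suc k"
  have d: "d \<in> Z - {\<zero>}" using h nonzero_central_pow[OF prime, of c "Suc k"] by (auto simp: d_def simp del: nat_pow_Suc)
  have dR: "d \<in> carrier R" using d by simp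
  have e: "e \<in> carrier R" using w by (simp add: e_def)
  have de: "d \<otimes> x [^] k = x [^] k \<otimes> e" unfolding d_def e_def by (rule cj)
  have "e \<noteq> \<zero>"
  proof
    assume "e = \<zero>"
    then have "d \<otimes> x [^] k = \<zero>" using de x by simp
    then show False using nonzero_central_cancel[OF prime] d assms(3)[of k] xk by auto
  qed
  \<comment> \<open>Writing \<open>e\<close> with \<open>x^k\<close> as its last factor makes
    \<open>x^k e = d x^k\<close> applicable to the product \<open>e e\<close>.\<close>
  have eq: "e = g [^] Suc k \<otimes> x \<otimes> x [^] k"
  proof -
    have "e = (g \<otimes> x) [^] Suc k" unfolding e_def w_def using g by simp
    also have "\<dots> = g [^] Suc k \<otimes> x [^] Suc k" by (rule pow_mult_distrib) (use g x in auto)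
    finally show ?thesis using nat_pow_Suc2[OF x, of k] g(1) x by (simp add: m_assoc del: nat_pow_Suc)
  qed
  have "e \<otimes> e = g [^] Suc k \<otimes> x \<otimes> (x [^] k \<otimes> e)"
    using eq e g x by (metis m_assoc m_closed nat_pow_closed)
  also have "\<dots> = g [^] Suc k \<otimes> x \<otimes> (d \<otimes> x [^] k)" by (simp add: de)
  also have "\<dots> = (g [^] Suc k \<otimes> x \<otimes> d) \<otimes> x [^] k" using g x dR by (simp add: m_assoc del: nat_pow_Suc)
  also have "\<dots> = d \<otimes> (g [^] Suc k \<otimes> x) \<otimes> x [^] k"
    using Z_central[of d "g [^] Suc k \<otimes> x"] d g x by (simp del: nat_pow_Suc)
  also have "\<dots> = d \<otimes> e" using eq g x dR by (simp add: m_assoc del: nat_pow_Suc)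
  finally have ee: "e \<otimes> e = d \<otimes> e" .
  have "e = x \<otimes> (g \<otimes> w [^] k)"
    using w g x nat_pow_Suc2[OF w(1), of k] by (simp add: e_def w_def m_assoc del: nat_pow_Suc)
  then show thesis
    using that[of "g \<otimes> w [^] k" d] ee \<open>e \<noteq> \<zero>\<close> d g w by auto
qed

text \<open>Among the almost idempotents \<open>e\<close> of the ideal take one with the largest left ideal
  \<open>{y. y d = y e}\<close>: if \<open>e\<close> is not \<open>d\<close>, then an almost idempotent \<open>f\<close> with \<open>e f = 0\<close>
  produces a larger one.\<close>

lemma ideal_meets_center:
  assumes noeth: "left_noetherian R" and prime: "prime_ring R"
    and I: "ideal I R" "I \<noteq> {\<zero>}"
  shows "\<exists>z\<in>I \<inter> Z. z \<noteq> \<zero>"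
proof -
  define T where "T = {(e, d). e \<in> I \<and> e \<noteq> \<zero> \<and> d \<in> Z - {\<zero>} \<and> e \<otimes> e = d \<otimes> e}"
  define E where "E = (\<lambda>(e, d). {y \<in> carrier R. y \<otimes> d = y \<otimes> e})"
  note IR = ideal_closed(1)[OF I(1)]
  have almost: "\<exists>f\<in>N. \<exists>d. (f, d) \<in> T"
    if N: "N \<subseteq> I" "\<And>x r. x \<in> N \<Longrightarrow> r \<in> carrier R \<Longrightarrow> x \<otimes> r \<in> N" "\<not> N \<subseteq> {\<zero>}" for N
  proof -
    have "\<not> (\<forall>x\<in>N. \<exists>n::nat. x [^] n = \<zero>)"
      using nil_right_ideal_zero[OF noeth prime, of N] N IR by blast
    then obtain x where x: "x \<in> N" "\<And>n::nat. x [^] n \<noteq> \<zero>" by blast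
    then have "x \<in> carrier R" using N IR by blast
    then obtain v d where "v \<in> carrier R" "d \<in> Z - {\<zero>}" "x \<otimes> v \<noteq> \<zero>" "(x \<otimes> v) \<otimes> (x \<otimes> v) = d \<otimes> (x \<otimes> v)"
      using x(2) by (rule almost_idempotent[OF prime])
    then have "x \<otimes> v \<in> N" "(x \<otimes> v, d) \<in> T" using N x by (auto simp: T_def)
    then show ?thesis by blast
  qed
  have El: "left_ideal (E p) R" if "p \<in> T" for p
    using that IR
    by (intro left_idealI) (auto simp: T_def E_def l_distr m_assoc split: prod.splits)
  have "T \<noteq> {}"
    using almost[of I] I ideal_closed(2,6)[OF I(1)] by blast
  obtain p where p: "p \<in> T" "\<And>p'. p' \<in> T \<Longrightarrow> E p \<subseteq> E p' \<Longrightarrow> E p' = E p"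
  proof (rule left_noetherianD[OF noeth, of "E ` T"])
    show "E ` T \<noteq> {}" using \<open>T \<noteq> {}\<close> by simp
    show "left_ideal J R" if "J \<in> E ` T" for J using that El by blast
  qed auto
  obtain e d where ed: "p = (e, d)" by (cases p)
  have e: "e \<in> I" "e \<noteq> \<zero>" "d \<in> Z - {\<zero>}" "e \<otimes> e = d \<otimes> e" using p by (auto simp: ed T_def)
  have eR [simp]: "e \<in> carrier R" "d \<in> carrier R" using e IR by auto
  show ?thesis
  \<comment> \<open>As \<open>e (d - e) = 0\<close>, the set \<open>(d - e) I\<close> is killed by
    \<open>e\<close> from the left. If only zero is, primeness gives \<open>d = e\<close>, and
    \<open>e\<close> is the central element sought.\<close>
  proof (cases "{f \<in> I. e \<otimes> f = \<zero>} \<subseteq> {\<zero>}")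
    case True
    have *: "(d \<ominus> e) \<otimes> y = \<zero>" if y: "y \<in> I" for y
    proof -
      have yR: "y \<in> carrier R" using y IR by simp
      have "(d \<ominus> e) \<otimes> y \<in> I" using y ideal_closed(5)[OF I(1)] by simp
      moreover have "e \<otimes> ((d \<ominus> e) \<otimes> y) = \<zero>"
      proof -
        have "e \<otimes> (d \<ominus> e) = e \<otimes> d \<ominus> e \<otimes> e" by (simp add: minus_eq r_distr r_minus)
        also have "\<dots> = \<zero>" using Z_central[of d e] e by (simp add: minus_eq r_neg)
        finally show ?thesis using yR by (simp flip: m_assoc)
      qed
      ultimately show ?thesis using True by auto
    qed
    have "(d \<ominus> e) \<otimes> r \<otimes> e = \<zero>" if "r \<in> carrier R" for r
      using *[of "r \<otimes> e"] that ideal_closed(5)[OF I(1) e(1)] by (simp add: m_assoc)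
    then have "d \<ominus> e = \<zero>" using prime_ringD[OF prime, of "d \<ominus> e" e] e by auto
    then have "d = e" by (simp add: r_right_minus_eq)
    then show ?thesis using e by blast
  next
    case False
    have "\<exists>f\<in>{f \<in> I. e \<otimes> f = \<zero>}. \<exists>d. (f, d) \<in> T"
    proof (rule almost)
      show "x \<otimes> r \<in> {f \<in> I. e \<otimes> f = \<zero>}" if "x \<in> {f \<in> I. e \<otimes> f = \<zero>}" "r \<in> carrier R" for x r
        using that IR ideal_closed(6)[OF I(1)] by (auto simp flip: m_assoc)
    qed (use False in auto)
    then obtain f d' where f: "f \<in> I" "e \<otimes> f = \<zero>" "f \<noteq> \<zero>" "d' \<in> Z - {\<zero>}" "f \<otimes> f = d' \<otimes> f"
      by (auto simp: T_def)
    have fR [simp]: "f \<in> carrier R" "d' \<in> carrier R" using f IR by auto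
    have dc: "r \<otimes> d = d \<otimes> r" "r \<otimes> d' = d' \<otimes> r" if "r \<in> carrier R" for r
      using that Z_central[of d r] Z_central[of d' r] e f by simp_all
    have dlc: "r \<otimes> (d \<otimes> t) = d \<otimes> (r \<otimes> t)" "r \<otimes> (d' \<otimes> t) = d' \<otimes> (r \<otimes> t)"
      if "r \<in> carrier R" "t \<in> carrier R" for r t
      using that dc[of r] by (metis eR(2) m_assoc, metis fR(2) m_assoc)
    define D where "D = d \<otimes> d'"
    have D: "D \<in> Z - {\<zero>}" unfolding D_def using nonzero_central_mult[OF prime] e f by blast
    \<comment> \<open>For idempotents, where \<open>d = d' = 1\<close>, this is
      \<open>e + f - f e\<close>, the complement of \<open>(1 - f) (1 - e)\<close>; the factors
      \<open>d\<close> and \<open>d'\<close> clear the denominators.\<close>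
    define e' where "e' = (d' \<otimes> e \<oplus> d \<otimes> f) \<ominus> f \<otimes> e"
    have e'I: "e' \<in> I"
      unfolding e'_def minus_eq using e f by (intro ideal_closed(3-5)[OF I(1)]) auto
    have e'R [simp]: "e' \<in> carrier R" by (simp add: e'_def)
    have e_e': "e \<otimes> e' = D \<otimes> e"
    proof -
      have "e \<otimes> e' = d' \<otimes> (e \<otimes> e) \<oplus> d \<otimes> (e \<otimes> f) \<ominus> (e \<otimes> f) \<otimes> e"
        by (simp add: e'_def minus_eq r_distr r_minus dlc m_assoc)
      then show ?thesis using e f dlc(1)[of d' e] by (simp add: minus_eq D_def m_assoc)
    qed
    have f_e': "f \<otimes> e' = D \<otimes> f"
    proof -
      have "f \<otimes> e' = d' \<otimes> (f \<otimes> e) \<oplus> d \<otimes> (f \<otimes> f) \<ominus> (f \<otimes> f) \<otimes> e"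
        by (simp add: e'_def minus_eq r_distr r_minus dlc m_assoc)
      also have "\<dots> = d' \<otimes> (f \<otimes> e) \<oplus> d \<otimes> (d' \<otimes> f) \<ominus> d' \<otimes> (f \<otimes> e)"
        using f by (simp add: m_assoc)
      also have "\<dots> = d \<otimes> (d' \<otimes> f)"
      proof -
        have "(x \<oplus> y) \<ominus> x = y" if "x \<in> carrier R" "y \<in> carrier R" for x y
          using that a_comm[of x y] by (simp add: minus_eq a_assoc r_neg)
        then show ?thesis by simp
      qed
      finally show ?thesis by (simp add: D_def m_assoc)
    qed
    have e'e': "e' \<otimes> e' = D \<otimes> e'"
    proof -
      have DR: "D \<in> carrier R" "D \<otimes> f = f \<otimes> D" using D Z_central[of D f] by simp_all
      have "e' \<otimes> e' = d' \<otimes> (e \<otimes> e') \<oplus> d \<otimes> (f \<otimes> e') \<ominus> f \<otimes> (e \<otimes> e')"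
        by (subst (1) e'_def) (simp add: minus_eq l_distr l_minus m_assoc)
      also have "\<dots> = D \<otimes> (d' \<otimes> e) \<oplus> D \<otimes> (d \<otimes> f) \<ominus> D \<otimes> (f \<otimes> e)"
      proof -
        have "d' \<otimes> (D \<otimes> e) = D \<otimes> (d' \<otimes> e)" "d \<otimes> (D \<otimes> f) = D \<otimes> (d \<otimes> f)"
          using DR dlc by simp_all
        moreover have "f \<otimes> (D \<otimes> e) = D \<otimes> (f \<otimes> e)"
          using DR by (metis eR(1) fR(1) m_assoc)
        ultimately show ?thesis unfolding e_e' f_e' by simp
      qed
      also have "\<dots> = D \<otimes> e'"
        using DR by (simp add: e'_def minus_eq r_distr r_minus)
      finally show ?thesis .
    qed
    have "e' \<noteq> \<zero>"
    proof
      assume "e' = \<zero>"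
      then have "D \<otimes> e = \<zero>" using e_e' by simp
      then show False using nonzero_central_cancel[OF prime, of D e] D e by auto
    qed
    then have T': "(e', D) \<in> T" using e'I D e'e' by (auto simp: T_def)
    have "E p \<subseteq> E (e', D)"
    proof
      fix y assume "y \<in> E p"
      then have y: "y \<in> carrier R" "y \<otimes> d = y \<otimes> e" by (auto simp: E_def ed)
      have "d \<otimes> (y \<otimes> f) = (y \<otimes> d) \<otimes> f" using y(1) by (simp add: m_assoc dlc)
      also have "\<dots> = y \<otimes> (e \<otimes> f)" unfolding y(2) using y by (simp add: m_assoc)
      finally have "d \<otimes> (y \<otimes> f) = \<zero>" using f y by simp
      then have yf: "y \<otimes> f = \<zero>" using nonzero_central_cancel[OF prime, of d] e y by auto
      have "y \<otimes> e' = d' \<otimes> (y \<otimes> e) \<oplus> d \<otimes> (y \<otimes> f) \<ominus> (y \<otimes> f) \<otimes> e"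
        using y(1) by (simp add: e'_def minus_eq r_distr r_minus dlc m_assoc)
      also have "\<dots> = d' \<otimes> (y \<otimes> d)" using yf y by (simp add: minus_eq flip: y(2))
      also have "\<dots> = y \<otimes> D" using y(1) dc(2)[of "y \<otimes> d"] by (simp add: D_def m_assoc)
      finally show "y \<in> E (e', D)" using y by (simp add: E_def)
    qed
    then have "E (e', D) = E p" using p T' by blast
    \<comment> \<open>\<open>f\<close> witnesses that the new left ideal is strictly larger:
      \<open>f d = f e\<close> would give \<open>d (f f) = f (e f) = 0\<close>.\<close>
    moreover have "f \<in> E (e', D)" using f_e' D Z_central[of D f] by (simp add: E_def)
    ultimately have "f \<otimes> d = f \<otimes> e" by (auto simp: E_def ed)
    then have "(f \<otimes> d) \<otimes> f = f \<otimes> (e \<otimes> f)" by (simp add: m_assoc)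
    then have "d \<otimes> (f \<otimes> f) = \<zero>" using f(2) dlc(1)[of f f] by (simp add: m_assoc)
    then have "D \<otimes> f = \<zero>" using f(5) by (simp add: D_def m_assoc)
    then show ?thesis using nonzero_central_cancel[OF prime, of D f] D f by auto
  qed
qed

end

section \<open>Incomparability and a criterion for going down\<close>

lemma (in integral_extension) integral_extension_quotient:
  assumes P: "ideal P R"
  shows "integral_extension (R Quot P) ((+>) P ` Z)"
proof -
  interpret P: ideal P R by (rule P)
  interpret h: ring_hom_ring R "R Quot P" "(+>) P" by (rule P.rcos_ring_hom_ring)
  show ?thesis
  proof (intro integral_extension.intro integral_extension_axioms.intro h.S.ring_axioms)
    show "subring ((+>) P ` Z) (R Quot P)"
      by (rule h.img_is_subring[OF Z_subring])
    show "z \<otimes>\<^bsub>R Quot P\<^esub> r = r \<otimes>\<^bsub>R Quot P\<^esub> z"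
      if zr: "z \<in> (+>) P ` Z" "r \<in> carrier (R Quot P)" for z r
    proof -
      obtain a b where "a \<in> Z" "z = P +> a" "b \<in> carrier R" "r = P +> b"
        using zr P.in_carrier_quotient_iff by auto
      then show ?thesis
        using h.hom_mult[of a b] h.hom_mult[of b a] Z_central[of a b] by simp
    qed
    show "integral_over (R Quot P) ((+>) P ` Z)"
      unfolding integral_over_def
    proof
      fix A assume "A \<in> carrier (R Quot P)"
      then obtain u where u: "u \<in> carrier R" "A = P +> u"
        using P.in_carrier_quotient_iff by auto
      obtain cs where cs: "set cs \<subseteq> Z" "eval (\<one> # cs) u = \<zero>"
        using integralE[OF u(1)] by blast
      have "h.S.eval (map ((+>) P) (\<one> # cs)) (P +> u) = P +> eval (\<one> # cs) u"
        by (rule h.eval_hom'[symmetric]) (use u cs Z_carr in auto)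
      then have "h.S.eval (\<one>\<^bsub>R Quot P\<^esub> # map ((+>) P) cs) A = \<zero>\<^bsub>R Quot P\<^esub>"
        using u cs by (simp del: eval.simps h.S.eval.simps)
      then show "\<exists>cs. set cs \<subseteq> (+>) P ` Z \<and> h.S.eval (\<one>\<^bsub>R Quot P\<^esub> # cs) A = \<zero>\<^bsub>R Quot P\<^esub>"
        using cs by (intro exI[of _ "map ((+>) P) cs"]) (auto simp del: h.S.eval.simps)
    qed
  qed
qed

context integral_extension
begin

text \<open>In the prime ring \<open>R / P\<close> the image of \<open>Q\<close> is a nonzero ideal,
  so it contains the nonzero image of some \<open>z\<close> in \<open>Z\<close>. As \<open>P\<close>
  lies inside \<open>Q\<close>, the element \<open>z\<close> itself lies in \<open>Q\<close>, and it
  is not in \<open>P\<close>.\<close>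

lemma incomparability:
  assumes noeth: "left_noetherian R" and PQ: "P \<in> Spec R" "Q \<in> Spec R" "P \<subset> Q"
  shows "P \<inter> Z \<subset> Q \<inter> Z"
proof -
  have iP: "ideal P R" and iQ: "ideal Q R" using PQ by (auto simp: Spec_def)
  interpret P: ideal P R by (rule iP)
  interpret h: ring_hom_ring R "R Quot P" "(+>) P" by (rule P.rcos_ring_hom_ring)
  interpret q: integral_extension "R Quot P" "(+>) P ` Z" by (rule integral_extension_quotient[OF iP])
  define I where "I = (+>) P ` Q"
  have I: "ideal I (R Quot P)"
  proof (rule h.S.two_sided_idealI)
    show "I \<subseteq> carrier (R Quot P)" using ideal.Icarr[OF iQ] by (auto simp: I_def)
    show "\<zero>\<^bsub>R Quot P\<^esub> \<in> I"
      using ideal_closed(2)[OF iQ] h.hom_zero by (metis I_def imageI)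
    show "x \<oplus>\<^bsub>R Quot P\<^esub> y \<in> I" if "x \<in> I" "y \<in> I" for x y
    proof -
      obtain a b where ab: "a \<in> Q" "x = P +> a" "b \<in> Q" "y = P +> b" using \<open>x \<in> I\<close> \<open>y \<in> I\<close> by (auto simp: I_def)
      then have "x \<oplus>\<^bsub>R Quot P\<^esub> y = P +> (a \<oplus> b)"
        using h.hom_add[of a b] ideal.Icarr[OF iQ] by simp
      then show ?thesis
        using ab ideal_closed(3)[OF iQ, of a b] by (simp add: I_def)
    qed
    show "r \<otimes>\<^bsub>R Quot P\<^esub> x \<in> I" "x \<otimes>\<^bsub>R Quot P\<^esub> r \<in> I"
      if xr: "x \<in> I" "r \<in> carrier (R Quot P)" for x r
    proof -
      obtain a b where ab: "a \<in> Q" "x = P +> a" "b \<in> carrier R" "r = P +> b"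
        using xr P.in_carrier_quotient_iff by (auto simp: I_def)
      then have "r \<otimes>\<^bsub>R Quot P\<^esub> x = P +> (b \<otimes> a)" "x \<otimes>\<^bsub>R Quot P\<^esub> r = P +> (a \<otimes> b)"
        using h.hom_mult[of a b] h.hom_mult[of b a] ideal.Icarr[OF iQ] by simp_all
      then show "r \<otimes>\<^bsub>R Quot P\<^esub> x \<in> I" "x \<otimes>\<^bsub>R Quot P\<^esub> r \<in> I"
        using ab ideal_closed(5,6)[OF iQ, of a b] by (simp_all add: I_def)
    qed
  qed
  obtain x where x: "x \<in> Q" "x \<notin> P" "x \<in> carrier R" using PQ ideal.Icarr[OF iQ] by blast
  then have "P +> x \<in> I" "P +> x \<noteq> \<zero>\<^bsub>R Quot P\<^esub>"
    using P.rcos_eq_zero_iff by (auto simp: I_def)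
  then have "I \<noteq> {\<zero>\<^bsub>R Quot P\<^esub>}" by blast
  then obtain C where "C \<in> I" "C \<in> (+>) P ` Z" "C \<noteq> \<zero>\<^bsub>R Quot P\<^esub>"
    using q.ideal_meets_center[OF P.left_noetherian_quotient[OF noeth] P.prime_ring_quotient[OF PQ(1)] I]
    by blast
  then obtain y z where yz: "y \<in> Q" "z \<in> Z" "P +> y = P +> z" "P +> z \<noteq> \<zero>\<^bsub>R Quot P\<^esub>"
    by (auto simp: I_def)
  have "z \<notin> P" using yz P.rcos_eq_zero_iff by simp
  have "z \<in> P +> y" using yz P.a_rcos_self by (metis Z_carr)
  then obtain p where "p \<in> P" "z = p \<oplus> y" unfolding a_r_coset_def' by blast
  then have "z \<in> Q" using yz PQ ideal_closed(3)[OF iQ, of p y] by blast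
  then show ?thesis using yz PQ \<open>z \<notin> P\<close> by blast
qed

lemma ideal_prod_center_ideal:
  assumes \<pp>: "\<pp> \<in> Spec (R\<lparr>carrier := Z\<rparr>)"
  shows "ideal (\<pp> \<cdot> carrier R) R"
proof -
  note p = Spec_centerD[OF \<pp>]
  have carr: "x \<in> carrier R" if "x \<in> \<pp> \<cdot> carrier R" for x
    using that by induction (use p in auto)
  show ?thesis
  proof (rule two_sided_idealI)
    show "\<zero> \<in> \<pp> \<cdot> carrier R"
      using ideal_prod.prod[of \<zero> \<pp> \<zero> "carrier R" R] p by simp
    show "x \<oplus> y \<in> \<pp> \<cdot> carrier R" if "x \<in> \<pp> \<cdot> carrier R" "y \<in> \<pp> \<cdot> carrier R" for x y
      using that by (rule ideal_prod.sum)
    show "r \<otimes> x \<in> \<pp> \<cdot> carrier R" if "x \<in> \<pp> \<cdot> carrier R" "r \<in> carrier R" for x r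
      using that(1)
    proof induction
      case (prod i j)
      have "i \<in> Z" using prod p by auto
      then have "r \<otimes> (i \<otimes> j) = i \<otimes> (r \<otimes> j)"
        using Z_central[of i r] prod that by (simp flip: m_assoc)
      then show ?case using ideal_prod.prod[of i \<pp> "r \<otimes> j" "carrier R" R] prod that by simp
    next
      case (sum s1 s2)
      then show ?case using that carr by (simp add: r_distr ideal_prod.sum)
    qed
    show "x \<otimes> r \<in> \<pp> \<cdot> carrier R" if "x \<in> \<pp> \<cdot> carrier R" "r \<in> carrier R" for x r
      using that(1)
    proof induction
      case (prod i j)
      have "i \<in> Z" using prod p by auto
      then have "i \<otimes> j \<otimes> r = i \<otimes> (j \<otimes> r)" using prod that by (simp add: m_assoc)
      then show ?case using ideal_prod.prod[of i \<pp> "j \<otimes> r" "carrier R" R] prod that by simp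
    next
      case (sum s1 s2)
      then show ?case using that carr by (simp add: l_distr ideal_prod.sum)
    qed
  qed (use carr in auto)
qed

text \<open>The cosets of the products \<open>u r\<close> form a nil right ideal of the prime left
  Noetherian ring \<open>R / P\<close>.\<close>

lemma nil_modulo_prime:
  assumes noeth: "left_noetherian R" and P: "P \<in> Spec R" and u: "u \<in> carrier R"
    and nil: "\<And>r. r \<in> carrier R \<Longrightarrow> \<exists>n::nat. (u \<otimes> r) [^] n \<in> P"
  shows "u \<in> P"
proof -
  have iP: "ideal P R" using P by (simp add: Spec_def)
  interpret P: ideal P R by (rule iP)
  interpret h: ring_hom_ring R "R Quot P" "(+>) P" by (rule P.rcos_ring_hom_ring)
  define N where "N = {P +> (u \<otimes> r) |r. r \<in> carrier R}"
  have "N \<subseteq> {\<zero>\<^bsub>R Quot P\<^esub>}"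
  proof (rule h.S.nil_right_ideal_zero)
    show "left_noetherian (R Quot P)" by (rule P.left_noetherian_quotient[OF noeth])
    show "prime_ring (R Quot P)" by (rule P.prime_ring_quotient[OF P])
    show "N \<subseteq> carrier (R Quot P)" using u by (auto simp: N_def)
    show "x \<otimes>\<^bsub>R Quot P\<^esub> t \<in> N" if xt: "x \<in> N" "t \<in> carrier (R Quot P)" for x t
    proof -
      obtain r b where rb: "x = P +> (u \<otimes> r)" "r \<in> carrier R" "b \<in> carrier R" "t = P +> b"
        using xt P.in_carrier_quotient_iff[of t] unfolding N_def by blast
      then have "x \<otimes>\<^bsub>R Quot P\<^esub> t = P +> (u \<otimes> (r \<otimes> b))"
        using u h.hom_mult[of "u \<otimes> r" b] by (simp add: m_assoc)
      then show ?thesis using rb by (auto simp: N_def)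
    qed
    show "\<exists>n::nat. x [^]\<^bsub>R Quot P\<^esub> n = \<zero>\<^bsub>R Quot P\<^esub>" if xN: "x \<in> N" for x
    proof -
      obtain r where r: "r \<in> carrier R" "x = P +> (u \<otimes> r)" using xN by (auto simp: N_def)
      obtain n :: nat where "(u \<otimes> r) [^] n \<in> P" using nil[OF r(1)] by blast
      then have "P +> ((u \<otimes> r) [^] n) = \<zero>\<^bsub>R Quot P\<^esub>"
        using P.rcos_eq_zero_iff r u by simp
      then show ?thesis using h.hom_nat_pow[of "u \<otimes> r" n] r u by auto
    qed
  qed
  moreover have "P +> (u \<otimes> \<one>) \<in> N" by (auto simp: N_def)
  ultimately show ?thesis using P.rcos_eq_zero_iff u by auto
qed

text \<open>The products of elements of \<open>Z - \<pp>\<close> with elements outside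
  \<open>P\<close> form an m-system containing both kinds of factors. A prime \<open>Q\<close> that
  contains \<open>\<pp> R\<close> and avoids it therefore lies inside \<open>P\<close> and meets
  \<open>Z\<close> exactly in \<open>\<pp>\<close>. The assumption \<open>nil\<close> isolates the
  part that depends on integral closedness.\<close>

lemma going_down:
  assumes noeth: "left_noetherian R"
    and \<pp>: "\<pp> \<in> Spec (R\<lparr>carrier := Z\<rparr>)" and P: "P \<in> Spec R" "\<pp> \<subseteq> P"
    and nil: "\<And>a u. a \<in> Z - \<pp> \<Longrightarrow> u \<in> carrier R \<Longrightarrow> a \<otimes> u \<in> \<pp> \<cdot> carrier R \<Longrightarrow> \<exists>n::nat. u [^] n \<in> P"
  obtains Q where "Q \<in> Spec R" "Q \<subseteq> P" "Q \<inter> Z = \<pp>"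
proof -
  note p = Spec_centerD[OF \<pp>]
  note I = ideal_prod_center_ideal[OF \<pp>]
  define S where "S = {a \<otimes> u |a u. a \<in> Z - \<pp> \<and> u \<in> carrier R - P}"
  have one: "\<one> \<notin> P" using P Spec_iff by auto
  have S1: "u \<in> S" if "u \<in> carrier R - P" for u
  proof -
    have "u = \<one> \<otimes> u" "\<one> \<in> Z - \<pp>" using that p(3) by auto
    then show ?thesis using that unfolding S_def by blast
  qed
  have S2: "a \<in> S" if "a \<in> Z - \<pp>" for a
  proof -
    have "a = a \<otimes> \<one>" "\<one> \<in> carrier R - P" using that one by auto
    then show ?thesis using that unfolding S_def by blast
  qed
  obtain Q where Q: "Q \<in> Spec R" "\<pp> \<cdot> carrier R \<subseteq> Q" "Q \<inter> S = {}"
  proof (rule exists_prime_avoiding[OF noeth I, of S])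
    \<comment> \<open>Nilpotency of \<open>u\<close> alone modulo \<open>P\<close> would not put
      \<open>u\<close> into \<open>P\<close>. But every \<open>u r\<close> satisfies the same
      relation, since \<open>\<pp> R\<close> is also a right ideal.\<close>
    have "u \<in> P" if "a \<in> Z - \<pp>" "u \<in> carrier R" "a \<otimes> u \<in> \<pp> \<cdot> carrier R" for a u
    proof (rule nil_modulo_prime[OF noeth P(1) that(2)])
      fix r assume r: "r \<in> carrier R"
      have "a \<otimes> (u \<otimes> r) = a \<otimes> u \<otimes> r" using that r by (simp add: m_assoc)
      then show "\<exists>n::nat. (u \<otimes> r) [^] n \<in> P"
        using nil[of a "u \<otimes> r"] that r ideal_closed(6)[OF I that(3) r] by simp
    qed
    then show "\<pp> \<cdot> carrier R \<inter> S = {}" by (auto simp: S_def)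
    show "S \<noteq> {}" using S2[of \<one>] p by auto
    show "S \<subseteq> carrier R" by (auto simp: S_def)
    show "\<exists>r\<in>carrier R. x \<otimes> r \<otimes> y \<in> S" if xy: "x \<in> S" "y \<in> S" for x y
    proof -
      obtain a u b v where ab: "x = a \<otimes> u" "y = b \<otimes> v" "a \<in> Z - \<pp>" "b \<in> Z - \<pp>"
        "u \<in> carrier R - P" "v \<in> carrier R - P" using xy by (auto simp: S_def)
      obtain r where r: "r \<in> carrier R" "u \<otimes> r \<otimes> v \<notin> P"
        using P(1) ab unfolding Spec_iff by blast
      have "a \<otimes> u \<otimes> r \<otimes> (b \<otimes> v) = a \<otimes> (((u \<otimes> r) \<otimes> b) \<otimes> v)"
        using ab r by (simp add: m_assoc)
      also have "(u \<otimes> r) \<otimes> b = b \<otimes> (u \<otimes> r)"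
        using Z_central[of b "u \<otimes> r"] ab r by simp
      finally have "x \<otimes> r \<otimes> y = (a \<otimes> b) \<otimes> (u \<otimes> r \<otimes> v)" using ab r by (simp add: m_assoc)
      moreover have "a \<otimes> b \<in> Z - \<pp>" "u \<otimes> r \<otimes> v \<in> carrier R - P" using ab r p(8) by auto
      ultimately show ?thesis using r unfolding S_def by blast
    qed
  qed auto
  have iQ: "ideal Q R" using Q by (simp add: Spec_def)
  have "Q \<subseteq> P" using S1 Q(3) ideal.Icarr[OF iQ] by blast
  moreover have "\<pp> \<subseteq> Q"
  proof
    fix x assume x: "x \<in> \<pp>"
    have "x \<otimes> \<one> \<in> \<pp> \<cdot> carrier R" using x by (intro ideal_prod.prod) auto
    moreover have "x \<otimes> \<one> = x" using x p(1) by auto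
    ultimately show "x \<in> Q" using Q by auto
  qed
  ultimately show thesis using that Q S2 p(1) by blast
qed

end

section \<open>Cayley-Hamilton and integral elements\<close>

locale scalar_action =
  fixes scale :: "'r::comm_ring_1 \<Rightarrow> 'b::ab_group_add \<Rightarrow> 'b" (infixr "*s" 75)
  assumes scale_right_distrib: "a *s (v + w) = a *s v + a *s w"
    and scale_left_distrib: "(a + b) *s v = a *s v + b *s v"
    and scale_scale: "a *s b *s v = (a * b) *s v"
    and scale_one [simp]: "1 *s v = v"
begin

lemma scale_zero_right [simp]: "a *s 0 = 0"
  using scale_right_distrib[of a 0 0] by simp

lemma scale_zero_left [simp]: "0 *s v = 0"
  using scale_left_distrib[of 0 0 v] by simp

lemma scale_minus_left: "(- a) *s v = - (a *s v)"
  using scale_left_distrib[of "- a" a v] by (simp add: eq_neg_iff_add_eq_0)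

lemma scale_sum_right: "a *s (\<Sum>i\<in>I. f i) = (\<Sum>i\<in>I. a *s f i)"
  by (induction I rule: infinite_finite_induct) (auto simp: scale_right_distrib)

lemma scale_sum_left: "(\<Sum>i\<in>I. f i) *s v = (\<Sum>i\<in>I. f i *s v)"
  by (induction I rule: infinite_finite_induct) (auto simp: scale_left_distrib)

text \<open>The relations are combined with the entries of row \<open>k\<close> of the adjugate as
  coefficients.\<close>

lemma det_scale_eq_zero:
  assumes N: "N \<in> carrier_mat n n" and "k < n"
    and zero: "\<And>i. i < n \<Longrightarrow> (\<Sum>j<n. N $$ (i, j) *s v j) = 0"
  shows "det N *s v k = 0"
proof -
  let ?B = "adj_mat N"
  have B: "?B \<in> carrier_mat n n" and eq: "?B * N = det N \<cdot>\<^sub>m 1\<^sub>m n"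
    using adj_mat[OF N] by auto
  have entry: "(\<Sum>i<n. ?B $$ (k, i) * N $$ (i, j)) = (if j = k then det N else 0)" if "j < n" for j
  proof -
    have "(?B * N) $$ (k, j) = (\<Sum>i<n. ?B $$ (k, i) * N $$ (i, j))"
      using B N that \<open>k < n\<close> by (auto simp: times_mat_def scalar_prod_def lessThan_atLeast0)
    then show ?thesis unfolding eq using that \<open>k < n\<close> by auto
  qed
  have "det N *s v k = (\<Sum>j<n. (if j = k then det N else 0) *s v j)"
    using \<open>k < n\<close> by (simp add: if_distrib[of "\<lambda>x. x *s _"] sum.delta' cong: if_cong)
  also have "\<dots> = (\<Sum>j<n. (\<Sum>i<n. ?B $$ (k, i) * N $$ (i, j)) *s v j)"
    using entry by (intro sum.cong) auto
  also have "\<dots> = (\<Sum>j<n. \<Sum>i<n. ?B $$ (k, i) *s N $$ (i, j) *s v j)"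
    by (simp add: scale_sum_left scale_scale)
  also have "\<dots> = (\<Sum>i<n. ?B $$ (k, i) *s (\<Sum>j<n. N $$ (i, j) *s v j))"
    by (subst sum.swap) (simp add: scale_sum_right)
  also have "\<dots> = 0" using zero by simp
  finally show ?thesis .
qed

end

locale poly_action = scalar_action scale
  for scale :: "'r::comm_ring_1 \<Rightarrow> 'b::ab_group_add \<Rightarrow> 'b" (infixr "*s" 75) +
  fixes T :: "'b \<Rightarrow> 'b"
  assumes T_add: "T (v + w) = T v + T w"
    and T_scale: "T (a *s v) = a *s T v"
begin

text \<open>This is \<open>p(T) v\<close>. With \<open>T\<close> right multiplication by
  \<open>u\<close> and \<open>v = 1\<close> it is the value of \<open>p\<close> at \<open>u\<close>
  with the coefficients written on the left.\<close>

definition act :: "'r poly \<Rightarrow> 'b \<Rightarrow> 'b" where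
  "act p v = (\<Sum>i\<le>degree p. coeff p i *s (T ^^ i) v)"

lemma act_eq_sum:
  assumes "degree p < n"
  shows "act p v = (\<Sum>i<n. coeff p i *s (T ^^ i) v)"
  unfolding act_def by (rule sum.mono_neutral_left) (use assms in \<open>auto simp: coeff_eq_0\<close>)

lemma T_zero [simp]: "T 0 = 0"
  using T_add[of 0 0] by simp

lemma act_pCons [simp]: "act (pCons a p) v = a *s v + act p (T v)"
proof -
  define n where "n = Suc (degree p)"
  have "act (pCons a p) v = (\<Sum>i<Suc n. coeff (pCons a p) i *s (T ^^ i) v)"
    by (rule act_eq_sum) (auto simp: n_def degree_pCons_eq_if)
  also have "\<dots> = a *s v + (\<Sum>i<n. coeff p i *s (T ^^ i) (T v))"
    by (simp add: sum.lessThan_Suc_shift funpow_swap1 del: sum.lessThan_Suc)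
  also have "(\<Sum>i<n. coeff p i *s (T ^^ i) (T v)) = act p (T v)"
    by (rule act_eq_sum[symmetric]) (simp add: n_def)
  finally show ?thesis .
qed

lemma act_zero [simp]: "act 0 v = 0"
  by (simp add: act_def)

lemma act_add_left: "act (p + q) v = act p v + act q v"
proof -
  define n where "n = Suc (max (degree p) (degree q))"
  have "degree p < n" "degree q < n" "degree (p + q) < n"
    unfolding n_def using degree_add_le_max[of p q] by linarith+
  then show ?thesis
    by (simp add: act_eq_sum[of _ n] scale_left_distrib sum.distrib)
qed

lemma act_smult: "act (smult a p) v = a *s act p v"
  by (induction p arbitrary: v) (auto simp: scale_scale scale_right_distrib)

lemma act_T: "act p (T v) = T (act p v)"
  by (induction p arbitrary: v) (auto simp: T_scale T_add)

lemma act_add_right: "act p (v + w) = act p v + act p w"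
  by (induction p arbitrary: v w) (auto simp: T_add scale_right_distrib add_ac)

lemma act_mult: "act (p * q) v = act p (act q v)"
  by (induction p arbitrary: v) (auto simp: act_add_left act_smult act_T)

lemma act_zero_right [simp]: "act p 0 = 0"
  using act_add_right[of p 0 0] by simp

lemma act_scale: "act p (a *s v) = a *s act p v"
  by (induction p arbitrary: v) (auto simp: T_scale scale_scale scale_right_distrib mult.commute)

lemma act_sum_right: "act p (\<Sum>i\<in>I. f i) = (\<Sum>i\<in>I. act p (f i))"
  by (induction I rule: infinite_finite_induct) (auto simp: act_add_right)

text \<open>Over the polynomial ring \<open>T\<close> itself becomes a scalar, so the adjugate
  argument applies to the characteristic matrix.\<close>

sublocale poly: scalar_action act
  by unfold_locales (simp_all add: act_add_right act_add_left act_mult one_pCons)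

end

text \<open>Dropping the unit includes ideals: the statements on characteristic polynomials and
  integrality are applied to coefficient rings as well as to primes of the center and their
  extensions.\<close>

definition nonunital_subring :: "'r::comm_ring_1 set \<Rightarrow> bool" where
  "nonunital_subring I \<longleftrightarrow> 0 \<in> I \<and> (\<forall>x\<in>I. \<forall>y\<in>I. x + y \<in> I \<and> x * y \<in> I) \<and> (\<forall>x\<in>I. - x \<in> I)"

lemma nonunital_subringD:
  assumes "nonunital_subring I"
  shows "0 \<in> I" "\<And>x y. x \<in> I \<Longrightarrow> y \<in> I \<Longrightarrow> x + y \<in> I" "\<And>x y. x \<in> I \<Longrightarrow> y \<in> I \<Longrightarrow> x * y \<in> I"
    "\<And>x. x \<in> I \<Longrightarrow> - x \<in> I" "\<And>x y. x \<in> I \<Longrightarrow> y \<in> I \<Longrightarrow> x - y \<in> I"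
    "\<And>A f. (\<And>a. a \<in> A \<Longrightarrow> f a \<in> I) \<Longrightarrow> sum f A \<in> I"
proof -
  show *: "0 \<in> I" "\<And>x y. x \<in> I \<Longrightarrow> y \<in> I \<Longrightarrow> x + y \<in> I" "\<And>x y. x \<in> I \<Longrightarrow> y \<in> I \<Longrightarrow> x * y \<in> I"
    "\<And>x. x \<in> I \<Longrightarrow> - x \<in> I"
    using assms by (auto simp: nonunital_subring_def)
  show "x - y \<in> I" if "x \<in> I" "y \<in> I" for x y
    using *(2)[OF that(1) *(4)[OF that(2)]] by simp
  show "sum f A \<in> I" if "\<And>a. a \<in> A \<Longrightarrow> f a \<in> I" for A and f :: "'b \<Rightarrow> 'a"
    using that by (induction A rule: infinite_finite_induct) (auto intro: *)
qed

definition coeffs_in :: "'r::comm_ring_1 set \<Rightarrow> 'r poly set" where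
  "coeffs_in I = {p. \<forall>i. coeff p i \<in> I}"

lemma nonunital_subring_coeffs_in:
  assumes "nonunital_subring I"
  shows "nonunital_subring (coeffs_in I)"
proof -
  have "p * q \<in> coeffs_in I" if "p \<in> coeffs_in I" "q \<in> coeffs_in I" for p q
    unfolding coeffs_in_def mem_Collect_eq coeff_mult
    using that nonunital_subringD(3)[OF assms]
    by (intro allI nonunital_subringD(6)[OF assms]) (auto simp: coeffs_in_def)
  then show ?thesis
    using nonunital_subringD(1,2,4)[OF assms] unfolding nonunital_subring_def[of "coeffs_in I"]
    by (auto simp: coeffs_in_def)
qed

lemma coeffs_in_pCons_0: "0 \<in> I \<Longrightarrow> p \<in> coeffs_in I \<Longrightarrow> pCons 0 p \<in> coeffs_in I"
  by (auto simp: coeffs_in_def coeff_pCons split: nat.splits)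

text \<open>When the product is expanded, every term except the product of all first summands
  contains some \<open>q i\<close>. A monomial \<open>t^k\<close> times such a term keeps its
  coefficients in \<open>I\<close>, even if \<open>1\<close> is not in \<open>I\<close>.\<close>

lemma prod_coeffs_in:
  fixes d :: "'i \<Rightarrow> bool" and q :: "'i \<Rightarrow> 'r::comm_ring_1 poly"
  assumes I: "nonunital_subring I" and "finite S" "\<And>i. i \<in> S \<Longrightarrow> q i \<in> coeffs_in I"
  shows "(\<Prod>i\<in>S. (if d i then [:0, 1:] else 0) + q i) - (if \<forall>i\<in>S. d i then monom 1 (card S) else 0) \<in> coeffs_in I"
  using assms(2,3)
proof (induction S rule: finite_induct)
  case empty
  then show ?case using nonunital_subringD(1)[OF I] by (simp add: coeffs_in_def monom_0 one_pCons)
next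
  case (insert x S)
  note J = nonunital_subringD[OF nonunital_subring_coeffs_in[OF I]]
  define P where "P = (\<Prod>i\<in>S. (if d i then [:0, 1:] else 0) + q i)"
  define m where "m = (if \<forall>i\<in>S. d i then monom 1 (card S) else (0::'r poly))"
  have IH: "P - m \<in> coeffs_in I" using insert unfolding P_def m_def by blast
  have qx: "q x \<in> coeffs_in I" using insert by simp
  have shift: "[:0, 1:] * p \<in> coeffs_in I" if "p \<in> coeffs_in I" for p
    using coeffs_in_pCons_0[OF nonunital_subringD(1)[OF I] that] by simp
  have qm: "q x * m \<in> coeffs_in I"
    using qx nonunital_subringD(1)[OF I]
    by (auto simp: m_def mult.commute[of "q x"] coeffs_in_def coeff_monom_mult)
  have "(\<Prod>i\<in>insert x S. (if d i then [:0, 1:] else 0) + q i) = ((if d x then [:0, 1:] else 0) + q x) * P"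
    using insert by (simp add: P_def)
  moreover have "(if \<forall>i\<in>insert x S. d i then monom 1 (card (insert x S)) else 0) = (if d x then [:0, 1:] * m else 0)"
    using insert by (auto simp: m_def monom_Suc)
  moreover have "((if d x then [:0, 1:] else 0) + q x) * P - (if d x then [:0, 1:] * m else 0) =
     (if d x then [:0, 1:] * (P - m) else 0) + q x * (P - m) + q x * m"
    by (simp add: algebra_simps)
  moreover have "\<dots> \<in> coeffs_in I"
    using J IH qx qm shift[OF IH] by auto
  ultimately show ?case by simp
qed

text \<open>Modulo \<open>coeffs_in I\<close> only the identity permutation contributes to the
  Leibniz formula, namely \<open>t^n\<close>.\<close>

lemma char_poly_coeffs_in:
  assumes A: "A \<in> carrier_mat n n" and I: "nonunital_subring I" and "\<And>i j. i < n \<Longrightarrow> j < n \<Longrightarrow> A $$ (i, j) \<in> I"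
  shows "char_poly A - monom 1 n \<in> coeffs_in I"
proof -
  note J = nonunital_subringD[OF nonunital_subring_coeffs_in[OF I]]
  let ?M = "char_poly_matrix A"
  let ?S = "{p. p permutes {0..<n}}"
  have M: "?M \<in> carrier_mat n n" using A by simp
  have entry: "?M $$ (i, j) = (if i = j then [:0, 1:] else 0) + [:- A $$ (i, j):]" if "i < n" "j < n" for i j
    using A that by (auto simp: char_poly_matrix_def)
  have "(\<Prod>i = 0..<n. ?M $$ (i, p i)) - (if p = id then monom 1 n else 0) \<in> coeffs_in I" if p: "p permutes {0..<n}" for p
  proof -
    have lt: "p i < n" if "i < n" for i using permutes_in_image[OF p, of i] that by auto
    have "(\<forall>i\<in>{0..<n}. i = p i) \<longleftrightarrow> p = id"
      using permutes_superset[OF p, of "{}"] p by (auto simp: permutes_empty id_def)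
    moreover have "(\<Prod>i = 0..<n. ?M $$ (i, p i)) = (\<Prod>i = 0..<n. (if i = p i then [:0, 1:] else 0) + [:- A $$ (i, p i):])"
      using lt by (intro prod.cong) (auto simp: entry)
    moreover have "[:- A $$ (i, p i):] \<in> coeffs_in I" if "i \<in> {0..<n}" for i
      using nonunital_subringD(1,4)[OF I] assms(3)[of i "p i"] that lt
      by (auto simp: coeffs_in_def coeff_pCons split: nat.splits)
    ultimately show ?thesis
      using prod_coeffs_in[OF I, of "{0..<n}" "\<lambda>i. [:- A $$ (i, p i):]" "\<lambda>i. i = p i"] by (simp cong: if_cong)
  qed
  moreover have "signof p * x \<in> coeffs_in I" if "x \<in> coeffs_in I" for p :: "nat \<Rightarrow> nat" and x :: "'a poly"
    using J(4)[OF that] that by (simp add: sign_def)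
  ultimately have "signof p * ((\<Prod>i = 0..<n. ?M $$ (i, p i)) - (if p = id then monom 1 n else 0)) \<in> coeffs_in I"
    if "p \<in> ?S" for p using that by blast
  then have "(\<Sum>p\<in>?S. signof p * ((\<Prod>i = 0..<n. ?M $$ (i, p i)) - (if p = id then monom 1 n else 0))) \<in> coeffs_in I"
    by (rule J(6))
  moreover have "(\<Sum>p\<in>?S. signof p * ((\<Prod>i = 0..<n. ?M $$ (i, p i)) - (if p = id then monom 1 n else 0))) =
    (\<Sum>p\<in>?S. signof p * (\<Prod>i = 0..<n. ?M $$ (i, p i))) - (\<Sum>p\<in>?S. signof p * (if p = id then monom 1 n else 0))"
    by (simp add: right_diff_distrib sum_subtractf)
  moreover have "(\<Sum>p\<in>?S. signof p * (if p = id then monom 1 n else 0)) = (monom 1 n :: 'a poly)"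
  proof -
    have "(\<Sum>p\<in>?S. signof p * (if p = id then monom 1 n else (0 :: 'a poly))) = (\<Sum>p\<in>{id}. signof p * monom 1 n)"
      by (rule sum.mono_neutral_cong_right) (auto simp: finite_permutations permutes_id)
    then show ?thesis by (simp add: signof_id)
  qed
  ultimately show ?thesis
    unfolding char_poly_def det_def'[OF M] by simp
qed

definition monic_over :: "'r::comm_ring_1 set \<Rightarrow> 'r poly \<Rightarrow> bool" where
  "monic_over I p \<longleftrightarrow> lead_coeff p = 1 \<and> (\<forall>i<degree p. coeff p i \<in> I)"

lemma char_poly_monic_over:
  assumes A: "A \<in> carrier_mat n n" and I: "nonunital_subring I" and "\<And>i j. i < n \<Longrightarrow> j < n \<Longrightarrow> A $$ (i, j) \<in> I"
  shows "monic_over I (char_poly A)" "degree (char_poly A) = n"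
proof -
  have "coeff (char_poly A) i \<in> I" if "i < n" for i
    using char_poly_coeffs_in[OF assms] that by (auto simp: coeffs_in_def dest: spec[of _ i])
  then show "monic_over I (char_poly A)" "degree (char_poly A) = n"
    using degree_monic_char_poly[OF A] by (auto simp: monic_over_def)
qed

text \<open>The characteristic matrix annihilates the vector of the \<open>v k\<close> in the module
  over the polynomial ring, hence so does its determinant.\<close>

lemma (in poly_action) cayley_hamilton:
  assumes I: "nonunital_subring I" and a: "\<And>i j. i < n \<Longrightarrow> j < n \<Longrightarrow> a i j \<in> I"
    and T: "\<And>i. i < n \<Longrightarrow> T (v i) = (\<Sum>j<n. a i j *s v j)"
  obtains c where "monic_over I c" "degree c = n" "\<And>k. k < n \<Longrightarrow> act c (v k) = 0"
proof -
  define A where "A = mat n n (\<lambda>(i, j). a i j)"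
  have A: "A \<in> carrier_mat n n" by (simp add: A_def)
  have "act (char_poly A) (v k) = 0" if "k < n" for k
    unfolding char_poly_def
  proof (rule poly.det_scale_eq_zero[OF _ that])
    show "char_poly_matrix A \<in> carrier_mat n n" using A by simp
    show "(\<Sum>j<n. act (char_poly_matrix A $$ (i, j)) (v j)) = 0" if i: "i < n" for i
    proof -
      have "act (char_poly_matrix A $$ (i, j)) (v j) = (if j = i then T (v i) else 0) - a i j *s v j" if "j < n" for j
        using A i that by (auto simp: char_poly_matrix_def A_def act_add_left scale_minus_left)
      then have "(\<Sum>j<n. act (char_poly_matrix A $$ (i, j)) (v j)) =
        (\<Sum>j<n. (if j = i then T (v i) else 0) - a i j *s v j)"
        by (intro sum.cong) auto
      also have "\<dots> = T (v i) - (\<Sum>j<n. a i j *s v j)"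
        using i by (simp add: sum_subtractf)
      finally show ?thesis using T[OF i] by simp
    qed
  qed
  moreover have "monic_over I (char_poly A)" "degree (char_poly A) = n"
    by (rule char_poly_monic_over[OF A I]; simp add: A_def a)+
  ultimately show thesis using that by blast
qed

section \<open>Integral elements with coefficients in an ideal\<close>

definition span_over :: "'r::comm_ring_1 set \<Rightarrow> 'r set \<Rightarrow> 'r set" where
  "span_over I V = {\<Sum>w\<in>V. c w * w |c. \<forall>w\<in>V. c w \<in> I}"

text \<open>Integrality in its module form. Asking for coefficients in an ideal \<open>I\<close> of the base ring
  makes it stable under sums without any further argument.\<close>

definition integral_at :: "'r::comm_ring_1 set \<Rightarrow> 'r \<Rightarrow> bool" where
  "integral_at I z \<longleftrightarrow> (\<exists>V. finite V \<and> 1 \<in> V \<and> (\<forall>v\<in>V. z * v \<in> span_over I V))"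

lemma span_over_add:
  assumes "nonunital_subring I" "x \<in> span_over I V" "y \<in> span_over I V"
  shows "x + y \<in> span_over I V"
proof -
  obtain c d where "\<forall>w\<in>V. c w \<in> I" "x = (\<Sum>w\<in>V. c w * w)" "\<forall>w\<in>V. d w \<in> I" "y = (\<Sum>w\<in>V. d w * w)"
    using assms by (auto simp: span_over_def)
  then show ?thesis
    using nonunital_subringD(2)[OF assms(1)]
    by (auto simp: span_over_def sum.distrib distrib_right intro!: exI[of _ "\<lambda>w. c w + d w"])
qed

lemma span_over_single:
  assumes "nonunital_subring I" "finite V" "v \<in> V" "c \<in> I"
  shows "c * v \<in> span_over I V"
proof -
  have "(\<Sum>w\<in>V. (if w = v then c else 0) * w) = c * v"
    using assms by (simp add: if_distrib[of "\<lambda>x. x * _"] cong: if_cong)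
  then show ?thesis
    using assms nonunital_subringD(1)[OF assms(1)]
    by (auto simp: span_over_def intro!: exI[of _ "\<lambda>w. if w = v then c else 0"])
qed

lemma span_over_sum:
  assumes "nonunital_subring I" "\<And>a. a \<in> A \<Longrightarrow> f a \<in> span_over I V"
  shows "sum f A \<in> span_over I V"
proof -
  have "0 \<in> span_over I V"
    using nonunital_subringD(1)[OF assms(1)] by (auto simp: span_over_def intro!: exI[of _ "\<lambda>_. 0"])
  then show ?thesis
    using assms(2) by (induction A rule: infinite_finite_induct) (auto intro: span_over_add[OF assms(1)])
qed

lemma finite_products: "finite V \<Longrightarrow> finite W \<Longrightarrow> finite {v * w |v w. v \<in> V \<and> w \<in> W}"
  using finite_image_set2[of "\<lambda>v. v \<in> V" "\<lambda>w. w \<in> W"] by simp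

lemma span_over_mult:
  assumes I: "nonunital_subring I" and fin: "finite V" "finite W"
    and xy: "x \<in> span_over I V" "y \<in> span_over I W"
  shows "x * y \<in> span_over I {v * w |v w. v \<in> V \<and> w \<in> W}" (is "_ \<in> span_over I ?P")
proof -
  have P: "finite ?P" using fin by (rule finite_products)
  obtain c d where c: "\<forall>v\<in>V. c v \<in> I" "x = (\<Sum>v\<in>V. c v * v)" and d: "\<forall>w\<in>W. d w \<in> I" "y = (\<Sum>w\<in>W. d w * w)"
    using xy by (auto simp: span_over_def)
  have "x * y = (\<Sum>v\<in>V. \<Sum>w\<in>W. (c v * d w) * (v * w))"
    unfolding c d sum_product by (simp add: mult_ac)
  also have "\<dots> \<in> span_over I ?P"
    using c d nonunital_subringD(3)[OF I]
    by (intro span_over_sum[OF I] span_over_single[OF I P]) auto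
  finally show ?thesis .
qed

lemma span_over_mult_elem:
  assumes I: "nonunital_subring I" and fin: "finite V" "finite W"
    and xy: "x \<in> span_over I V" "w \<in> W"
  shows "x * w \<in> span_over I {v * w |v w. v \<in> V \<and> w \<in> W}" (is "_ \<in> span_over I ?P")
proof -
  have P: "finite ?P" using fin by (rule finite_products)
  obtain c where c: "\<forall>v\<in>V. c v \<in> I" "x = (\<Sum>v\<in>V. c v * v)"
    using xy by (auto simp: span_over_def)
  have "x * w = (\<Sum>v\<in>V. c v * (v * w))"
    unfolding c sum_distrib_right by (simp add: mult_ac)
  also have "\<dots> \<in> span_over I ?P"
    using c xy by (intro span_over_sum[OF I] span_over_single[OF I P]) auto
  finally show ?thesis .
qed

lemma integral_at_add:
  assumes I: "nonunital_subring I" and "integral_at I x" "integral_at I y"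
  shows "integral_at I (x + y)"
proof -
  obtain V W where V: "finite V" "1 \<in> V" "\<forall>v\<in>V. x * v \<in> span_over I V"
    and W: "finite W" "1 \<in> W" "\<forall>w\<in>W. y * w \<in> span_over I W"
    using assms by (auto simp: integral_at_def)
  let ?P = "{v * w |v w. v \<in> V \<and> w \<in> W}"
  have "(x + y) * (v * w) \<in> span_over I ?P" if "v \<in> V" "w \<in> W" for v w
  proof -
    have "(x + y) * (v * w) = (x * v) * w + (y * w) * v" by (simp add: algebra_simps)
    moreover have "(x * v) * w \<in> span_over I ?P"
      using span_over_mult_elem[OF I V(1) W(1)] V that by blast
    moreover have "(y * w) * v \<in> span_over I ?P"
    proof -
      have "(y * w) * v \<in> span_over I {v * w |v w. v \<in> W \<and> w \<in> V}"
        using W that by (intro span_over_mult_elem[OF I W(1) V(1)]) auto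
      moreover have "{v * w |v w. v \<in> W \<and> w \<in> V} = {w * v |v w. v \<in> W \<and> w \<in> V}"
        by (simp add: mult.commute)
      moreover have "\<dots> = ?P" by blast
      ultimately show ?thesis by simp
    qed
    ultimately show ?thesis using span_over_add[OF I] by simp
  qed
  moreover have "finite ?P" using V W by (intro finite_products)
  moreover have "1 \<in> ?P" using V W by force
  ultimately show ?thesis unfolding integral_at_def by blast
qed

lemma integral_at_mult:
  assumes I: "nonunital_subring I" and "integral_at I x" "integral_at I y"
  shows "integral_at I (x * y)"
proof -
  obtain V W where V: "finite V" "1 \<in> V" "\<forall>v\<in>V. x * v \<in> span_over I V"
    and W: "finite W" "1 \<in> W" "\<forall>w\<in>W. y * w \<in> span_over I W"
    using assms by (auto simp: integral_at_def)
  let ?P = "{v * w |v w. v \<in> V \<and> w \<in> W}"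
  have "(x * y) * (v * w) \<in> span_over I ?P" if "v \<in> V" "w \<in> W" for v w
    using span_over_mult[OF I V(1) W(1), of "x * v" "y * w"] V W that by (simp add: mult_ac)
  moreover have "finite ?P" using V W by (intro finite_products)
  moreover have "1 \<in> ?P" using V W by force
  ultimately show ?thesis unfolding integral_at_def by blast
qed

text \<open>The generators \<open>V\<close> for \<open>z\<close> also serve for \<open>p z\<close>:
  multiplying the coefficients by \<open>p\<close> moves them from \<open>A\<close> into
  \<open>I\<close>.\<close>

lemma integral_at_ideal_mult:
  assumes "integral_at A z" "p \<in> I" "\<And>a. a \<in> A \<Longrightarrow> p * a \<in> I"
  shows "integral_at I (p * z)"
proof -
  obtain V where V: "finite V" "1 \<in> V" "\<forall>v\<in>V. z * v \<in> span_over A V"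
    using assms by (auto simp: integral_at_def)
  have "p * z * v \<in> span_over I V" if v: "v \<in> V" for v
  proof -
    obtain c where "\<forall>w\<in>V. c w \<in> A" "z * v = (\<Sum>w\<in>V. c w * w)"
      using V v by (auto simp: span_over_def)
    moreover from this have "p * z * v = (\<Sum>w\<in>V. (p * c w) * w)"
      by (simp add: sum_distrib_left mult.assoc)
    ultimately show ?thesis using assms(3) by (auto simp: span_over_def)
  qed
  then show ?thesis using V unfolding integral_at_def by blast
qed

lemma integral_at_elem:
  assumes "nonunital_subring I" "a \<in> I"
  shows "integral_at I a"
  using span_over_single[OF assms(1), of "{1}" 1 a] assms
  unfolding integral_at_def by (intro exI[of _ "{1}"]) auto

text \<open>Cayley-Hamilton for multiplication by \<open>z\<close> on the generators; since
  \<open>1\<close> is one of them, the polynomial vanishes at \<open>z\<close> itself.\<close>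

lemma integral_at_imp_root:
  assumes I: "nonunital_subring I" and "integral_at I z"
  obtains p where "monic_over I p" "poly p z = 0" "degree p > 0"
proof -
  obtain V where V: "finite V" "1 \<in> V" "\<forall>v\<in>V. z * v \<in> span_over I V"
    using assms by (auto simp: integral_at_def)
  interpret P: poly_action "(*)" "(*) z"
    by unfold_locales (auto simp: algebra_simps)
  obtain v where v: "bij_betw v {..<card V} V"
    using ex_bij_betw_nat_finite[OF V(1)] by (auto simp: lessThan_atLeast0)
  have "\<exists>c. \<forall>w\<in>V. c w \<in> I \<and> z * u = (\<Sum>w\<in>V. c w * w)" if "u \<in> V" for u
    using V that by (force simp: span_over_def)
  then obtain c where c: "\<And>u w. u \<in> V \<Longrightarrow> w \<in> V \<Longrightarrow> c u w \<in> I"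
    "\<And>u. u \<in> V \<Longrightarrow> z * u = (\<Sum>w\<in>V. c u w * w)"
    using V(2) by metis
  have vV: "v i \<in> V" if "i < card V" for i using v that by (auto simp: bij_betw_def)
  have T: "z * v i = (\<Sum>j<card V. c (v i) (v j) * v j)" if "i < card V" for i
    using c(2)[OF vV[OF that]] sum.reindex_bij_betw[OF v, of "\<lambda>w. c (v i) w * w"] by simp
  obtain q where q: "monic_over I q" "degree q = card V" "\<And>k. k < card V \<Longrightarrow> P.act q (v k) = 0"
    using P.cayley_hamilton[OF I, of "card V" "\<lambda>i j. c (v i) (v j)" v] c(1) vV T by metis
  obtain k where "k < card V" "v k = 1"
    using v V(2) unfolding bij_betw_def by (metis imageE lessThan_iff)
  then have "P.act q 1 = 0" using q(3) by force
  moreover have "P.act q x = poly q z * x" for x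
    by (induction q arbitrary: x) (auto simp: algebra_simps)
  ultimately show thesis
    using that[OF q(1)] q(2) V by (simp add: card_gt_0_iff) blast
qed

lemma root_imp_integral_at:
  assumes A: "nonunital_subring A" "1 \<in> A" and p: "monic_over A p" "poly p z = 0"
  shows "integral_at A z"
proof -
  define n where "n = degree p"
  \<comment> \<open>The powers already contain \<open>1\<close> unless the degree is
    \<open>0\<close>, in which case the equation says that the ring is trivial.\<close>
  define V where "V = insert 1 ((^) z ` {..<n})"
  have pow: "z ^ i \<in> span_over A V" if "i < n" for i
    using span_over_single[OF A(1), of V "z ^ i" 1] that A by (auto simp: V_def)
  have "0 = (\<Sum>i\<le>n. coeff p i * z ^ i)" using p by (simp add: poly_altdef n_def)
  also have "\<dots> = (\<Sum>i<n. coeff p i * z ^ i) + z ^ n"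
    using p by (simp add: n_def monic_over_def flip: lessThan_Suc_atMost)
  finally have zn: "z ^ n = (\<Sum>i<n. (- coeff p i) * z ^ i)"
    by (simp add: sum_negf eq_neg_iff_add_eq_0 add.commute)
  have "z ^ n \<in> span_over A V"
    unfolding zn using p nonunital_subringD(4)[OF A(1)]
    by (intro span_over_sum[OF A(1)] span_over_single[OF A(1)]) (auto simp: V_def monic_over_def n_def)
  then have pow': "z ^ i \<in> span_over A V" if "i \<le> n" for i
    using pow that by (cases "i = n") auto
  have "z \<in> span_over A V"
  proof (cases n)
    case 0
    then have "(1::'a) = 0" using zn by simp
    then have "z = 1 * 1" by (metis mult_zero_right mult.right_neutral)
    then show ?thesis using span_over_single[OF A(1), of V 1 1] A by (metis V_def finite.insertI finite_imageI finite_lessThan insertI1)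
  next
    case (Suc m)
    then show ?thesis using pow'[of 1] by simp
  qed
  moreover have "z * z ^ i \<in> span_over A V" if "i < n" for i
    using pow'[of "Suc i"] that by simp
  ultimately show ?thesis
    unfolding integral_at_def by (intro exI[of _ V]) (auto simp: V_def)
qed

section \<open>Coefficients of monic factors\<close>

lemma map_poly_to_ac_mult: "map_poly to_ac (p * q) = map_poly to_ac p * map_poly to_ac q"
  by (rule poly_eqI) (simp add: coeff_map_poly coeff_mult to_ac_sum)

text \<open>Over the algebraic closure \<open>p\<close> splits into linear factors. Its roots are
  roots of \<open>p * q\<close>, hence integral over the image \<open>B\<close> of \<open>A\<close>,
  and so are the coefficients of \<open>p\<close>, which are polynomials in the roots. The monic
  equation over \<open>B\<close> obtained in this way is pulled back along
  \<open>to_ac\<close>.\<close>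

lemma integral_at_coeffs_of_factor:
  fixes p q :: "'f::field poly"
  assumes A: "nonunital_subring A" "1 \<in> A" and "lead_coeff p = 1" "lead_coeff q = 1"
    and pq: "p * q \<in> coeffs_in A"
  shows "integral_at A (coeff p i)"
proof -
  define B where "B = to_ac ` A"
  have B: "nonunital_subring B" "1 \<in> B"
    using A rev_image_eqI[of 0 A 0 to_ac] rev_image_eqI[of 1 A 1 to_ac] unfolding B_def nonunital_subring_def
    by (auto simp flip: to_ac_add to_ac_mult to_ac_minus)
  interpret ac: field_hom "to_ac :: 'f \<Rightarrow> 'f alg_closure"
    by unfold_locales auto
  let ?h = "map_poly (to_ac :: 'f \<Rightarrow> 'f alg_closure)"
  have mon: "lead_coeff (?h (p * q)) = 1" "lead_coeff (?h p) = 1"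
    using assms by (simp_all add: lead_coeff_mult)
  obtain S where S: "?h p = (\<Prod>x\<in>#S. [:- x, 1:])"
    using alg_closed_imp_factorization[of "?h p"] mon(2) by fastforce
  have root: "integral_at B x" if "x \<in># S" for x
  proof (rule root_imp_integral_at[OF B, of "?h (p * q)"])
    show "monic_over B (?h (p * q))"
      using mon(1) pq by (auto simp: monic_over_def B_def coeffs_in_def)
    have "poly (?h p) x = 0"
      unfolding S poly_prod_mset using that by (auto simp: prod_mset_zero_iff image_iff intro!: bexI[of _ x])
    then show "poly (?h (p * q)) x = 0" by (simp add: map_poly_to_ac_mult)
  qed
  have "integral_at B (coeff (\<Prod>x\<in>#S. [:- x, 1:]) i)" for i
    using root
  proof (induction S arbitrary: i)
    case empty
    then show ?case using integral_at_elem[OF B(1)] B nonunital_subringD(1)[OF B(1)] by (simp add: coeff_1)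
  next
    case (add x S)
    have "integral_at B (- x)"
      using integral_at_mult[OF B(1), of "-1" x] integral_at_elem[OF B(1), of "-1"] add.prems
        nonunital_subringD(4)[OF B(1) B(2)] by simp
    then have "integral_at B (- x * coeff (\<Prod>x\<in>#S. [:- x, 1:]) i)" for i
      using add by (intro integral_at_mult[OF B(1)]) auto
    then have "integral_at B (coeff (\<Prod>x\<in>#S. [:- x, 1:]) j + - x * coeff (\<Prod>x\<in>#S. [:- x, 1:]) k)" for j k
      using add by (intro integral_at_add[OF B(1)]) auto
    moreover have "integral_at B (- x * coeff (\<Prod>x\<in>#S. [:- x, 1:]) i)" for i
      using \<open>integral_at B (- x)\<close> add by (intro integral_at_mult[OF B(1)]) auto
    ultimately show ?case
      by (cases i) auto
  qed
  then have "integral_at B (to_ac (coeff p i))"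
    by (metis S ac.coeff_map_poly_hom)
  then obtain r where r: "monic_over B r" "poly r (to_ac (coeff p i)) = 0"
    using integral_at_imp_root[OF B(1)] by metis
  have "\<exists>a. coeff r i = to_ac a \<and> (i < degree r \<longrightarrow> a \<in> A)" for i
    using r(1) unfolding monic_over_def B_def
    by (metis imageE le_degree linorder_neqE_nat not_less to_ac_0 to_ac_1)
  then obtain a where a: "\<And>i. coeff r i = to_ac (a i)" "\<And>i. i < degree r \<Longrightarrow> a i \<in> A"
    by metis
  define r' where "r' = Abs_poly a"
  have a0: "a i = 0" if "i > degree r" for i
    using a(1)[of i] that by (simp add: coeff_eq_0)
  have r': "coeff r' = a"
    unfolding r'_def by (rule coeff_Abs_poly[of "degree r"]) (use a0 in auto)
  have h: "?h r' = r" by (rule poly_eqI) (simp add: r' a)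
  then have deg: "degree r' = degree r" by (metis ac.degree_map_poly_hom)
  have "lead_coeff r' = 1" using r(1) a(1)[of "degree r"] by (simp add: r' deg monic_over_def)
  then have "monic_over A r'" using a by (auto simp: monic_over_def r' deg)
  moreover have "poly r' (coeff p i) = 0"
    using r(2) h by (metis ac.hom_0_iff ac.poly_map_poly)
  ultimately show ?thesis by (rule root_imp_integral_at[OF A])
qed

text \<open>Over the domain \<open>A / P\<close> a power of \<open>t\<close> has only powers of
  \<open>t\<close> as monic factors. Concretely, if \<open>i\<close> and \<open>j\<close> are the
  lowest indices of coefficients of \<open>p\<close> and \<open>q\<close> outside \<open>P\<close>,
  then coefficient \<open>i + j\<close> of the product is outside \<open>P\<close>; so it is the
  leading one, and \<open>i\<close> and \<open>j\<close> are the two degrees.\<close>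

lemma factor_lower_coeffs_in_prime:
  fixes p q :: "'r::comm_ring_1 poly"
  assumes A: "nonunital_subring A" "1 \<in> A" and P: "P \<subseteq> A" "nonunital_subring P"
    and Pideal: "\<And>a x. a \<in> A \<Longrightarrow> x \<in> P \<Longrightarrow> a * x \<in> P"
    and Pprime: "\<And>a b. a \<in> A \<Longrightarrow> b \<in> A \<Longrightarrow> a * b \<in> P \<Longrightarrow> a \<in> P \<or> b \<in> P"
    and "1 \<notin> P" and pq: "monic_over A p" "monic_over A q" "monic_over P (p * q)"
    and deg: "degree (p * q) = degree p + degree q"
  shows "monic_over P p"
proof -
  note PD = nonunital_subringD[OF P(2)]
  have cA: "coeff p i \<in> A" "coeff q i \<in> A" for i
    using pq(1,2) A nonunital_subringD(1)[OF A(1)] unfolding monic_over_def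
    by (metis coeff_eq_0 linorder_neqE_nat)+
  define i where "i = (LEAST i. coeff p i \<notin> P)"
  define j where "j = (LEAST j. coeff q j \<notin> P)"
  have ex: "coeff p (degree p) \<notin> P" "coeff q (degree q) \<notin> P"
    using pq \<open>1 \<notin> P\<close> by (auto simp: monic_over_def)
  have i: "coeff p i \<notin> P" "\<And>k. k < i \<Longrightarrow> coeff p k \<in> P" "i \<le> degree p"
    unfolding i_def using LeastI[of "\<lambda>i. coeff p i \<notin> P", OF ex(1)] Least_le[of "\<lambda>i. coeff p i \<notin> P", OF ex(1)]
    by (auto dest: not_less_Least)
  have j: "coeff q j \<notin> P" "\<And>k. k < j \<Longrightarrow> coeff q k \<in> P" "j \<le> degree q"
    unfolding j_def using LeastI[of "\<lambda>i. coeff q i \<notin> P", OF ex(2)] Least_le[of "\<lambda>i. coeff q i \<notin> P", OF ex(2)]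
    by (auto dest: not_less_Least)
  have "coeff (p * q) (i + j) = (\<Sum>k\<le>i + j. coeff p k * coeff q (i + j - k))"
    by (rule coeff_mult)
  also have "\<dots> = coeff p i * coeff q j + (\<Sum>k\<in>{..i + j} - {i}. coeff p k * coeff q (i + j - k))"
    by (subst sum.remove[of _ i]) auto
  finally have eq: "coeff p i * coeff q j = coeff (p * q) (i + j) - (\<Sum>k\<in>{..i + j} - {i}. coeff p k * coeff q (i + j - k))"
    by simp
  have rest: "(\<Sum>k\<in>{..i + j} - {i}. coeff p k * coeff q (i + j - k)) \<in> P"
  proof (rule PD(6))
    fix k assume k: "k \<in> {..i + j} - {i}"
    show "coeff p k * coeff q (i + j - k) \<in> P"
    proof (cases "k < i")
      case True
      then show ?thesis using i(2) Pideal[OF cA(2)] by (metis mult.commute)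
    next
      case False
      then have "i + j - k < j" using k by auto
      then show ?thesis using j(2) Pideal[OF cA(1)] by blast
    qed
  qed
  have "\<not> i + j < degree (p * q)"
  proof
    assume "i + j < degree (p * q)"
    then have "coeff (p * q) (i + j) \<in> P" using pq(3) by (simp add: monic_over_def)
    then have "coeff p i * coeff q j \<in> P" using rest eq PD(5) by simp
    then show False using Pprime cA i(1) j(1) by blast
  qed
  then have "i = degree p" using deg i(3) j(3) by linarith
  then show ?thesis using i(2) pq(1) by (auto simp: monic_over_def)
qed

section \<open>The skew group ring and its action on the field of fractions\<close>

abbreviation finv :: "('a \<Rightarrow> 'b) \<Rightarrow> 'b \<Rightarrow> 'a" where
  "finv f \<equiv> inv_into UNIV f"

section \<open>Automorphisms, their extensions to fractions, and Dedekind's lemma\<close>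

definition ring_aut :: "('a::comm_ring_1 \<Rightarrow> 'a) \<Rightarrow> bool" where
  "ring_aut \<phi> \<longleftrightarrow> bij \<phi> \<and> (\<forall>x y. \<phi> (x + y) = \<phi> x + \<phi> y) \<and> (\<forall>x y. \<phi> (x * y) = \<phi> x * \<phi> y) \<and> \<phi> 1 = 1"

lemma ring_autD:
  assumes "ring_aut \<phi>"
  shows "bij \<phi>" "inj \<phi>" "surj \<phi>" "\<phi> (x + y) = \<phi> x + \<phi> y" "\<phi> (x * y) = \<phi> x * \<phi> y" "\<phi> 1 = 1" "\<phi> 0 = 0"
    "\<phi> x = 0 \<longleftrightarrow> x = 0" "\<phi> (finv \<phi> x) = x" "finv \<phi> (\<phi> x) = x" "\<phi> \<circ> finv \<phi> = id" "finv \<phi> \<circ> \<phi> = id"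
proof -
  show *: "bij \<phi>" "inj \<phi>" "surj \<phi>" "\<phi> (x + y) = \<phi> x + \<phi> y" "\<phi> (x * y) = \<phi> x * \<phi> y" "\<phi> 1 = 1"
    using assms by (auto simp: ring_aut_def bij_def)
  have "\<phi> (0 + 0) = \<phi> 0 + \<phi> 0" using assms unfolding ring_aut_def by blast
  then show 0: "\<phi> 0 = 0" by simp
  then show "\<phi> x = 0 \<longleftrightarrow> x = 0" using injD[OF *(2), of x 0] by auto
  show "\<phi> (finv \<phi> x) = x" "finv \<phi> (\<phi> x) = x" "\<phi> \<circ> finv \<phi> = id" "finv \<phi> \<circ> \<phi> = id"
    using * by (auto simp: surj_f_inv_f inv_f_f fun_eq_iff)
qed

lemma ring_aut_id [simp]: "ring_aut id"
  by (simp add: ring_aut_def)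

lemma ring_aut_comp: "ring_aut \<phi> \<Longrightarrow> ring_aut \<psi> \<Longrightarrow> ring_aut (\<phi> \<circ> \<psi>)"
  by (auto simp: ring_aut_def bij_comp)

lemma ring_aut_inv:
  assumes "ring_aut \<phi>"
  shows "ring_aut (finv \<phi>)"
proof -
  note p = ring_autD[OF assms]
  have "finv \<phi> (x + y) = finv \<phi> x + finv \<phi> y" "finv \<phi> (x * y) = finv \<phi> x * finv \<phi> y" for x y
    using p(4)[of "finv \<phi> x" "finv \<phi> y"] p(5)[of "finv \<phi> x" "finv \<phi> y"] p(9,10) by metis+
  moreover have "finv \<phi> 1 = 1" using p(6,10) by metis
  ultimately show ?thesis using p(1) by (simp add: ring_aut_def bij_imp_bij_inv)
qed

lemma ring_aut_sum: "ring_aut \<phi> \<Longrightarrow> \<phi> (\<Sum>i\<in>I. f i) = (\<Sum>i\<in>I. \<phi> (f i))"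
  by (induction I rule: infinite_finite_induct) (auto simp: ring_autD)

lemma ring_aut_minus: "ring_aut \<phi> \<Longrightarrow> \<phi> (- x) = - \<phi> x"
  using ring_autD(4)[of \<phi> x "- x"] by (simp add: ring_autD(7) eq_neg_iff_add_eq_0 add.commute)

lemma ring_aut_prod: "ring_aut \<phi> \<Longrightarrow> \<phi> (\<Prod>i\<in>I. f i) = (\<Prod>i\<in>I. \<phi> (f i))"
  by (induction I rule: infinite_finite_induct) (auto simp: ring_autD)

lemma fract_ext_eq:
  "ring_aut \<phi> \<Longrightarrow> b \<noteq> 0 \<Longrightarrow> fract_ext \<phi> (Fract a b) = Fract (\<phi> a) (\<phi> b)"
  by (rule fract_ext_Fract) (auto simp: ring_autD)

lemma fract_ext_to_fract: "ring_aut \<phi> \<Longrightarrow> fract_ext \<phi> (to_fract a) = to_fract (\<phi> a)"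
  by (simp add: to_fract_def fract_ext_eq ring_autD)

lemma fract_ext_id [simp]: "fract_ext id x = x"
  by (cases x) (simp add: fract_ext_eq)

lemma ring_aut_fract_ext_hom:
  assumes \<phi>: "ring_aut \<phi>"
  shows "fract_ext \<phi> (x + y) = fract_ext \<phi> x + fract_ext \<phi> y"
    "fract_ext \<phi> (x * y) = fract_ext \<phi> x * fract_ext \<phi> y"
  by (cases x; cases y; simp add: fract_ext_eq[OF \<phi>] ring_autD[OF \<phi>])+

lemma fract_ext_comp:
  assumes "ring_aut \<phi>" "ring_aut \<psi>"
  shows "fract_ext (\<phi> \<circ> \<psi>) x = fract_ext \<phi> (fract_ext \<psi> x)"
  using assms by (cases x) (simp add: fract_ext_eq ring_aut_comp ring_autD)

lemma ring_aut_fract_ext: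
  assumes \<phi>: "ring_aut \<phi>"
  shows "ring_aut (fract_ext \<phi>)"
proof -
  have "fract_ext \<phi> (fract_ext (finv \<phi>) x) = x" "fract_ext (finv \<phi>) (fract_ext \<phi> x) = x" for x
    using fract_ext_comp[OF \<phi> ring_aut_inv[OF \<phi>]] fract_ext_comp[OF ring_aut_inv[OF \<phi>] \<phi>]
      ring_autD(11,12)[OF \<phi>] by (metis fract_ext_id)+
  then have "bij (fract_ext \<phi>)" by (metis bijI')
  moreover have "fract_ext \<phi> 1 = 1"
    using fract_ext_to_fract[OF \<phi>, of 1] ring_autD(6)[OF \<phi>] by (simp add: to_fract_def One_fract_def)
  ultimately show ?thesis by (simp add: ring_aut_def ring_aut_fract_ext_hom[OF \<phi>])
qed

lemmas fract_ext_simps = ring_autD(4-7)[OF ring_aut_fract_ext] ring_aut_minus[OF ring_aut_fract_ext]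
  ring_aut_sum[OF ring_aut_fract_ext]

text \<open>Replacing \<open>x\<close> by \<open>y * x\<close> and subtracting
  \<open>\<chi> i y\<close> times the relation removes the term of \<open>i\<close>. The arguments
  range over a submonoid \<open>\<Gamma>\<close>, on which the characters only have to stay pairwise
  distinct; it is all of \<Lambda> for the elements of \<open>G\<close>, and the invariants for
  those of \<open>M\<close>.\<close>

lemma dedekind_independence:
  fixes \<chi> :: "'i \<Rightarrow> 'a::monoid_mult \<Rightarrow> 'f::field"
  assumes \<Gamma>: "1 \<in> \<Gamma>" "\<And>x y. x \<in> \<Gamma> \<Longrightarrow> y \<in> \<Gamma> \<Longrightarrow> x * y \<in> \<Gamma>"
    and "finite S" "\<And>i. i \<in> S \<Longrightarrow> \<chi> i 1 = 1"
    and "\<And>i x y. i \<in> S \<Longrightarrow> x \<in> \<Gamma> \<Longrightarrow> y \<in> \<Gamma> \<Longrightarrow> \<chi> i (x * y) = \<chi> i x * \<chi> i y"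
    and "\<And>i j. i \<in> S \<Longrightarrow> j \<in> S \<Longrightarrow> i \<noteq> j \<Longrightarrow> \<exists>x\<in>\<Gamma>. \<chi> i x \<noteq> \<chi> j x"
    and "\<And>x. x \<in> \<Gamma> \<Longrightarrow> (\<Sum>i\<in>S. c i * \<chi> i x) = 0"
  shows "\<forall>i\<in>S. c i = 0"
  using assms(3-)
proof (induction S arbitrary: c rule: finite_induct)
  case (insert i S)
  have "c j * (\<chi> j y - \<chi> i y) = 0" if "y \<in> \<Gamma>" "j \<in> S" for y j
  proof -
    have "(\<Sum>j\<in>S. c j * (\<chi> j y - \<chi> i y) * \<chi> j x) = 0" if x: "x \<in> \<Gamma>" for x
    proof -
      have "(\<Sum>j\<in>S. c j * (\<chi> j y - \<chi> i y) * \<chi> j x) =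
        (\<Sum>j\<in>S. c j * \<chi> j (y * x)) - \<chi> i y * (\<Sum>j\<in>S. c j * \<chi> j x)"
        using insert.prems(2) x \<open>y \<in> \<Gamma>\<close>
        by (simp add: sum_distrib_left sum_subtractf[symmetric] algebra_simps)
      also have "\<dots> = (\<Sum>j\<in>insert i S. c j * \<chi> j (y * x)) - \<chi> i y * (\<Sum>j\<in>insert i S. c j * \<chi> j x)"
        using insert.hyps insert.prems(2)[of i y x] x \<open>y \<in> \<Gamma>\<close> by (simp add: algebra_simps)
      also have "\<dots> = 0" using insert.prems(4) \<Gamma>(2) x \<open>y \<in> \<Gamma>\<close> by simp
      finally show ?thesis .
    qed
    then have "\<forall>j\<in>S. c j * (\<chi> j y - \<chi> i y) = 0"
      using insert.prems by (intro insert.IH) auto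
    then show ?thesis using that by blast
  qed
  moreover have "\<exists>y\<in>\<Gamma>. \<chi> j y \<noteq> \<chi> i y" if "j \<in> S" for j
    using insert.prems(3)[of j i] insert.hyps that by auto
  ultimately have 0: "\<forall>j\<in>S. c j = 0" by fastforce
  then have "c i * \<chi> i 1 = 0" using insert.prems(4)[OF \<Gamma>(1)] insert.hyps by simp
  then show ?case using 0 insert.prems(1)[of i] by simp
qed simp

section \<open>Skew elements as operators on the field of fractions\<close>

definition skew_apply :: "'a::idom skew \<Rightarrow> 'a fract \<Rightarrow> 'a fract" where
  "skew_apply f l = (\<Sum>\<mu>\<in>Poly_Mapping.keys f. Poly_Mapping.lookup f \<mu> * fract_ext \<mu> l)"

abbreviation keys where "keys \<equiv> Poly_Mapping.keys"
abbreviation lookup where "lookup \<equiv> Poly_Mapping.lookup"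

lemma skew_apply_superset:
  "finite S \<Longrightarrow> keys f \<subseteq> S \<Longrightarrow> skew_apply f l = (\<Sum>\<mu>\<in>S. lookup f \<mu> * fract_ext \<mu> l)"
  unfolding skew_apply_def by (rule sum.mono_neutral_left) (auto simp: in_keys_iff)

lemma skew_apply_zero [simp]: "skew_apply 0 l = 0"
  by (simp add: skew_apply_def)

lemma skew_apply_add: "skew_apply (f + g) l = skew_apply f l + skew_apply g l"
proof -
  have "finite (keys f \<union> keys g)" "keys (f + g) \<subseteq> keys f \<union> keys g"
    using keys_add[of f g] by auto
  then show ?thesis
    by (simp add: skew_apply_superset[of "keys f \<union> keys g"] lookup_add distrib_right sum.distrib)
qed

lemma skew_apply_single: "skew_apply (Poly_Mapping.single \<mu> a) l = a * fract_ext \<mu> l"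
  using skew_apply_superset[of "{\<mu>}" "Poly_Mapping.single \<mu> a" l] by simp

lemma skew_apply_sum: "skew_apply (\<Sum>i\<in>I. f i) l = (\<Sum>i\<in>I. skew_apply (f i) l)"
  by (induction I rule: infinite_finite_induct) (auto simp: skew_apply_add)

lemma skew_apply_arg_add:
  assumes "\<forall>\<mu>\<in>keys f. ring_aut \<mu>"
  shows "skew_apply f (x + y) = skew_apply f x + skew_apply f y"
  using assms by (simp add: skew_apply_def fract_ext_simps distrib_left sum.distrib)

lemma skew_apply_arg_sum:
  assumes "\<forall>\<mu>\<in>keys f. ring_aut \<mu>"
  shows "skew_apply f (\<Sum>i\<in>I. h i) = (\<Sum>i\<in>I. skew_apply f (h i))"
proof -
  have "skew_apply f 0 = 0" using assms by (simp add: skew_apply_def fract_ext_simps)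
  then show ?thesis
    by (induction I rule: infinite_finite_induct) (auto simp: skew_apply_arg_add[OF assms])
qed

lemma skew_apply_mult:
  assumes "\<forall>\<mu>\<in>keys f. ring_aut \<mu>" "\<forall>\<mu>\<in>keys g. ring_aut \<mu>"
  shows "skew_apply (skew_mult f g) l = skew_apply f (skew_apply g l)"
proof -
  have "skew_apply (skew_mult f g) l =
    (\<Sum>\<mu>\<in>keys f. \<Sum>\<nu>\<in>keys g. lookup f \<mu> * fract_ext \<mu> (lookup g \<nu>) * fract_ext (\<mu> \<circ> \<nu>) l)"
    by (simp add: skew_mult_def skew_apply_sum skew_apply_single)
  also have "\<dots> = (\<Sum>\<mu>\<in>keys f. lookup f \<mu> * fract_ext \<mu> (skew_apply g l))"
    using assms by (intro sum.cong) (auto simp: skew_apply_def fract_ext_simps fract_ext_comp sum_distrib_left mult.assoc)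
  finally show ?thesis by (simp add: skew_apply_def)
qed

lemma keys_sum_subset: "(\<And>i. i \<in> I \<Longrightarrow> keys (f i) \<subseteq> A) \<Longrightarrow> keys (\<Sum>i\<in>I. f i) \<subseteq> A"
proof (induction I rule: infinite_finite_induct)
  case (insert x F)
  then show ?case using keys_add[of "f x" "sum f F"] by auto
qed auto

lemma keys_single_subset: "\<mu> \<in> A \<Longrightarrow> keys (Poly_Mapping.single \<mu> a) \<subseteq> A"
  by (simp add: keys_single)

lemma keys_skew_mult: "keys (skew_mult f g) \<subseteq> {\<mu> \<circ> \<nu> |\<mu> \<nu>. \<mu> \<in> keys f \<and> \<nu> \<in> keys g}"
  unfolding skew_mult_def by (intro keys_sum_subset keys_single_subset) auto

lemma lookup_skew_action:
  assumes g: "ring_aut g"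
  shows "lookup (skew_action g f) \<nu> = fract_ext g (lookup f (finv g \<circ> \<nu> \<circ> g))"
proof -
  have iff: "g \<circ> \<mu> \<circ> finv g = \<nu> \<longleftrightarrow> \<mu> = finv g \<circ> \<nu> \<circ> g" for \<mu>
    using ring_autD(9,10)[OF g] by (auto simp: fun_eq_iff) metis+
  have "lookup (skew_action g f) \<nu> = (\<Sum>\<mu>\<in>keys f. if \<mu> = finv g \<circ> \<nu> \<circ> g then fract_ext g (lookup f \<mu>) else 0)"
    by (auto simp: skew_action_def lookup_sum lookup_single when_def iff intro!: sum.cong)
  also have "\<dots> = (if finv g \<circ> \<nu> \<circ> g \<in> keys f then fract_ext g (lookup f (finv g \<circ> \<nu> \<circ> g)) else 0)"
    by simp
  also have "\<dots> = fract_ext g (lookup f (finv g \<circ> \<nu> \<circ> g))"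
    using fract_ext_simps(4)[OF g] by (simp add: in_keys_iff)
  finally show ?thesis .
qed

lemma skew_action_add:
  "ring_aut g \<Longrightarrow> skew_action g (f + h) = skew_action g f + skew_action g h"
  by (rule poly_mapping_eqI) (simp add: lookup_skew_action lookup_add fract_ext_simps)

lemma skew_action_zero [simp]: "skew_action g 0 = 0"
  by (simp add: skew_action_def)

lemma skew_action_sum:
  "ring_aut g \<Longrightarrow> skew_action g (\<Sum>i\<in>I. f i) = (\<Sum>i\<in>I. skew_action g (f i))"
  by (induction I rule: infinite_finite_induct) (auto simp: skew_action_add)

lemma skew_action_minus: "ring_aut g \<Longrightarrow> skew_action g (- f) = - skew_action g f"
  by (rule poly_mapping_eqI) (simp add: lookup_skew_action fract_ext_simps)

lemma skew_action_single:
  "ring_aut g \<Longrightarrow> skew_action g (Poly_Mapping.single \<mu> a) = Poly_Mapping.single (g \<circ> \<mu> \<circ> finv g) (fract_ext g a)"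
  by (cases "a = 0") (simp_all add: skew_action_def fract_ext_simps)

lemma skew_action_comp:
  assumes "ring_aut g" "ring_aut h"
  shows "skew_action (g \<circ> h) f = skew_action g (skew_action h f)"
proof (rule poly_mapping_eqI)
  fix \<nu>
  have "finv (g \<circ> h) = finv h \<circ> finv g"
    using assms by (intro o_inv_distrib) (auto simp: ring_autD)
  then show "lookup (skew_action (g \<circ> h) f) \<nu> = lookup (skew_action g (skew_action h f)) \<nu>"
    using assms by (simp add: lookup_skew_action ring_aut_comp fract_ext_comp comp_assoc)
qed

lemma keys_skew_action: "keys (skew_action g f) \<subseteq> (\<lambda>\<mu>. g \<circ> \<mu> \<circ> finv g) ` keys f"
  unfolding skew_action_def by (intro keys_sum_subset keys_single_subset) auto

lemma skew_apply_action:
  assumes g: "ring_aut g" and f: "\<forall>\<mu>\<in>keys f. ring_aut \<mu>"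
  shows "skew_apply (skew_action g f) l = fract_ext g (skew_apply f (fract_ext (finv g) l))"
proof -
  have "skew_apply (skew_action g f) l =
    (\<Sum>\<mu>\<in>keys f. fract_ext g (lookup f \<mu>) * fract_ext (g \<circ> \<mu> \<circ> finv g) l)"
    by (simp add: skew_action_def skew_apply_sum skew_apply_single)
  also have "\<dots> = (\<Sum>\<mu>\<in>keys f. fract_ext g (lookup f \<mu> * fract_ext \<mu> (fract_ext (finv g) l)))"
    using f g by (intro sum.cong) (auto simp: fract_ext_simps fract_ext_comp ring_aut_comp ring_aut_inv)
  also have "\<dots> = fract_ext g (skew_apply f (fract_ext (finv g) l))"
    by (simp add: skew_apply_def ring_aut_sum[OF ring_aut_fract_ext[OF g]])
  finally show ?thesis .
qed

section \<open>Invariants of G and the separation of M by them\<close>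

locale galois_data =
  fixes G M :: "('a::idom \<Rightarrow> 'a) set"
  assumes G_aut: "\<And>g. g \<in> G \<Longrightarrow> ring_aut g" and M_aut: "\<And>\<mu>. \<mu> \<in> M \<Longrightarrow> ring_aut \<mu>"
    and G_id [simp, intro]: "id \<in> G" and G_comp: "\<And>g h. g \<in> G \<Longrightarrow> h \<in> G \<Longrightarrow> g \<circ> h \<in> G"
    and G_inv: "\<And>g. g \<in> G \<Longrightarrow> finv g \<in> G"
    and M_id [simp, intro]: "id \<in> M" and M_comp: "\<And>g h. g \<in> M \<Longrightarrow> h \<in> M \<Longrightarrow> g \<circ> h \<in> M"
    and M_inv: "\<And>g. g \<in> M \<Longrightarrow> finv g \<in> M"
    and fin_G [simp]: "finite G"
    and M_G_trivial: "{\<mu> \<circ> finv \<nu> |\<mu> \<nu>. \<mu> \<in> M \<and> \<nu> \<in> M} \<inter> G = {id}"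
    and conj_M: "\<And>g \<mu>. g \<in> G \<Longrightarrow> \<mu> \<in> M \<Longrightarrow> g \<circ> \<mu> \<circ> finv g \<in> M"
begin

abbreviation "\<Gamma> \<equiv> fixed_subring G"

lemma fixedD: "x \<in> \<Gamma> \<Longrightarrow> g \<in> G \<Longrightarrow> g x = x"
  by (simp add: fixed_subring_def)

lemma \<Gamma>_closed [simp]: "1 \<in> \<Gamma>" "0 \<in> \<Gamma>" "x \<in> \<Gamma> \<Longrightarrow> y \<in> \<Gamma> \<Longrightarrow> x * y \<in> \<Gamma>" "x \<in> \<Gamma> \<Longrightarrow> y \<in> \<Gamma> \<Longrightarrow> x + y \<in> \<Gamma>"
  "x \<in> \<Gamma> \<Longrightarrow> - x \<in> \<Gamma>"
proof -
  note hom = ring_autD(4-7)[OF G_aut] ring_aut_minus[OF G_aut]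
  show "1 \<in> \<Gamma>" "0 \<in> \<Gamma>" by (simp_all add: fixed_subring_def hom(3,4))
  have "g (x * y) = x * y \<and> g (x + y) = x + y" if "g \<in> G" "x \<in> \<Gamma>" "y \<in> \<Gamma>" for g
    using fixedD[OF that(2,1)] fixedD[OF that(3,1)] hom(1,2)[OF that(1), of x y] by simp
  then show "x * y \<in> \<Gamma>" "x + y \<in> \<Gamma>" if "x \<in> \<Gamma>" "y \<in> \<Gamma>"
    using that by (simp_all add: fixed_subring_def)
  have "g (- x) = - x" if "g \<in> G" "x \<in> \<Gamma>" for g
    using fixedD[OF that(2,1)] hom(5)[OF that(1), of x] by simp
  then show "- x \<in> \<Gamma>" if "x \<in> \<Gamma>"
    using that by (simp add: fixed_subring_def)
qed

lemma bij_betw_G: "h \<in> G \<Longrightarrow> bij_betw (\<lambda>g. h \<circ> g) G G"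
  by (rule bij_betw_byWitness[where f' = "\<lambda>g. finv h \<circ> g"])
    (auto simp: G_comp G_inv comp_assoc[symmetric] ring_autD(11,12)[OF G_aut])

lemma trace_in_\<Gamma>: "(\<Sum>g\<in>G. g x) \<in> \<Gamma>"
proof -
  have "h (\<Sum>g\<in>G. g x) = (\<Sum>g\<in>G. g x)" if "h \<in> G" for h
    using sum.reindex_bij_betw[OF bij_betw_G[OF that], of "\<lambda>g. g x"]
    by (simp add: ring_aut_sum[OF G_aut[OF that]])
  then show ?thesis by (simp add: fixed_subring_def)
qed

lemma norm_in_\<Gamma>: "(\<Prod>g\<in>G. g x) \<in> \<Gamma>"
proof -
  have "h (\<Prod>g\<in>G. g x) = (\<Prod>g\<in>G. g x)" if "h \<in> G" for h
    using prod.reindex_bij_betw[OF bij_betw_G[OF that], of "\<lambda>g. g x"]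
    by (simp add: ring_aut_prod[OF G_aut[OF that]])
  then show ?thesis by (simp add: fixed_subring_def)
qed

text \<open>The trace is fixed by \<open>\<theta>\<close>, which would be a linear relation between the automorphisms in
  the cosets \<open>G\<close> and \<open>\<theta> G\<close>.\<close>

lemma fixes_\<Gamma>_imp_in_G:
  assumes \<theta>: "ring_aut \<theta>" "\<And>x. x \<in> \<Gamma> \<Longrightarrow> \<theta> x = x"
  shows "\<theta> \<in> G"
proof (rule ccontr)
  assume n: "\<theta> \<notin> G"
  define H where "H = (\<lambda>g. \<theta> \<circ> g) ` G"
  have disj: "G \<inter> H = {}"
  proof -
    have "\<theta> = (\<theta> \<circ> g) \<circ> finv g" if "g \<in> G" for g
      using ring_autD(11)[OF G_aut[OF that]] by (simp add: comp_assoc)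
    then show ?thesis using n G_comp G_inv unfolding H_def by (metis (no_types, lifting) disjoint_iff imageE)
  qed
  have inj: "inj_on (\<lambda>g. \<theta> \<circ> g) G"
    using ring_autD(2)[OF \<theta>(1)] by (auto simp: inj_on_def fun_eq_iff inj_def)
  \<comment> \<open>With these signs the linear relation reads
    \<open>\<theta> (tr x) - tr x = 0\<close>.\<close>
  define c :: "('a \<Rightarrow> 'a) \<Rightarrow> 'a fract" where "c = (\<lambda>\<chi>. if \<chi> \<in> G then - 1 else 1)"
  have aut: "ring_aut \<chi>" if "\<chi> \<in> G \<union> H" for \<chi>
    using that G_aut ring_aut_comp[OF \<theta>(1)] by (auto simp: H_def)
  have "\<forall>\<chi>\<in>G \<union> H. c \<chi> = 0"
  proof (rule dedekind_independence[where \<Gamma> = UNIV and \<chi> = "\<lambda>\<chi> x. to_fract (\<chi> x)"])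
    show "(\<Sum>\<chi>\<in>G \<union> H. c \<chi> * to_fract (\<chi> x)) = 0" for x
    proof -
      have "(\<Sum>\<chi>\<in>G \<union> H. c \<chi> * to_fract (\<chi> x)) = (\<Sum>\<chi>\<in>G. - to_fract (\<chi> x)) + (\<Sum>\<chi>\<in>H. to_fract (\<chi> x))"
      proof (subst sum.union_disjoint)
        show "(\<Sum>\<chi>\<in>G. c \<chi> * to_fract (\<chi> x)) + (\<Sum>\<chi>\<in>H. c \<chi> * to_fract (\<chi> x)) =
          (\<Sum>\<chi>\<in>G. - to_fract (\<chi> x)) + (\<Sum>\<chi>\<in>H. to_fract (\<chi> x))"
          using disj by (intro arg_cong2[where f = "(+)"] sum.cong) (auto simp: c_def)
      qed (use disj in \<open>auto simp: H_def\<close>)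
      also have "\<dots> = - to_fract (\<Sum>\<chi>\<in>G. \<chi> x) + to_fract (\<theta> (\<Sum>\<chi>\<in>G. \<chi> x))"
        unfolding H_def using inj \<theta>(1) by (simp add: sum.reindex ring_aut_sum sum_negf to_fract_sum)
      also have "\<dots> = 0" using \<theta>(2)[OF trace_in_\<Gamma>] by simp
      finally show ?thesis .
    qed
    fix i assume "i \<in> G \<union> H"
    then show "to_fract (i 1) = 1" "to_fract (i (x * y)) = to_fract (i x) * to_fract (i y)" for x y
      using ring_autD(5,6)[OF aut[of i]] by simp_all
    show "\<exists>x\<in>UNIV. to_fract (i x) \<noteq> to_fract (j x)" if "i \<noteq> j" for j
      using that by (metis UNIV_I ext to_fract_eq_iff)
  qed (simp_all add: H_def)
  then have "c id = 0" using G_id by blast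
  then show False using G_id by (simp add: c_def)
qed

text \<open>If \<open>\<mu>\<close> and \<open>\<nu>\<close> agree on \<Gamma>, then the inverse of
  \<open>\<nu>\<close> composed with \<open>\<mu>\<close> fixes \<Gamma>, so it lies in
  \<open>G\<close> and, \<open>M\<close> being a group, also in \<open>M M^-1\<close>.\<close>

lemma separating:
  assumes "\<mu> \<in> M" "\<nu> \<in> M" "\<mu> \<noteq> \<nu>"
  shows "\<exists>x\<in>\<Gamma>. \<mu> x \<noteq> \<nu> x"
proof (rule ccontr)
  assume n: "\<not> (\<exists>x\<in>\<Gamma>. \<mu> x \<noteq> \<nu> x)"
  \<comment> \<open>The double inverse gives \<open>\<theta>\<close> literally the shape of a member
    of the set in \<open>M_G_trivial\<close>.\<close>
  define \<theta> where "\<theta> = finv \<nu> \<circ> finv (finv \<mu>)"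
  have finv: "finv (finv \<mu>) = \<mu>" using ring_autD(1)[OF M_aut[OF assms(1)]] by (rule inv_inv_eq)
  have "ring_aut \<theta>" using assms M_aut ring_aut_comp ring_aut_inv unfolding \<theta>_def finv by blast
  moreover have "\<theta> x = x" if "x \<in> \<Gamma>" for x
    using n that ring_autD(10)[OF M_aut[OF assms(2)]] by (auto simp: \<theta>_def finv)
  ultimately have "\<theta> \<in> G" by (rule fixes_\<Gamma>_imp_in_G)
  moreover have "\<theta> \<in> {\<mu> \<circ> finv \<nu> |\<mu> \<nu>. \<mu> \<in> M \<and> \<nu> \<in> M}"
    using assms M_inv unfolding \<theta>_def by blast
  ultimately have "\<theta> = id" using M_G_trivial by blast
  then have "\<nu> \<circ> (finv \<nu> \<circ> \<mu>) = \<nu> \<circ> id" by (simp add: \<theta>_def finv)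
  then show False
    using ring_autD(11)[OF M_aut[OF assms(2)]] assms(3) by (simp add: comp_assoc[symmetric])
qed

lemma skew_coeffs_zero:
  assumes "finite S" "S \<subseteq> M" "\<And>x. x \<in> \<Gamma> \<Longrightarrow> (\<Sum>\<mu>\<in>S. c \<mu> * to_fract (\<mu> x)) = 0"
  shows "\<forall>\<mu>\<in>S. c \<mu> = 0"
proof (rule dedekind_independence[where \<Gamma> = \<Gamma> and \<chi> = "\<lambda>\<chi> x. to_fract (\<chi> x)"])
  show "\<exists>x\<in>\<Gamma>. to_fract (i x) \<noteq> to_fract (j x)" if "i \<in> S" "j \<in> S" "i \<noteq> j" for i j
    using separating[of i j] that assms(2) by auto
  fix i assume "i \<in> S"
  then have "ring_aut i" using assms(2) M_aut by blast
  then show "to_fract (i 1) = 1" "to_fract (i (x * y)) = to_fract (i x) * to_fract (i y)" for x y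
    using ring_autD(5,6)[of i] by simp_all
qed (use assms in auto)

lemma skew_apply_mult_to_fract:
  assumes "keys f \<subseteq> M"
  shows "skew_apply f (to_fract x * y) = (\<Sum>\<mu>\<in>keys f. (lookup f \<mu> * fract_ext \<mu> y) * to_fract (\<mu> x))"
  unfolding skew_apply_def using assms M_aut
  by (intro sum.cong) (auto simp: fract_ext_simps fract_ext_to_fract)

text \<open>For fixed \<open>y\<close> the value at \<open>x y\<close> is a combination of the
  characters \<open>\<mu>\<close> restricted to \<Gamma>, with coefficients
  \<open>lookup f \<mu>\<close> times the image of \<open>y\<close>, so Dedekind's lemma applies.
  The vector \<open>y\<close> is there for the substitution argument, where a nonzero element of
  \<open>U\<close> must not kill all of \<open>\<Gamma> y\<close>.\<close>

lemma skew_apply_faithful: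
  assumes "keys f \<subseteq> M" "y \<noteq> 0" "\<And>x. x \<in> \<Gamma> \<Longrightarrow> skew_apply f (to_fract x * y) = 0"
  shows "f = 0"
proof -
  have "\<forall>\<mu>\<in>keys f. lookup f \<mu> * fract_ext \<mu> y = 0"
    using assms skew_apply_mult_to_fract[OF assms(1)] by (intro skew_coeffs_zero) auto
  moreover have "fract_ext \<mu> y \<noteq> 0" if "\<mu> \<in> keys f" for \<mu>
    using ring_autD(8)[OF ring_aut_fract_ext[OF M_aut]] assms that by auto
  ultimately show ?thesis by (auto simp: in_keys_iff intro!: poly_mapping_eqI)
qed

text \<open>Faithfulness turns skew elements into operators on \<open>L\<close>; the ring axioms and
  the compatibility with \<open>G\<close> below reduce to composition of operators.\<close>

lemma skew_eqI:
  assumes "keys f \<subseteq> M" "keys g \<subseteq> M" "\<And>l. skew_apply f l = skew_apply g l"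
  shows "f = g"
proof -
  have "skew_apply (f - g) l = 0" for l
    using assms(3)[of l] skew_apply_add[of "f - g" g l] by simp
  moreover have "keys (f - g) \<subseteq> M" using assms keys_diff[of f g] by blast
  ultimately have "f - g = 0" by (intro skew_apply_faithful[of "f - g" 1]) auto
  then show ?thesis by simp
qed

end

lemma lookup_skew_embed_mult:
  "lookup (skew_mult (skew_embed x) f) \<nu> = x * lookup f \<nu>"
proof (cases "x = 0")
  case False
  have "skew_mult (skew_embed x) f = (\<Sum>\<nu>\<in>keys f. Poly_Mapping.single \<nu> (x * lookup f \<nu>))"
    using False by (simp add: skew_mult_def skew_embed_def)
  then have "lookup (skew_mult (skew_embed x) f) \<nu> = (\<Sum>\<mu>\<in>keys f. if \<mu> = \<nu> then x * lookup f \<mu> else 0)"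
    by (auto simp: lookup_sum lookup_single when_def intro!: sum.cong)
  also have "\<dots> = x * lookup f \<nu>" by (simp add: in_keys_iff)
  finally show ?thesis .
qed (simp add: skew_mult_def skew_embed_def)

lemma keys_skew_embed_mult: "keys (skew_mult (skew_embed x) f) \<subseteq> keys f"
  by (auto simp: in_keys_iff lookup_skew_embed_mult)

lemma keys_skew_embed: "id \<in> A \<Longrightarrow> keys (skew_embed x) \<subseteq> A"
  by (simp add: skew_embed_def keys_single)

lemma skew_apply_embed [simp]: "skew_apply (skew_embed x) l = x * l"
  by (simp add: skew_embed_def skew_apply_single)

lemma skew_apply_embed_mult: "skew_apply (skew_mult (skew_embed x) f) l = x * skew_apply f l"
  using keys_skew_embed_mult[of x f]
  by (simp add: skew_apply_superset[of "keys f"] lookup_skew_embed_mult sum_distrib_left mult.assoc)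

section \<open>The ring of invariants, traces and annihilators\<close>

context galois_data
begin

abbreviation KK where "KK \<equiv> invariant_skew_ring G M"

lemma KK_simps [simp]:
  "monoid.mult KK = skew_mult" "one KK = skew_embed 1" "zero KK = 0" "add KK = (+)"
  by (simp_all add: invariant_skew_ring_def skew_ring_def skew_embed_def)

lemma KK_carrier: "f \<in> carrier KK \<longleftrightarrow> keys f \<subseteq> M \<and> (\<forall>g\<in>G. skew_action g f = f)"
  by (simp add: invariant_skew_ring_def skew_ring_def)

lemma keys_M_aut: "keys f \<subseteq> M \<Longrightarrow> \<forall>\<mu>\<in>keys f. ring_aut \<mu>"
  using M_aut by blast

lemma keys_mult_M: "keys f \<subseteq> M \<Longrightarrow> keys h \<subseteq> M \<Longrightarrow> keys (skew_mult f h) \<subseteq> M"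
  using keys_skew_mult[of f h] M_comp by blast

lemma keys_add_M: "keys f \<subseteq> M \<Longrightarrow> keys h \<subseteq> M \<Longrightarrow> keys (f + h) \<subseteq> M"
  using keys_add[of f h] by blast

lemma keys_action_M:
  assumes "g \<in> G" "keys f \<subseteq> M"
  shows "keys (skew_action g f) \<subseteq> M"
  using keys_skew_action[of g f] conj_M[OF assms(1)] assms(2) by blast

lemma apply_mult: "keys f \<subseteq> M \<Longrightarrow> keys h \<subseteq> M \<Longrightarrow> skew_apply (skew_mult f h) l = skew_apply f (skew_apply h l)"
  by (intro skew_apply_mult keys_M_aut)

lemma apply_arg_add: "keys f \<subseteq> M \<Longrightarrow> skew_apply f (x + y) = skew_apply f x + skew_apply f y"
  by (intro skew_apply_arg_add keys_M_aut)

lemma skew_mult_assoc: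
  assumes "keys f \<subseteq> M" "keys h \<subseteq> M" "keys k \<subseteq> M"
  shows "skew_mult (skew_mult f h) k = skew_mult f (skew_mult h k)"
  using assms by (intro skew_eqI keys_mult_M) (simp_all add: apply_mult keys_mult_M)

lemma skew_mult_one: "keys f \<subseteq> M \<Longrightarrow> skew_mult (skew_embed 1) f = f" "keys f \<subseteq> M \<Longrightarrow> skew_mult f (skew_embed 1) = f"
  by (rule skew_eqI; simp add: apply_mult keys_mult_M keys_skew_embed[OF M_id])+

lemma skew_mult_distrib:
  assumes "keys f \<subseteq> M" "keys h \<subseteq> M" "keys k \<subseteq> M"
  shows "skew_mult (f + h) k = skew_mult f k + skew_mult h k" "skew_mult k (f + h) = skew_mult k f + skew_mult k h"
  using assms
  by (intro skew_eqI keys_mult_M keys_add_M; simp add: apply_mult keys_mult_M keys_add_M skew_apply_add apply_arg_add)+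

lemma apply_action:
  "g \<in> G \<Longrightarrow> keys f \<subseteq> M \<Longrightarrow> skew_apply (skew_action g f) l = fract_ext g (skew_apply f (fract_ext (finv g) l))"
  by (intro skew_apply_action G_aut keys_M_aut)

lemma fract_ext_inv_cancel:
  assumes "ring_aut g"
  shows "fract_ext (finv g) (fract_ext g l) = l" "fract_ext g (fract_ext (finv g) l) = l"
  using fract_ext_comp[OF ring_aut_inv[OF assms] assms, of l] fract_ext_comp[OF assms ring_aut_inv[OF assms], of l]
  by (simp_all add: ring_autD(11,12)[OF assms])

lemma skew_action_mult:
  assumes "g \<in> G" "keys f \<subseteq> M" "keys h \<subseteq> M"
  shows "skew_action g (skew_mult f h) = skew_mult (skew_action g f) (skew_action g h)"
  using assms
  by (intro skew_eqI keys_mult_M keys_action_M)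
    (simp_all add: apply_mult apply_action keys_mult_M keys_action_M fract_ext_inv_cancel[OF G_aut])

lemma skew_action_embed: "g \<in> G \<Longrightarrow> skew_action g (skew_embed x) = skew_embed (fract_ext g x)"
  using skew_action_single[OF G_aut, of g id x] ring_autD(11)[OF G_aut, of g] by (simp add: skew_embed_def)

lemma KK_closed:
  "f \<in> carrier KK \<Longrightarrow> h \<in> carrier KK \<Longrightarrow> f + h \<in> carrier KK"
  "f \<in> carrier KK \<Longrightarrow> h \<in> carrier KK \<Longrightarrow> skew_mult f h \<in> carrier KK"
  "f \<in> carrier KK \<Longrightarrow> - f \<in> carrier KK" "0 \<in> carrier KK" "skew_embed 1 \<in> carrier KK"
  using ring_autD(6)[OF ring_aut_fract_ext[OF G_aut]]
  by (simp_all add: KK_carrier keys_add_M keys_mult_M skew_action_add G_aut skew_action_mult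
      skew_action_minus skew_action_embed keys_skew_embed)

lemma ring_KK: "ring KK"
proof (rule ringI)
  show "abelian_group KK"
    by (rule abelian_groupI) (auto simp: KK_closed add_ac intro!: bexI[of _ "- _"])
  show "Group.monoid KK"
    by (rule Group.monoidI) (simp_all add: KK_closed, simp_all add: skew_mult_assoc skew_mult_one KK_carrier)
qed (simp_all add: KK_carrier skew_mult_distrib)

definition skew_trace :: "'a skew \<Rightarrow> 'a skew" where
  "skew_trace f = (\<Sum>g\<in>G. skew_action g f)"

lemma skew_trace_in_KK:
  assumes "keys f \<subseteq> M"
  shows "skew_trace f \<in> carrier KK"
proof -
  have "skew_action h (skew_trace f) = skew_trace f" if h: "h \<in> G" for h
  proof -
    have "skew_action h (skew_trace f) = (\<Sum>g\<in>G. skew_action (h \<circ> g) f)"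
      using h by (simp add: skew_trace_def skew_action_sum G_aut skew_action_comp)
    then show ?thesis
      using sum.reindex_bij_betw[OF bij_betw_G[OF h], of "\<lambda>g. skew_action g f"] by (simp add: skew_trace_def)
  qed
  moreover have "keys (skew_trace f) \<subseteq> M"
    unfolding skew_trace_def using assms by (intro keys_sum_subset keys_action_M)
  ultimately show ?thesis by (simp add: KK_carrier)
qed

text \<open>The trace of \<open>f\<close> itself may vanish. The coefficient at \<open>\<mu>\<close>
  of the trace of \<open>b f\<close> is a combination of the values \<open>g b\<close>, in which the
  identity of \<open>G\<close> has a nonzero coefficient, so by Dedekind's lemma it is nonzero for
  some \<open>b\<close>.\<close>

lemma skew_trace_nonzero:
  assumes "keys f \<subseteq> M" "\<mu> \<in> keys f"
  obtains b where "lookup (skew_trace (skew_mult (skew_embed (to_fract b)) f)) \<mu> \<noteq> 0"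
proof (rule ccontr)
  assume n: "\<not> thesis"
  define c where "c g = fract_ext g (lookup f (finv g \<circ> \<mu> \<circ> g))" for g
  have "(\<Sum>g\<in>G. c g * to_fract (g b)) = 0" for b
  proof -
    have "(\<Sum>g\<in>G. c g * to_fract (g b)) = lookup (skew_trace (skew_mult (skew_embed (to_fract b)) f)) \<mu>"
      unfolding skew_trace_def lookup_sum using G_aut
      by (intro sum.cong)
        (simp_all add: lookup_skew_action lookup_skew_embed_mult fract_ext_simps fract_ext_to_fract c_def)
    then show ?thesis using n that by metis
  qed
  then have "\<forall>g\<in>G. c g = 0"
  proof (intro dedekind_independence[where \<Gamma> = UNIV and \<chi> = "\<lambda>\<chi> x. to_fract (\<chi> x)"])
    fix i assume i: "i \<in> G"
    then show "to_fract (i 1) = 1" "to_fract (i (x * y)) = to_fract (i x) * to_fract (i y)" for x y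
      using ring_autD(5,6)[OF G_aut[OF i]] by simp_all
    show "\<exists>x\<in>UNIV. to_fract (i x) \<noteq> to_fract (j x)" if "i \<noteq> j" for j
      using that by (metis UNIV_I ext to_fract_eq_iff)
  qed auto
  then have "c id = 0" using G_id by blast
  then show False using assms(2) by (simp add: c_def in_keys_iff)
qed

text \<open>Finitely many linear conditions leave room among infinitely many coefficients. The
  excluded set \<open>E\<close> lets the induction produce two solutions with disjoint supports, so
  that the combination \<open>c2 z1 - c1 z2\<close> killing the additional vector cannot cancel to
  zero.\<close>

lemma skew_annihilator_disjoint:
  assumes "infinite M" "finite W" "finite E"
  shows "\<exists>z. z \<noteq> 0 \<and> keys z \<subseteq> M - E \<and> (\<forall>w\<in>W. skew_apply z w = 0)"
  using assms(2,3)
proof (induction W arbitrary: E rule: finite_induct)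
  case empty
  then obtain \<mu> where "\<mu> \<in> M - E" using assms(1) by (metis Diff_infinite_finite ex_in_conv finite.emptyI)
  moreover have "Poly_Mapping.single \<mu> 1 \<noteq> (0 :: 'a skew)"
    by (metis insert_not_empty keys_single keys_zero zero_neq_one)
  ultimately show ?case
    by (intro exI[of _ "Poly_Mapping.single \<mu> 1"]) (auto simp: keys_single)
next
  case (insert w W)
  obtain z1 where z1: "z1 \<noteq> 0" "keys z1 \<subseteq> M - E" "\<forall>w\<in>W. skew_apply z1 w = 0"
    using insert.IH[OF insert.prems] by blast
  obtain z2 where z2: "z2 \<noteq> 0" "keys z2 \<subseteq> M - (E \<union> keys z1)" "\<forall>w\<in>W. skew_apply z2 w = 0"
    using insert.IH[of "E \<union> keys z1"] insert.prems by auto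
  define c1 c2 where "c1 = skew_apply z1 w" and "c2 = skew_apply z2 w"
  show ?case
  proof (cases "c1 = 0")
    case True
    then show ?thesis using z1 by (intro exI[of _ z1]) (simp add: c1_def)
  next
    case False
    define z where "z = skew_mult (skew_embed c2) z1 + skew_mult (skew_embed (- c1)) z2"
    obtain \<nu> where \<nu>: "\<nu> \<in> keys z2" using z2(1) by (metis keys_eq_empty ex_in_conv)
    then have "lookup z1 \<nu> = 0" using z2(2) by (auto simp: in_keys_iff)
    then have "lookup z \<nu> \<noteq> 0"
      using \<nu> False by (simp add: z_def lookup_add lookup_skew_embed_mult in_keys_iff)
    then have "z \<noteq> 0" by auto
    moreover have "keys z \<subseteq> M - E"
      using keys_add[of "skew_mult (skew_embed c2) z1" "skew_mult (skew_embed (- c1)) z2"]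
        keys_skew_embed_mult[of c2 z1] keys_skew_embed_mult[of "- c1" z2] z1(2) z2(2) unfolding z_def by blast
    moreover have "skew_apply z v = 0" if "v \<in> insert w W" for v
      using that z1(3) z2(3)
      by (auto simp: z_def skew_apply_add skew_apply_embed_mult c1_def c2_def mult.commute)
    ultimately show ?thesis by blast
  qed
qed

definition fixed_field :: "'a fract set" where
  "fixed_field = {l. \<forall>g\<in>G. fract_ext g l = l}"

lemma apply_fixed_field:
  assumes "f \<in> carrier KK" "l \<in> fixed_field"
  shows "skew_apply f l \<in> fixed_field"
proof -
  have "fract_ext g (skew_apply f l) = skew_apply f l" if g: "g \<in> G" for g
  proof -
    have "fract_ext (finv g) l = l" using assms(2) G_inv[OF g] by (simp add: fixed_field_def)
    moreover have "skew_action g f = f" "keys f \<subseteq> M" using assms(1) g by (auto simp: KK_carrier)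
    ultimately show ?thesis using apply_action[OF g, of f l] by simp
  qed
  then show ?thesis by (simp add: fixed_field_def)
qed

lemma to_fract_\<Gamma>_fixed: "x \<in> \<Gamma> \<Longrightarrow> to_fract x \<in> fixed_field"
  using fract_ext_to_fract[OF G_aut] by (simp add: fixed_field_def fixed_subring_def)

lemma embed_in_KK: "x \<in> fixed_field \<Longrightarrow> skew_embed x \<in> carrier KK"
  by (simp add: KK_carrier keys_skew_embed skew_action_embed fixed_field_def)

lemma Gamma_in_iff: "x \<in> Gamma_in G \<longleftrightarrow> (\<exists>a\<in>\<Gamma>. x = skew_embed (to_fract a))"
  by (auto simp: Gamma_in_def)

lemma skew_mult_embed_embed: "skew_mult (skew_embed x) (skew_embed y) = skew_embed (x * y)"
  by (rule poly_mapping_eqI) (simp add: lookup_skew_embed_mult, simp add: skew_embed_def lookup_single when_def)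

end

section \<open>Galois rings and polynomial identities\<close>

locale galois_ring_data = galois_data +
  fixes U
  assumes U_ring: "galois_ring G M U"
begin

lemma U_subring: "subring U KK" and \<Gamma>_in_U: "Gamma_in G \<subseteq> U"
  and KU: "K_in G \<cdot>\<^bsub>KK\<^esub> U = carrier KK"
  using U_ring by (auto simp: galois_ring_def Let_def)

lemma U_KK: "u \<in> U \<Longrightarrow> u \<in> carrier KK"
  using subringE(1)[OF U_subring] by blast

lemma U_keys: "u \<in> U \<Longrightarrow> keys u \<subseteq> M"
  using U_KK KK_carrier by blast

lemma U_closed: "0 \<in> U" "skew_embed 1 \<in> U" "u \<in> U \<Longrightarrow> v \<in> U \<Longrightarrow> u + v \<in> U"
  "u \<in> U \<Longrightarrow> v \<in> U \<Longrightarrow> skew_mult u v \<in> U"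
  using subringE(2,3,6,7)[OF U_subring] by auto

lemma embed_U: "a \<in> \<Gamma> \<Longrightarrow> skew_embed (to_fract a) \<in> U"
  using \<Gamma>_in_U Gamma_in_iff by blast

lemma clear_denominator:
  assumes "x \<in> carrier KK"
  obtains b where "b \<in> \<Gamma>" "b \<noteq> 0" "skew_mult (skew_embed (to_fract b)) x \<in> U"
proof -
  have "x \<in> K_in G \<cdot>\<^bsub>KK\<^esub> U" using assms KU by simp
  then have "\<exists>b\<in>\<Gamma>. b \<noteq> 0 \<and> skew_mult (skew_embed (to_fract b)) x \<in> U"
  proof induction
    case (prod k u)
    then obtain a b where ab: "k = skew_embed (Fract a b)" "a \<in> \<Gamma>" "b \<in> \<Gamma>" "b \<noteq> 0" by (auto simp: K_in_def)
    have "skew_mult (skew_embed (to_fract b)) (skew_mult k u) = skew_mult (skew_embed (to_fract a)) u"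
      using ab by (intro poly_mapping_eqI) (simp add: lookup_skew_embed_mult to_fract_def eq_fract flip: mult.assoc)
    then show ?case using ab U_closed(4)[OF embed_U[OF ab(2)] prod(2)] by auto
  next
    case (sum x y)
    then obtain b c where bc: "b \<in> \<Gamma>" "b \<noteq> 0" "skew_mult (skew_embed (to_fract b)) x \<in> U"
      "c \<in> \<Gamma>" "c \<noteq> 0" "skew_mult (skew_embed (to_fract c)) y \<in> U" by auto
    have "skew_mult (skew_embed (to_fract (b * c))) (x + y) =
       skew_mult (skew_embed (to_fract c)) (skew_mult (skew_embed (to_fract b)) x) +
       skew_mult (skew_embed (to_fract b)) (skew_mult (skew_embed (to_fract c)) y)"
      by (rule poly_mapping_eqI) (simp add: lookup_skew_embed_mult lookup_add algebra_simps)
    moreover have "\<dots> \<in> U"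
      by (intro U_closed(3) U_closed(4)[OF embed_U[OF bc(4)] bc(3)] U_closed(4)[OF embed_U[OF bc(1)] bc(6)])
    ultimately show ?case using bc by (intro bexI[of _ "b * c"]) auto
  qed
  then show thesis using that by blast
qed

text \<open>An annihilator in \<open>L * M\<close> becomes an element of \<open>U\<close> by taking
  a trace and clearing its denominator. The trace still kills \<open>W\<close> because
  \<open>W\<close> is fixed by \<open>G\<close>, and the multiplier \<open>b\<close> keeps it
  nonzero.\<close>

lemma annihilator_in_U:
  assumes "infinite M" "finite W" "W \<subseteq> fixed_field"
  obtains u where "u \<in> U" "u \<noteq> 0" "\<And>w. w \<in> W \<Longrightarrow> skew_apply u w = 0"
proof -
  obtain z where z: "z \<noteq> 0" "keys z \<subseteq> M" "\<forall>w\<in>W. skew_apply z w = 0"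
    using skew_annihilator_disjoint[OF assms(1,2), of "{}"] by auto
  obtain \<mu> where \<mu>: "\<mu> \<in> keys z" using z(1) by (metis keys_eq_empty ex_in_conv)
  obtain b where b: "lookup (skew_trace (skew_mult (skew_embed (to_fract b)) z)) \<mu> \<noteq> 0"
    using skew_trace_nonzero[OF z(2) \<mu>] by blast
  define y where "y = skew_mult (skew_embed (to_fract b)) z"
  have y: "keys y \<subseteq> M" using keys_skew_embed_mult[of "to_fract b" z] z(2) by (auto simp: y_def)
  have kill: "skew_apply (skew_trace y) w = 0" if w: "w \<in> W" for w
  proof -
    have "skew_apply (skew_action g y) w = 0" if g: "g \<in> G" for g
    proof -
      have "fract_ext (finv g) w = w" using w assms(3) G_inv[OF g] by (auto simp: fixed_field_def)
      then show ?thesis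
        using apply_action[OF g y] z(3) w fract_ext_simps(4)[OF G_aut[OF g]] by (simp add: y_def skew_apply_embed_mult)
    qed
    then show ?thesis by (simp add: skew_trace_def skew_apply_sum)
  qed
  obtain c where c: "c \<in> \<Gamma>" "c \<noteq> 0" "skew_mult (skew_embed (to_fract c)) (skew_trace y) \<in> U"
    using clear_denominator[OF skew_trace_in_KK[OF y]] by blast
  have "lookup (skew_mult (skew_embed (to_fract c)) (skew_trace y)) \<mu> \<noteq> 0"
    using b c by (simp add: lookup_skew_embed_mult y_def)
  then have "skew_mult (skew_embed (to_fract c)) (skew_trace y) \<noteq> 0" by auto
  then show thesis using that c kill by (simp add: skew_apply_embed_mult)
qed

definition word_apply :: "(nat \<Rightarrow> 'a skew) \<Rightarrow> nat list \<Rightarrow> 'a fract" where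
  "word_apply a w = foldr (\<lambda>i. skew_apply (a i)) w 1"

lemma word_apply_simps [simp]: "word_apply a [] = 1" "word_apply a (i # w) = skew_apply (a i) (word_apply a w)"
  by (simp_all add: word_apply_def)

text \<open>No linearization is needed to contradict an identity when \<open>M\<close> is infinite: the
  substitution is built letter by letter along the chosen leading word, adding at each step an
  element that annihilates the values of all other words that are short enough.\<close>

lemma separating_substitution:
  assumes inf: "infinite M" and N: "finite N"
  shows "set w \<subseteq> N \<Longrightarrow> \<exists>a z. (\<forall>i. a i \<in> U) \<and> z \<in> U \<and> skew_apply z (word_apply a w) \<noteq> 0 \<and>
    (\<forall>v. set v \<subseteq> N \<longrightarrow> length v \<le> length w \<longrightarrow> v \<noteq> w \<longrightarrow> skew_apply z (word_apply a v) = 0)"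
proof (induction w)
  case Nil
  show ?case
    by (intro exI[of _ "\<lambda>_. 0"] exI[of _ "skew_embed 1"]) (auto simp: U_closed)
next
  case (Cons i w)
  then obtain a z where a: "\<And>j. a j \<in> U" and z: "z \<in> U" "skew_apply z (word_apply a w) \<noteq> 0"
    "\<And>v. set v \<subseteq> N \<Longrightarrow> length v \<le> length w \<Longrightarrow> v \<noteq> w \<Longrightarrow> skew_apply z (word_apply a v) = 0"
    by auto
  define y where "y = skew_apply z (word_apply a w)"
  define Y where "Y = word_apply a ` {v. set v \<subseteq> N \<and> length v \<le> length (i # w)}"
  have one: "1 \<in> fixed_field"
    using to_fract_\<Gamma>_fixed[OF \<Gamma>_closed(1)] by simp
  have "word_apply a v \<in> fixed_field" for v
    by (induction v) (auto simp: one intro: apply_fixed_field U_KK a)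
  then have "finite Y" "Y \<subseteq> fixed_field"
    using finite_lists_length_le[OF N] by (auto simp: Y_def)
  then obtain u where u: "u \<in> U" "u \<noteq> 0" "\<And>w. w \<in> Y \<Longrightarrow> skew_apply u w = 0"
    using annihilator_in_U[OF inf] by metis
  \<comment> \<open>\<open>u\<close> kills every value taken so far, so of the new value of
    \<open>i # w\<close> it sees only the increment \<open>c y\<close>. Choosing \<open>c\<close> in
    \<Gamma> makes this increment visible to \<open>u\<close> and keeps \<open>t\<close> in
    \<open>U\<close>.\<close>
  obtain c where c: "c \<in> \<Gamma>" "skew_apply u (to_fract c * y) \<noteq> 0"
    using skew_apply_faithful[OF U_keys[OF u(1)], of y] z(2) u(2) by (auto simp: y_def)
  define t where "t = skew_mult (skew_embed (to_fract c)) z"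
  define a' where "a' = a(i := a i + t)"
  have t: "t \<in> U" unfolding t_def by (intro U_closed(4) embed_U c z)
  have a'U: "a' j \<in> U" for j using a t by (auto simp: a'_def U_closed)
  have step: "skew_apply (a' j) l = skew_apply (a j) l + (if j = i then to_fract c * skew_apply z l else 0)" for j l
    by (simp add: a'_def skew_apply_add t_def skew_apply_embed_mult)
  \<comment> \<open>The changed letter adds \<open>c z\<close> applied to the value of the rest of
    the word, and \<open>z\<close> kills that value unless the rest is \<open>w\<close>. In a word
    no longer than \<open>w\<close> the rest is too short for that.\<close>
  have short: "word_apply a' v = word_apply a v" if "set v \<subseteq> N" "length v \<le> length w" for v
    using that
  proof (induction v)
    case (Cons j v)
    then have "skew_apply z (word_apply a v) = 0" by (intro z(3)) auto
    then show ?case using Cons by (simp add: step)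
  qed simp
  have long: "word_apply a' v = word_apply a v" if v: "set v \<subseteq> N" "length v \<le> length (i # w)" "v \<noteq> i # w" for v
  proof (cases v)
    case (Cons j v')
    have eq: "word_apply a' v' = word_apply a v'" using short[of v'] v Cons by simp
    show ?thesis
    proof (cases "j = i")
      case True
      then have "skew_apply z (word_apply a v') = 0" using v Cons by (intro z(3)) auto
      then show ?thesis using Cons eq by (simp add: step)
    qed (use Cons eq in \<open>simp add: step\<close>)
  qed simp
  have "word_apply a' (i # w) = word_apply a (i # w) + to_fract c * y"
    using short[of w] Cons.prems by (simp add: step y_def)
  moreover have "word_apply a (i # w) \<in> Y" using Cons.prems unfolding Y_def by blast
  ultimately have "skew_apply u (word_apply a' (i # w)) = skew_apply u (to_fract c * y)"
    using u(3) by (simp only: apply_arg_add[OF U_keys[OF u(1)]]) simp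
  moreover have "skew_apply u (word_apply a' v) = 0"
    if "set v \<subseteq> N" "length v \<le> length (i # w)" "v \<noteq> i # w" for v
    using long[OF that] u(3)[of "word_apply a v"] that unfolding Y_def by auto
  ultimately show ?case
    using a'U u(1) c(2) by (intro exI[of _ a'] exI[of _ u]) auto
qed

lemma finsum_eq_sum:
  assumes "finite A" "\<And>a. a \<in> A \<Longrightarrow> f a \<in> U"
  shows "finsum (KK\<lparr>carrier := U\<rparr>) f A = sum f A"
proof -
  interpret U: ring "KK\<lparr>carrier := U\<rparr>" by (rule ring.subring_is_ring[OF ring_KK U_subring])
  show ?thesis
    using assms
  proof (induction A rule: finite_induct)
    case (insert x F)
    then show ?case using U.finsum_insert[of F x f] by simp
  qed simp
qed

text \<open>The substituted identity is applied to \<open>1\<close> in \<open>L\<close>, and then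
  \<open>z\<close> to the result: \<open>z\<close> kills the value of every word except
  \<open>w\<close>, whose coefficient is \<open>1\<close>. The scalars pass through \<open>z\<close>
  because \<open>M\<close> fixes them.\<close>

lemma finite_M_of_PI:
  fixes \<kappa> :: "'k::field \<Rightarrow> 'a"
  assumes \<kappa>: "\<And>c. \<kappa> c \<in> \<Gamma>" "\<And>c \<mu>. \<mu> \<in> M \<Longrightarrow> \<mu> (\<kappa> c) = \<kappa> c" "\<kappa> 1 = 1"
    and PI: "PI_algebra (\<lambda>c. skew_embed (to_fract (\<kappa> c))) (KK\<lparr>carrier := U\<rparr>)"
  shows "finite M"
proof (rule ccontr)
  assume inf: "infinite M"
  let ?\<iota> = "\<lambda>c. skew_embed (to_fract (\<kappa> c))" and ?R = "KK\<lparr>carrier := U\<rparr>"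
  obtain p :: "nat list \<Rightarrow>\<^sub>0 'k" and w where p: "lookup p w = 1" "\<forall>v\<in>keys p. length v \<le> length w"
    and eval: "\<And>a. (\<forall>i. a i \<in> U) \<Longrightarrow> nc_eval ?\<iota> ?R p a = 0"
    using PI by (auto simp: PI_algebra_def)
  have w: "w \<in> keys p" using p(1) by (simp add: in_keys_iff)
  define N where "N = (\<Union>v\<in>keys p. set v)"
  have N: "finite N" "set w \<subseteq> N" using w by (auto simp: N_def)
  obtain a z where a: "\<forall>i. a i \<in> U" and z: "z \<in> U" "skew_apply z (word_apply a w) \<noteq> 0"
    "\<And>v. set v \<subseteq> N \<Longrightarrow> length v \<le> length w \<Longrightarrow> v \<noteq> w \<Longrightarrow> skew_apply z (word_apply a v) = 0"
    using separating_substitution[OF inf N] by blast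
  define W where "W v = foldr (\<lambda>i r. skew_mult (a i) r) v (skew_embed 1)" for v
  have WU: "W v \<in> U" for v by (induction v) (auto simp: W_def U_closed a)
  have W: "skew_apply (W v) 1 = word_apply a v" for v
  proof (induction v)
    case (Cons j v)
    have "W (j # v) = skew_mult (a j) (W v)" by (simp add: W_def)
    then show ?case using Cons apply_mult[of "a j" "W v" 1] U_keys WU a by simp
  qed (simp add: W_def)
  have "nc_eval ?\<iota> ?R p a = (\<Sum>v\<in>keys p. skew_mult (?\<iota> (lookup p v)) (W v))"
    unfolding nc_eval_def using embed_U \<kappa>(1) WU U_closed(4)
    by (subst finsum_eq_sum) (auto simp: W_def)
  then have "(\<Sum>v\<in>keys p. skew_mult (?\<iota> (lookup p v)) (W v)) = 0" using eval a by simp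
  then have "skew_apply (\<Sum>v\<in>keys p. skew_mult (?\<iota> (lookup p v)) (W v)) 1 = 0" by simp
  then have "(\<Sum>v\<in>keys p. to_fract (\<kappa> (lookup p v)) * word_apply a v) = 0"
    by (simp add: skew_apply_sum skew_apply_embed_mult W)
  then have "0 = skew_apply z (\<Sum>v\<in>keys p. to_fract (\<kappa> (lookup p v)) * word_apply a v)"
    using skew_apply_arg_sum[OF keys_M_aut[OF U_keys[OF z(1)]], of "\<lambda>_. 0" "{}"] by simp
  also have "\<dots> = (\<Sum>v\<in>keys p. skew_apply z (to_fract (\<kappa> (lookup p v)) * word_apply a v))"
    by (rule skew_apply_arg_sum[OF keys_M_aut[OF U_keys[OF z(1)]]])
  also have "\<dots> = (\<Sum>v\<in>keys p. to_fract (\<kappa> (lookup p v)) * skew_apply z (word_apply a v))"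
  proof (rule sum.cong)
    fix v
    show "skew_apply z (to_fract (\<kappa> (lookup p v)) * word_apply a v) =
      to_fract (\<kappa> (lookup p v)) * skew_apply z (word_apply a v)"
      unfolding skew_apply_mult_to_fract[OF U_keys[OF z(1)]] skew_apply_def sum_distrib_left
      using U_keys[OF z(1)] \<kappa>(2) M_aut
      by (intro sum.cong) (auto simp: fract_ext_simps fract_ext_to_fract mult_ac)
  qed simp
  also have "\<dots> = (\<Sum>v\<in>{w}. to_fract (\<kappa> (lookup p v)) * skew_apply z (word_apply a v))"
  proof (rule sum.mono_neutral_right)
    show "\<forall>v\<in>keys p - {w}. to_fract (\<kappa> (lookup p v)) * skew_apply z (word_apply a v) = 0"
      using z(3) p(2) by (auto simp: N_def)
  qed (use w in auto)
  finally show False using z(2) p(1) \<kappa>(3) by simp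
qed

end

section \<open>Galois orders as modules over the invariants\<close>

lemma sum_set_eq_sum_nth: "distinct xs \<Longrightarrow> (\<Sum>x\<in>set xs. f x) = (\<Sum>i<length xs. f (xs ! i))"
  using sum.reindex_bij_betw[OF bij_betw_nth[OF _ refl refl], of xs f] by simp

context galois_data
begin

text \<open>The norm over \<open>G\<close> of a denominator is a multiple of it, since
  \<open>id\<close> contributes the denominator itself, and it is invariant.\<close>

lemma \<Gamma>_denominator:
  obtains d a where "d \<in> \<Gamma>" "d \<noteq> 0" "to_fract d * q = to_fract a"
proof (cases q)
  case (Fract x y)
  define d where "d = (\<Prod>g\<in>G. g y)"
  have "d = y * (\<Prod>g\<in>G - {id}. g y)"
    unfolding d_def by (subst prod.remove[of _ id]) auto
  then have "to_fract d * q = to_fract (x * (\<Prod>g\<in>G - {id}. g y))"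
    using Fract by (simp add: to_fract_def eq_fract)
  moreover have "d \<noteq> 0" using Fract ring_autD(8)[OF G_aut] by (simp add: d_def)
  ultimately show thesis using that norm_in_\<Gamma> d_def by blast
qed

lemma \<Gamma>_common_denominator:
  assumes "finite S"
  shows "\<exists>d\<in>\<Gamma>. d \<noteq> 0 \<and> (\<forall>\<mu>\<in>S. \<exists>a. to_fract d * q \<mu> = to_fract a)"
  using assms
proof (induction S rule: finite_induct)
  case (insert \<nu> S)
  then obtain d where d: "d \<in> \<Gamma>" "d \<noteq> 0" "\<forall>\<mu>\<in>S. \<exists>a. to_fract d * q \<mu> = to_fract a" by blast
  obtain e b where e: "e \<in> \<Gamma>" "e \<noteq> 0" "to_fract e * q \<nu> = to_fract b" by (rule \<Gamma>_denominator)
  have "\<exists>a. to_fract (d * e) * q \<mu> = to_fract a" if \<mu>: "\<mu> \<in> insert \<nu> S" for \<mu>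
  proof (cases "\<mu> = \<nu>")
    case True
    then have "to_fract (d * e) * q \<mu> = to_fract (d * b)" using e by (simp add: mult.assoc)
    then show ?thesis by blast
  next
    case False
    then obtain a where "to_fract d * q \<mu> = to_fract a" using d \<mu> False by blast
    then have "to_fract (d * e) * q \<mu> = to_fract (e * a)" by (simp add: mult_ac)
    then show ?thesis by blast
  qed
  then show ?case using d e by (intro bexI[of _ "d * e"]) auto
qed (auto intro: bexI[of _ 1])

text \<open>Taking \<open>b = 1\<close> may fail, since the characteristic may divide the order of
  \<open>G\<close>; Dedekind's lemma provides \<open>b\<close> instead.\<close>

lemma trace_nonzero: obtains b where "(\<Sum>g\<in>G. g b) \<noteq> 0"
proof -
  obtain b where b: "lookup (skew_trace (skew_mult (skew_embed (to_fract b)) (skew_embed 1))) id \<noteq> 0"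
    using skew_trace_nonzero[of "skew_embed 1" id] by (auto simp: skew_embed_def keys_single)
  have "lookup (skew_trace (skew_mult (skew_embed (to_fract b)) (skew_embed 1))) id = to_fract (\<Sum>g\<in>G. g b)"
    unfolding skew_mult_embed_embed skew_trace_def
    by (simp add: skew_action_embed lookup_sum fract_ext_to_fract[OF G_aut])
      (simp add: skew_embed_def)
  then have "to_fract (\<Sum>g\<in>G. g b) \<noteq> 0" using b by simp
  then show thesis using that by (metis to_fract_0)
qed

lemma skew_trace_sum: "skew_trace (\<Sum>i\<in>I. f i) = (\<Sum>i\<in>I. skew_trace (f i))"
proof -
  have "skew_trace (\<Sum>i\<in>I. f i) = (\<Sum>g\<in>G. \<Sum>i\<in>I. skew_action g (f i))"
    unfolding skew_trace_def by (intro sum.cong skew_action_sum G_aut) auto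
  then show ?thesis unfolding skew_trace_def by (simp add: sum.swap[of _ I])
qed

lemma skew_trace_scale:
  assumes "c \<in> \<Gamma>" "keys f \<subseteq> M"
  shows "skew_trace (skew_mult (skew_embed (to_fract c)) f) = skew_mult (skew_embed (to_fract c)) (skew_trace f)"
proof -
  have "skew_action g (skew_mult (skew_embed (to_fract c)) f) = skew_mult (skew_embed (to_fract c)) (skew_action g f)"
    if "g \<in> G" for g
    using that assms fixedD[OF assms(1) that]
    by (simp add: skew_action_mult keys_skew_embed skew_action_embed fract_ext_to_fract[OF G_aut])
  then show ?thesis
    by (intro poly_mapping_eqI) (simp add: skew_trace_def lookup_sum lookup_skew_embed_mult sum_distrib_left)
qed

lemma trace_mult_KK:
  assumes "x \<in> carrier KK"
  shows "skew_trace (skew_mult (skew_embed (to_fract b)) x) = skew_mult (skew_embed (to_fract (\<Sum>g\<in>G. g b))) x"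
proof -
  have "skew_action g (skew_mult (skew_embed (to_fract b)) x) = skew_mult (skew_embed (to_fract (g b))) x"
    if "g \<in> G" for g
    using that assms
    by (simp add: KK_carrier skew_action_mult keys_skew_embed skew_action_embed fract_ext_to_fract[OF G_aut])
  then show ?thesis
    by (intro poly_mapping_eqI) (simp add: skew_trace_def lookup_sum lookup_skew_embed_mult sum_distrib_right)
qed

lemma Span_KK:
  "ring.Span KK A us = {(\<Sum>i<length us. skew_mult (c i) (us ! i)) |c. \<forall>i<length us. c i \<in> A}"
proof (induction us)
  case Nil
  then show ?case by (simp add: ring.Span.simps[OF ring_KK])
next
  case (Cons u us)
  have "ring.Span KK A (u # us) = {skew_mult k u + v |k v. k \<in> A \<and> v \<in> ring.Span KK A us}"
    by (simp add: ring.Span.simps[OF ring_KK] ring.line_extension_def[OF ring_KK] set_add_def set_mult_def r_coset_def)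
      blast
  also have "\<dots> = {(\<Sum>i<length (u # us). skew_mult (c i) ((u # us) ! i)) |c. \<forall>i<length (u # us). c i \<in> A}"
  proof (intro Set.set_eqI iffI)
    fix x assume "x \<in> {skew_mult k u + v |k v. k \<in> A \<and> v \<in> ring.Span KK A us}"
    then obtain k c where "k \<in> A" "\<forall>i<length us. c i \<in> A" "x = skew_mult k u + (\<Sum>i<length us. skew_mult (c i) (us ! i))"
      unfolding Cons by blast
    then show "x \<in> {(\<Sum>i<length (u # us). skew_mult (c i) ((u # us) ! i)) |c. \<forall>i<length (u # us). c i \<in> A}"
      by (intro CollectI exI[of _ "case_nat k c"]) (auto simp: sum.lessThan_Suc_shift less_Suc_eq_0_disj simp del: sum.lessThan_Suc)
  next
    fix x assume "x \<in> {(\<Sum>i<length (u # us). skew_mult (c i) ((u # us) ! i)) |c. \<forall>i<length (u # us). c i \<in> A}"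
    then obtain c where c: "\<forall>i<Suc (length us). c i \<in> A" "x = (\<Sum>i<Suc (length us). skew_mult (c i) ((u # us) ! i))"
      by auto
    then have "x = skew_mult (c 0) u + (\<Sum>i<length us. skew_mult (c (Suc i)) (us ! i))"
      by (simp add: sum.lessThan_Suc_shift del: sum.lessThan_Suc)
    moreover have "(\<Sum>i<length us. skew_mult (c (Suc i)) (us ! i)) \<in> ring.Span KK A us"
      unfolding Cons using c by (intro CollectI exI[of _ "\<lambda>i. c (Suc i)"]) auto
    ultimately show "x \<in> {skew_mult k u + v |k v. k \<in> A \<and> v \<in> ring.Span KK A us}" using c by blast
  qed
  finally show ?case .
qed

lemma K_in_iff: "x \<in> K_in G \<longleftrightarrow> (\<exists>a\<in>\<Gamma>. \<exists>b\<in>\<Gamma>. b \<noteq> 0 \<and> x = skew_embed (Fract a b))"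
  by (auto simp: K_in_def)

lemma subfield_K_in: "subfield (K_in G) KK"
proof -
  interpret KK: ring KK by (rule ring_KK)
  have car: "K_in G \<subseteq> carrier KK"
  proof
    fix x assume "x \<in> K_in G"
    then obtain a b where ab: "a \<in> \<Gamma>" "b \<in> \<Gamma>" "b \<noteq> 0" "x = skew_embed (Fract a b)" unfolding K_in_iff by blast
    have "fract_ext g (Fract a b) = Fract a b" if "g \<in> G" for g
      using fract_ext_eq[OF G_aut[OF that] ab(3), of a] fixedD[OF ab(1) that] fixedD[OF ab(2) that] by simp
    then show "x \<in> carrier KK" unfolding ab(4) by (intro embed_in_KK) (simp add: fixed_field_def)
  qed
  have mult: "skew_mult x y \<in> K_in G \<and> skew_mult x y = skew_mult y x"
    and add: "x + y \<in> K_in G" if xy: "x \<in> K_in G" "y \<in> K_in G" for x y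
  proof -
    obtain a b c d where ab: "a \<in> \<Gamma>" "b \<in> \<Gamma>" "b \<noteq> 0" "x = skew_embed (Fract a b)"
      "c \<in> \<Gamma>" "d \<in> \<Gamma>" "d \<noteq> 0" "y = skew_embed (Fract c d)" using xy unfolding K_in_iff by blast
    have "a * c \<in> \<Gamma>" "b * d \<in> \<Gamma>" "b * d \<noteq> 0" "a * d + c * b \<in> \<Gamma>" using ab by auto
    moreover have "skew_mult x y = skew_embed (Fract (a * c) (b * d))" "skew_mult y x = skew_embed (Fract (a * c) (b * d))"
      using ab by (simp_all add: skew_mult_embed_embed mult.commute)
    moreover have "x + y = skew_embed (Fract (a * d + c * b) (b * d))"
      using ab by (simp add: skew_embed_def single_add[symmetric])
    moreover have "skew_embed (Fract p q) \<in> K_in G" if "p \<in> \<Gamma>" "q \<in> \<Gamma>" "q \<noteq> 0" for p q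
      using that unfolding K_in_iff by blast
    ultimately show "skew_mult x y \<in> K_in G \<and> skew_mult x y = skew_mult y x" "x + y \<in> K_in G"
      by metis+
  qed
  have one: "skew_embed 1 \<in> K_in G"
    unfolding K_in_iff by (rule bexI[of _ 1], rule bexI[of _ 1]) (simp_all add: One_fract_def)
  have neg: "\<ominus>\<^bsub>KK\<^esub> x \<in> K_in G" if x: "x \<in> K_in G" for x
  proof -
    have "skew_embed (- 1) \<in> K_in G"
      unfolding K_in_iff by (rule bexI[of _ "- 1"], rule bexI[of _ 1]) (simp_all add: One_fract_def)
    then have m: "skew_mult (skew_embed (- 1)) x \<in> K_in G" using mult x by blast
    have "skew_mult (skew_embed (- 1)) x + x = 0"
      by (rule poly_mapping_eqI) (simp add: lookup_add lookup_skew_embed_mult)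
    then have "\<ominus>\<^bsub>KK\<^esub> x = skew_mult (skew_embed (- 1)) x"
      using KK.minus_equality[of "skew_mult (skew_embed (- 1)) x" x] car m x by auto
    then show ?thesis using m by simp
  qed
  have sub: "subcring (K_in G) KK"
    using car one neg mult add by (intro KK.subcringI KK.subringI) auto
  have "Units (KK\<lparr>carrier := K_in G\<rparr>) = K_in G - {\<zero>\<^bsub>KK\<^esub>}"
  proof (intro Set.set_eqI iffI)
    fix x assume "x \<in> Units (KK\<lparr>carrier := K_in G\<rparr>)"
    then obtain y where x: "x \<in> K_in G" "y \<in> K_in G" "skew_mult y x = skew_embed 1" by (auto simp: Units_def)
    then obtain q where "y = skew_embed q" unfolding K_in_iff by blast
    then have "x \<noteq> 0" using x(3) by (metis lookup_skew_embed_mult lookup_single_eq lookup_zero mult_zero_right skew_embed_def zero_neq_one)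
    then show "x \<in> K_in G - {\<zero>\<^bsub>KK\<^esub>}" using x by simp
  next
    fix x assume x: "x \<in> K_in G - {\<zero>\<^bsub>KK\<^esub>}"
    then have "x \<in> K_in G" by blast
    then obtain a b where ab: "a \<in> \<Gamma>" "b \<in> \<Gamma>" "b \<noteq> 0" "x = skew_embed (Fract a b)" unfolding K_in_iff by blast
    have "Fract a b \<noteq> 0" using x ab by (auto simp: skew_embed_def)
    then have "a \<noteq> 0" by (metis Zero_fract_def eq_fract(3))
    then have "skew_embed (Fract b a) \<in> K_in G" using ab unfolding K_in_iff by blast
    moreover have "skew_mult x (skew_embed (Fract b a)) = skew_embed 1"
    proof -
      have "Fract a b * Fract b a = 1"
        using ab \<open>a \<noteq> 0\<close> by (simp add: One_fract_def eq_fract mult.commute)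
      then show ?thesis using ab(4) by (simp only: skew_mult_embed_embed)
    qed
    ultimately show "x \<in> Units (KK\<lparr>carrier := K_in G\<rparr>)"
      using x mult[of x "skew_embed (Fract b a)"] unfolding Units_def by (auto intro!: bexI[of _ "skew_embed (Fract b a)"])
  qed
  then show ?thesis by (rule KK.subfieldI[OF sub])
qed

end

locale galois_order_data = galois_ring_data +
  assumes fin_M: "finite M" and noeth_\<Gamma>: "noetherian_over \<Gamma>" and U_order: "galois_order G M U"
begin

text \<open>The traces of the elements \<open>t \<mu>\<close>, with \<open>t\<close> among the
  generators of \<Lambda> over \<Gamma>, span. For invariant \<open>x\<close> the trace of
  \<open>b x\<close> is \<open>tr b\<close> times \<open>x\<close>, while a suitable
  \<Gamma>-multiple of \<open>b x\<close> is a \<Gamma>-combination of the \<open>t \<mu>\<close>.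
  Taking traces and dividing by \<open>d (tr b)\<close> recovers \<open>x\<close>.\<close>

lemma finite_dimension_KK: "ring.finite_dimension KK (K_in G) (carrier KK)"
proof -
  interpret KK: ring KK by (rule ring_KK)
  obtain T where T: "finite T" "(UNIV :: 'a set) = {(\<Sum>t\<in>T. c t * t) |c. \<forall>t\<in>T. c t \<in> \<Gamma>}"
    using spec[OF noeth_\<Gamma>[unfolded noetherian_over_def], of UNIV] by auto
  obtain b where b: "(\<Sum>g\<in>G. g b) \<noteq> 0" by (rule trace_nonzero)
  define v where "v = (\<lambda>(\<mu>, t). skew_trace (Poly_Mapping.single \<mu> (to_fract t)))"
  have "finite (M \<times> T)" using fin_M T by simp
  then obtain xs where xs': "set xs = M \<times> T" "distinct xs" using finite_distinct_list by blast
  have xs: "set xs = M \<times> T" "(\<Sum>x\<in>M \<times> T. f x) = (\<Sum>i<length xs. f (xs ! i))" for f :: "_ \<Rightarrow> 'a skew"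
    using sum_set_eq_sum_nth[OF xs'(2), of f] xs'(1) by simp_all
  have v: "v p \<in> carrier KK" if "p \<in> M \<times> T" for p
    using that by (auto simp: v_def intro!: skew_trace_in_KK keys_single_subset)
  have "x \<in> KK.Span (K_in G) (map v xs)" if x: "x \<in> carrier KK" for x
  proof -
    define y where "y = skew_mult (skew_embed (to_fract b)) x"
    obtain d where d: "d \<in> \<Gamma>" "d \<noteq> 0" "\<forall>\<mu>\<in>M. \<exists>a. to_fract d * lookup y \<mu> = to_fract a"
      using \<Gamma>_common_denominator[OF fin_M, of "lookup y"] by blast
    have "\<forall>\<mu>\<in>M. \<exists>c. (\<forall>t\<in>T. c t \<in> \<Gamma>) \<and> to_fract d * lookup y \<mu> = to_fract (\<Sum>t\<in>T. c t * t)"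
    proof
      fix \<mu> assume "\<mu> \<in> M"
      then obtain a where a: "to_fract d * lookup y \<mu> = to_fract a" using d(3) by blast
      have "a \<in> {(\<Sum>t\<in>T. c t * t) |c. \<forall>t\<in>T. c t \<in> \<Gamma>}" unfolding T(2)[symmetric] by simp
      then show "\<exists>c. (\<forall>t\<in>T. c t \<in> \<Gamma>) \<and> to_fract d * lookup y \<mu> = to_fract (\<Sum>t\<in>T. c t * t)"
        using a by blast
    qed
    then obtain c where c: "\<And>\<mu> t. \<mu> \<in> M \<Longrightarrow> t \<in> T \<Longrightarrow> c \<mu> t \<in> \<Gamma>"
      "\<And>\<mu>. \<mu> \<in> M \<Longrightarrow> to_fract d * lookup y \<mu> = to_fract (\<Sum>t\<in>T. c \<mu> t * t)"
      by metis
    have yM: "keys y \<subseteq> M" using keys_skew_embed_mult[of _ x] x by (auto simp: y_def KK_carrier)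
    have "skew_mult (skew_embed (to_fract d)) y =
      (\<Sum>\<mu>\<in>M. \<Sum>t\<in>T. skew_mult (skew_embed (to_fract (c \<mu> t))) (Poly_Mapping.single \<mu> (to_fract t)))"
    proof (rule poly_mapping_eqI)
      fix \<nu>
      have "lookup (\<Sum>\<mu>\<in>M. \<Sum>t\<in>T. skew_mult (skew_embed (to_fract (c \<mu> t))) (Poly_Mapping.single \<mu> (to_fract t))) \<nu> =
        (\<Sum>\<mu>\<in>M. if \<mu> = \<nu> then to_fract (\<Sum>t\<in>T. c \<mu> t * t) else 0)"
        by (auto simp: lookup_sum lookup_skew_embed_mult lookup_single when_def to_fract_sum intro!: sum.cong)
      also have "\<dots> = to_fract d * lookup y \<nu>"
        using fin_M c(2) yM by (auto simp: in_keys_iff)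
      finally show "lookup (skew_mult (skew_embed (to_fract d)) y) \<nu> =
        lookup (\<Sum>\<mu>\<in>M. \<Sum>t\<in>T. skew_mult (skew_embed (to_fract (c \<mu> t))) (Poly_Mapping.single \<mu> (to_fract t))) \<nu>"
        by (simp add: lookup_skew_embed_mult)
    qed
    then have "skew_trace (skew_mult (skew_embed (to_fract d)) y) =
      (\<Sum>\<mu>\<in>M. \<Sum>t\<in>T. skew_mult (skew_embed (to_fract (c \<mu> t))) (v (\<mu>, t)))"
      unfolding v_def using c(1) by (simp add: skew_trace_sum skew_trace_scale keys_single_subset)
    also have "\<dots> = (\<Sum>p\<in>M \<times> T. skew_mult (skew_embed (to_fract (c (fst p) (snd p)))) (v p))"
      by (simp add: sum.cartesian_product split_def)
    finally have eq: "skew_trace (skew_mult (skew_embed (to_fract d)) y) =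
      (\<Sum>i<length xs. skew_mult (skew_embed (to_fract (c (fst (xs ! i)) (snd (xs ! i))))) (v (xs ! i)))"
      using xs(2) by simp
    define e where "e = d * (\<Sum>g\<in>G. g b)"
    have e: "e \<in> \<Gamma>" "e \<noteq> 0" using d b trace_in_\<Gamma> by (auto simp: e_def)
    have "skew_trace (skew_mult (skew_embed (to_fract d)) y) = skew_mult (skew_embed (to_fract e)) x"
      using skew_trace_scale[OF d(1) yM] trace_mult_KK[OF x, of b]
      by (intro poly_mapping_eqI) (simp add: lookup_skew_embed_mult e_def y_def)
    then have "x = (\<Sum>i<length xs. skew_mult (skew_embed (Fract (c (fst (xs ! i)) (snd (xs ! i))) e)) (v (xs ! i)))"
      using eq e(2)
      by (intro poly_mapping_eqI)
        (simp add: poly_mapping_eq_iff fun_eq_iff lookup_sum lookup_skew_embed_mult Fract_conv_to_fract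
          sum_divide_distrib[symmetric] field_simps)
    moreover have "skew_embed (Fract (c (fst (xs ! i)) (snd (xs ! i))) e) \<in> K_in G" if "i < length xs" for i
      using c(1) e xs(1) nth_mem[OF that] unfolding K_in_iff by (metis mem_Times_iff)
    ultimately show ?thesis
      unfolding Span_KK
      by (intro CollectI exI[of _ "\<lambda>i. skew_embed (Fract (c (fst (xs ! i)) (snd (xs ! i))) e)"]) simp
  qed
  moreover have us: "set (map v xs) \<subseteq> carrier KK" using v xs(1) by auto
  ultimately have "KK.Span (K_in G) (map v xs) = carrier KK"
    using KK.Span_in_carrier[OF subringE(1)[OF subfieldE(1)[OF subfield_K_in]] us] by blast
  then show ?thesis
    using KK.Span_finite_dimension[OF subfield_K_in us] by simp
qed

text \<open>Since \<open>M\<close> is finite, the whole ring of invariants is an admissible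
  \<open>W\<close> in the definition of a Galois order.\<close>

lemma U_finitely_generated:
  "\<exists>(n::nat) w. (\<forall>i<n. w i \<in> U) \<and>
    (\<forall>u\<in>U. \<exists>c. (\<forall>i<n. c i \<in> \<Gamma>) \<and> u = (\<Sum>i<n. skew_mult (skew_embed (to_fract (c i))) (w i)))"
proof -
  have "fg_left_module KK (Gamma_in G) (carrier KK \<inter> U)"
    using U_order finite_dimension_KK unfolding galois_order_def Let_def by blast
  moreover have "carrier KK \<inter> U = U" using U_KK by blast
  ultimately obtain us where us: "U = ring.Span KK (Gamma_in G) us"
    by (auto simp: fg_left_module_def)
  show ?thesis
  proof (intro exI[of _ "length us"] exI[of _ "(!) us"] conjI allI impI ballI)
    show "us ! i \<in> U" if i: "i < length us" for i
    proof -
      have "us ! i \<in> ring.Span KK (Gamma_in G) us"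
      proof -
        have "(\<Sum>j<length us. skew_mult (skew_embed (to_fract (if j = i then 1 else 0))) (us ! j)) = us ! i"
          using i by (intro poly_mapping_eqI)
            (simp add: lookup_sum lookup_skew_embed_mult if_distrib[of to_fract] if_distrib[of "\<lambda>x. x * _"] cong: if_cong)
        moreover have "skew_embed (to_fract (if j = i then 1 else 0)) \<in> Gamma_in G" for j
          unfolding Gamma_in_iff by (metis \<Gamma>_closed(1,2))
        ultimately show ?thesis
          unfolding Span_KK
          by (intro CollectI exI[of _ "\<lambda>j. skew_embed (to_fract (if j = i then 1 else 0))"]) simp
      qed
      then show ?thesis using us by simp
    qed
    show "\<exists>c. (\<forall>i<length us. c i \<in> \<Gamma>) \<and> u = (\<Sum>i<length us. skew_mult (skew_embed (to_fract (c i))) (us ! i))"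
      if "u \<in> U" for u
    proof -
      have "u \<in> ring.Span KK (Gamma_in G) us" using that us by simp
      then obtain k where k: "\<forall>i<length us. k i \<in> Gamma_in G" "u = (\<Sum>i<length us. skew_mult (k i) (us ! i))"
        unfolding Span_KK by blast
      then obtain c where c: "\<forall>i<length us. c i \<in> \<Gamma> \<and> k i = skew_embed (to_fract (c i))"
        unfolding Gamma_in_iff by metis
      then show ?thesis using k(2) by (intro exI[of _ c]) simp
    qed
  qed
qed

end

section \<open>Noetherian modules\<close>

definition submodule_over :: "'r set \<Rightarrow> ('r \<Rightarrow> 'b \<Rightarrow> 'b) \<Rightarrow> 'b::ab_group_add set \<Rightarrow> bool" where
  "submodule_over A scale N \<longleftrightarrow> 0 \<in> N \<and> (\<forall>x\<in>N. \<forall>y\<in>N. x + y \<in> N) \<and> (\<forall>a\<in>A. \<forall>x\<in>N. scale a x \<in> N)"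

text \<open>The union of a chain is finitely generated, and a single member of the chain already
  contains the generators. The union is thus that member and belongs to \<open>F\<close>, as Zorn's
  lemma requires.\<close>

lemma noetherian_over_maximal:
  assumes noeth: "noetherian_over A" and F: "F \<noteq> {}" "\<And>N. N \<in> F \<Longrightarrow> submodule_over A (*) N"
  obtains N where "N \<in> F" "\<And>N'. N' \<in> F \<Longrightarrow> N \<subseteq> N' \<Longrightarrow> N' = N"
proof -
  have "\<exists>N\<in>F. \<forall>N'\<in>F. N \<subseteq> N' \<longrightarrow> N' = N"
  proof (rule subset_Zorn_nonempty[OF F(1)])
    fix C assume C: "C \<noteq> {}" "subset.chain F C"
    have CF: "C \<subseteq> F" and lin: "\<And>B D. B \<in> C \<Longrightarrow> D \<in> C \<Longrightarrow> B \<subseteq> D \<or> D \<subseteq> B"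
      using C(2) by (auto simp: subset.chain_def)
    have sub: "submodule_over A (*) N" if "N \<in> C" for N using that CF F(2) by blast
    have "submodule_over A (*) (\<Union>C)"
      unfolding submodule_over_def
    proof (intro conjI ballI)
      show "0 \<in> \<Union>C" using C(1) sub by (auto simp: submodule_over_def)
      fix x assume "x \<in> \<Union>C"
      then obtain B where B: "x \<in> B" "B \<in> C" by blast
      show "a * x \<in> \<Union>C" if "a \<in> A" for a
      proof -
        have "a * x \<in> B" using B(1) sub[OF B(2)] that by (simp add: submodule_over_def)
        then show ?thesis using B by blast
      qed
      fix y assume "y \<in> \<Union>C"
      then obtain D where D: "y \<in> D" "D \<in> C" by blast
      show "x + y \<in> \<Union>C"
      proof (cases "B \<subseteq> D")
        case True
        then have "x \<in> D" using B by blast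
        then have "x + y \<in> D" using sub[OF D(2)] D(1) by (simp add: submodule_over_def)
        then show ?thesis using D by blast
      next
        case False
        then have "y \<in> B" using lin[OF B(2) D(2)] D(1) by blast
        then have "x + y \<in> B" using sub[OF B(2)] B(1) by (simp add: submodule_over_def)
        then show ?thesis using B by blast
      qed
    qed
    then obtain T where T: "finite T" "T \<subseteq> \<Union>C" "\<Union>C = {(\<Sum>t\<in>T. c t * t) | c. \<forall>t\<in>T. c t \<in> A}"
      using spec[OF noeth[unfolded noetherian_over_def], of "\<Union>C"] unfolding submodule_over_def by auto
    obtain N where N: "N \<in> C" "T \<subseteq> N"
      using finite_subset_Union_chain[OF T(1,2) C] by blast
    have "(\<Sum>t\<in>S. c t * t) \<in> N" if "\<forall>t\<in>S. c t \<in> A" "S \<subseteq> T" for c S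
      using finite_subset[OF that(2) T(1)] that N sub[OF N(1)]
      by (induction S rule: finite_induct) (auto simp: submodule_over_def)
    then have "\<Union>C \<subseteq> N" using T(3) by auto
    then have "\<Union>C = N" using N by blast
    then show "\<Union>C \<in> F" using N CF by blast
  qed
  then show thesis using that by blast
qed

context scalar_action
begin

text \<open>Compare submodules \<open>N\<close> of the span of \<open>w 0, \<dots>, w k\<close> through their intersection with
  the span of \<open>w 0, \<dots>, w (k - 1)\<close> and the ideal of coefficients of \<open>w k\<close>.\<close>

lemma noetherian_span_aux:
  fixes w :: "nat \<Rightarrow> 'b" and A :: "'r set"
  defines "E \<equiv> \<lambda>k. {(\<Sum>i<k. c i *s w i) |c. \<forall>i<k. c i \<in> A}"
  assumes noeth: "noetherian_over A" and A: "- 1 \<in> A" "0 \<in> A" "\<And>a b. a \<in> A \<Longrightarrow> b \<in> A \<Longrightarrow> a + b \<in> A"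
      "\<And>a b. a \<in> A \<Longrightarrow> b \<in> A \<Longrightarrow> a * b \<in> A"
  shows "F \<noteq> {} \<Longrightarrow> (\<And>N. N \<in> F \<Longrightarrow> submodule_over A scale N) \<Longrightarrow>
    \<exists>N\<in>F. \<forall>N'\<in>F. N \<subseteq> N' \<longrightarrow> N' \<inter> E k \<subseteq> N"
proof (induction k arbitrary: F)
  case 0
  then show ?case by (auto simp: E_def submodule_over_def)
next
  case (Suc k)
  have E_add: "x + y \<in> E k" if xy: "x \<in> E k" "y \<in> E k" for x y
  proof -
    obtain c d where "\<forall>i<k. c i \<in> A" "x = (\<Sum>i<k. c i *s w i)" "\<forall>i<k. d i \<in> A" "y = (\<Sum>i<k. d i *s w i)"
      using xy by (auto simp: E_def)
    then show ?thesis
      using A(3) by (auto simp: E_def scale_left_distrib sum.distrib intro!: exI[of _ "\<lambda>i. c i + d i"])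
  qed
  have E_scale: "a *s x \<in> E k" if ax: "a \<in> A" "x \<in> E k" for a x
  proof -
    obtain c where "\<forall>i<k. c i \<in> A" "x = (\<Sum>i<k. c i *s w i)" using ax by (auto simp: E_def)
    then show ?thesis
      using A(4) ax by (auto simp: E_def scale_sum_right scale_scale intro!: exI[of _ "\<lambda>i. a * c i"])
  qed
  have E0: "0 \<in> E k" using A(2) by (auto simp: E_def intro!: exI[of _ "\<lambda>_. 0"])
  have neg: "- x = (- 1) *s x" for x by (simp add: scale_minus_left)
  define J where "J N = {c \<in> A. \<exists>e\<in>E k. c *s w k + e \<in> N}" for N
  have J: "submodule_over A (*) (J N)" if N: "N \<in> F" for N
    unfolding submodule_over_def
  proof (intro conjI ballI)
    note sub = Suc.prems(2)[OF N, unfolded submodule_over_def]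
    show "0 \<in> J N" using sub E0 A(2) by (auto simp: J_def intro!: bexI[of _ 0])
    fix c assume "c \<in> J N"
    then obtain e where e: "c \<in> A" "e \<in> E k" "c *s w k + e \<in> N" by (auto simp: J_def)
    show "a * c \<in> J N" if a: "a \<in> A" for a
    proof -
      have "(a * c) *s w k + a *s e = a *s (c *s w k + e)" by (simp add: scale_right_distrib scale_scale)
      then have "(a * c) *s w k + a *s e \<in> N" using sub a e(3) by simp
      then show ?thesis using E_scale[OF a e(2)] A(4)[OF a e(1)] unfolding J_def by blast
    qed
    fix d assume "d \<in> J N"
    then obtain e' where e': "d \<in> A" "e' \<in> E k" "d *s w k + e' \<in> N" by (auto simp: J_def)
    have eq: "(c + d) *s w k + (e + e') = (c *s w k + e) + (d *s w k + e')"
      by (simp add: scale_left_distrib algebra_simps)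
    have "(c + d) *s w k + (e + e') \<in> N" unfolding eq using sub e(3) e'(3) by blast
    then show "c + d \<in> J N" using E_add[OF e(2) e'(2)] A(3)[OF e(1) e'(1)] unfolding J_def by blast
  qed
  obtain J0 where J0: "J0 \<in> J ` F" "\<And>K. K \<in> J ` F \<Longrightarrow> J0 \<subseteq> K \<Longrightarrow> K = J0"
    by (rule noetherian_over_maximal[OF noeth, of "J ` F"]) (use Suc.prems J in auto)
  \<comment> \<open>Only the members with the maximal coefficient ideal \<open>J0\<close> are passed
    to the induction hypothesis; every member above the chosen \<open>N\<close> again has this
    ideal.\<close>
  define F' where "F' = {N \<in> F. J N = J0}"
  have "F' \<noteq> {}" using J0(1) by (auto simp: F'_def)
  moreover have "submodule_over A scale N" if "N \<in> F'" for N
    using that Suc.prems(2) by (simp add: F'_def)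
  ultimately have "\<exists>N\<in>F'. \<forall>N'\<in>F'. N \<subseteq> N' \<longrightarrow> N' \<inter> E k \<subseteq> N"
    by (rule Suc.IH)
  then obtain N where N0: "N \<in> F'" "\<forall>N'\<in>F'. N \<subseteq> N' \<longrightarrow> N' \<inter> E k \<subseteq> N" ..
  then have N: "N \<in> F'" "\<And>N'. N' \<in> F' \<Longrightarrow> N \<subseteq> N' \<Longrightarrow> N' \<inter> E k \<subseteq> N" by simp_all
  have "N' \<inter> E (Suc k) \<subseteq> N" if N': "N' \<in> F" "N \<subseteq> N'" for N'
  proof
    have NF: "N \<in> F" "J N = J0" using N(1) by (auto simp: F'_def)
    have "J N \<subseteq> J N'" using N'(2) by (auto simp: J_def)
    then have JN': "J N' = J0" using J0(2)[of "J N'"] N'(1) NF(2) by auto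
    then have N'F: "N' \<inter> E k \<subseteq> N" using N(2)[of N'] N' by (auto simp: F'_def)
    note sub = Suc.prems(2)[OF NF(1), unfolded submodule_over_def]
      and sub' = Suc.prems(2)[OF N'(1), unfolded submodule_over_def]
    fix x assume x: "x \<in> N' \<inter> E (Suc k)"
    then obtain c where c: "\<forall>i<Suc k. c i \<in> A" "x = (\<Sum>i<Suc k. c i *s w i)" by (auto simp: E_def)
    define e where "e = (\<Sum>i<k. c i *s w i)"
    have e: "e \<in> E k" "x = c k *s w k + e" using c by (auto simp: E_def e_def add.commute)
    then have "c k \<in> J N'" using x c(1) by (auto simp: J_def)
    then have "c k \<in> J N" using JN' NF(2) by simp
    then obtain e' where e': "e' \<in> E k" "c k *s w k + e' \<in> N" by (auto simp: J_def)
    \<comment> \<open>Two elements with the same coefficient at \<open>w k\<close> differ by an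
      element of \<open>E k\<close>, where \<open>N'\<close> is already known to lie inside
      \<open>N\<close>.\<close>
    have "e + (- 1) *s e' = x + (- 1) *s (c k *s w k + e')"
      unfolding e(2) by (simp flip: neg)
    then have "e + (- 1) *s e' \<in> N'" using sub' x e' N'(2) A(1) by auto
    moreover have "e + (- 1) *s e' \<in> E k" using E_add e(1) E_scale[OF A(1) e'(1)] by blast
    ultimately have "e + (- 1) *s e' \<in> N" using N'F by blast
    then have "(c k *s w k + e') + (e + (- 1) *s e') \<in> N" using sub e'(2) by blast
    moreover have "(c k *s w k + e') + (e + (- 1) *s e') = x" by (simp add: e(2) flip: neg)
    ultimately show "x \<in> N" by simp
  qed
  then show ?case using N(1) by (auto simp: F'_def)
qed

end

lemma skew_mult_superset:
  assumes "finite S" "keys f \<subseteq> S"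
  shows "skew_mult f h = (\<Sum>\<mu>\<in>S. \<Sum>\<nu>\<in>keys h. Poly_Mapping.single (\<mu> \<circ> \<nu>) (lookup f \<mu> * fract_ext \<mu> (lookup h \<nu>)))"
  unfolding skew_mult_def using assms
  by (intro sum.mono_neutral_left) (auto simp: in_keys_iff)

lemma skew_mult_add_left: "skew_mult (f + g) h = skew_mult f h + skew_mult g h"
proof -
  have S: "finite (keys f \<union> keys g)" "keys (f + g) \<subseteq> keys f \<union> keys g"
    using keys_add[of f g] by auto
  show ?thesis
    using S by (simp add: skew_mult_superset[of "keys f \<union> keys g"] lookup_add distrib_right single_add sum.distrib)
qed

interpretation skew: scalar_action "\<lambda>x f. skew_mult (skew_embed x) f"
  by unfold_locales (rule poly_mapping_eqI; simp add: lookup_skew_embed_mult lookup_add algebra_simps)+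

text \<open>Left multiplication by \<open>L\<close> commutes with right multiplication by
  \<open>u\<close>, so polynomials over the field \<open>L\<close> act although \<open>u\<close>
  commutes with hardly any scalar.\<close>

interpretation skew_right: poly_action "\<lambda>x f. skew_mult (skew_embed x) f" "\<lambda>f. skew_mult f u"
proof unfold_locales
  show "skew_mult (skew_mult (skew_embed a) f) u = skew_mult (skew_embed a) (skew_mult f u)" for a f
  proof -
    have "skew_mult (skew_mult (skew_embed a) f) u =
      (\<Sum>\<mu>\<in>keys f. \<Sum>\<nu>\<in>keys u. skew_mult (skew_embed a) (Poly_Mapping.single (\<mu> \<circ> \<nu>) (lookup f \<mu> * fract_ext \<mu> (lookup u \<nu>))))"
      unfolding skew_mult_superset[OF finite_keys keys_skew_embed_mult]
      by (intro sum.cong poly_mapping_eqI) (auto simp: lookup_skew_embed_mult lookup_single when_def)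
    then show ?thesis by (simp add: skew_mult_def[of f u] skew.scale_sum_right)
  qed
qed (rule skew_mult_add_left)

context galois_order_data
begin

abbreviation RU where "RU \<equiv> KK\<lparr>carrier := U\<rparr>"

lemma ring_RU: "ring RU"
  by (rule ring.subring_is_ring[OF ring_KK U_subring])

text \<open>Left ideals of \<open>U\<close> are \<Gamma>-submodules of a finitely generated module.
  The span in \<open>noetherian_span_aux\<close> contains all of \<open>U\<close>, so its conclusion
  becomes maximality.\<close>

lemma left_noetherian_RU: "left_noetherian RU"
  unfolding left_noetherian_def
proof (intro allI impI)
  interpret S: scalar_action "\<lambda>a f. skew_mult (skew_embed (to_fract a)) f"
    by unfold_locales
      (simp_all add: skew.scale_right_distrib skew.scale_left_distrib skew.scale_scale flip: skew_embed_def)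
  obtain n :: nat and w where w: "\<forall>i<n. w i \<in> U"
    "\<forall>u\<in>U. \<exists>c. (\<forall>i<n. c i \<in> \<Gamma>) \<and> u = (\<Sum>i<n. skew_mult (skew_embed (to_fract (c i))) (w i))"
    using U_finitely_generated by blast
  fix F assume F: "F \<noteq> {}" "\<forall>I\<in>F. left_ideal I RU"
  have sub: "submodule_over \<Gamma> (\<lambda>a f. skew_mult (skew_embed (to_fract a)) f) I" "I \<subseteq> U" if "I \<in> F" for I
  proof -
    have I: "additive_subgroup I RU" "\<And>r x. r \<in> U \<Longrightarrow> x \<in> I \<Longrightarrow> skew_mult r x \<in> I"
      using F(2) that by (auto simp: left_ideal_def)
    show "I \<subseteq> U" using additive_subgroup.a_subset[OF I(1)] by simp
    show "submodule_over \<Gamma> (\<lambda>a f. skew_mult (skew_embed (to_fract a)) f) I"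
      unfolding submodule_over_def
      using additive_subgroup.zero_closed[OF I(1)] additive_subgroup.a_closed[OF I(1)] I(2) embed_U by auto
  qed
  have m1: "- 1 \<in> \<Gamma>" using \<Gamma>_closed(5)[OF \<Gamma>_closed(1)] .
  have "\<exists>N\<in>F. \<forall>N'\<in>F. N \<subseteq> N' \<longrightarrow>
      N' \<inter> {(\<Sum>i<n. skew_mult (skew_embed (to_fract (c i))) (w i)) |c. \<forall>i<n. c i \<in> \<Gamma>} \<subseteq> N"
    by (rule S.noetherian_span_aux[OF noeth_\<Gamma> m1 _ _ _ F(1) sub(1)]) auto
  then obtain N where N: "N \<in> F" "\<forall>N'\<in>F. N \<subseteq> N' \<longrightarrow>
      N' \<inter> {(\<Sum>i<n. skew_mult (skew_embed (to_fract (c i))) (w i)) |c. \<forall>i<n. c i \<in> \<Gamma>} \<subseteq> N" ..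
  have "N' = N" if "N' \<in> F" "N \<subseteq> N'" for N'
  proof -
    have "N' \<subseteq> {(\<Sum>i<n. skew_mult (skew_embed (to_fract (c i))) (w i)) |c. \<forall>i<n. c i \<in> \<Gamma>}"
      using sub(2)[OF that(1)] w(2) by blast
    then show ?thesis using N(2)[rule_format, OF that] that(2) by blast
  qed
  then show "\<exists>I\<in>F. \<forall>J\<in>F. I \<subseteq> J \<longrightarrow> J = I" using N(1) by blast
qed

end

section \<open>Equations over the center\<close>

lemma monic_over_iff:
  assumes "0 \<in> I"
  shows "monic_over I p \<longleftrightarrow> lead_coeff p = 1 \<and> p - monom 1 (degree p) \<in> coeffs_in I"
proof -
  have "coeff (p - monom 1 (degree p)) i \<in> I" if "monic_over I p" for i
    using that assms by (cases "i < degree p"; cases "i = degree p") (auto simp: monic_over_def coeff_eq_0)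
  moreover have "coeff p i \<in> I" if "p - monom 1 (degree p) \<in> coeffs_in I" "i < degree p" for i
    using that by (auto simp: coeffs_in_def dest: spec[of _ i])
  ultimately show ?thesis
    unfolding coeffs_in_def mem_Collect_eq by (metis monic_over_def)
qed

lemma coeffs_in_monom_mult: "0 \<in> I \<Longrightarrow> p \<in> coeffs_in I \<Longrightarrow> monom 1 n * p \<in> coeffs_in I"
  by (auto simp: coeffs_in_def coeff_monom_mult)

lemma monic_over_mult:
  fixes p q :: "'r::idom poly"
  assumes I: "nonunital_subring I" and p: "monic_over I p" and q: "monic_over I q"
  shows "monic_over I (p * q)"
proof -
  note J = nonunital_subringD[OF nonunital_subring_coeffs_in[OF I]] and I0 = nonunital_subringD(1)[OF I]
  define p' q' where "p' = p - monom 1 (degree p)" and "q' = q - monom 1 (degree q)"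
  have pq: "p' \<in> coeffs_in I" "q' \<in> coeffs_in I" "lead_coeff p = 1" "lead_coeff q = 1"
    using p q monic_over_iff[OF I0] by (auto simp: p'_def q'_def)
  then have "p \<noteq> 0" "q \<noteq> 0" by auto
  then have deg: "degree (p * q) = degree p + degree q" by (rule degree_mult_eq)
  have "p * q - monom 1 (degree (p * q)) = monom 1 (degree p) * q' + monom 1 (degree q) * p' + p' * q'"
    unfolding deg by (simp add: p'_def q'_def algebra_simps mult_monom)
  also have "\<dots> \<in> coeffs_in I"
    using J(2,3) pq coeffs_in_monom_mult[OF I0] by auto
  finally show ?thesis
    using pq by (simp add: monic_over_iff[OF I0] lead_coeff_mult)
qed

lemma monic_over_one: "monic_over I (1 :: 'r::comm_ring_1 poly)"
  by (simp add: monic_over_def)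

lemma monic_over_prod:
  fixes f :: "'i \<Rightarrow> 'r::idom poly"
  assumes "nonunital_subring I" "\<And>i. i \<in> S \<Longrightarrow> monic_over I (f i)"
  shows "monic_over I (\<Prod>i\<in>S. f i)"
  using assms(2)
  by (induction S rule: infinite_finite_induct) (auto intro: monic_over_mult[OF assms(1)] monic_over_one)

lemma monic_over_mono: "I \<subseteq> J \<Longrightarrow> monic_over I p \<Longrightarrow> monic_over J p"
  by (auto simp: monic_over_def)

lemma monic_over_coeff:
  assumes "monic_over I p" "0 \<in> I" "1 \<in> I"
  shows "coeff p i \<in> I"
  using assms by (cases "i < degree p"; cases "i = degree p") (auto simp: monic_over_def coeff_eq_0)

lemma map_poly_mult_aut:
  fixes \<phi> :: "'f::field \<Rightarrow> 'f"
  assumes \<phi>: "ring_aut \<phi>"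
  shows "map_poly \<phi> (p * q) = map_poly \<phi> p * map_poly \<phi> q" "map_poly \<phi> (p + q) = map_poly \<phi> p + map_poly \<phi> q"
    "degree (map_poly \<phi> p) = degree p" "map_poly \<phi> 1 = 1" "coeff (map_poly \<phi> p) i = \<phi> (coeff p i)"
    "lead_coeff p = 1 \<Longrightarrow> lead_coeff (map_poly \<phi> p) = 1"
proof -
  note hom = ring_autD(4-8)[OF \<phi>]
  show c: "coeff (map_poly \<phi> p) i = \<phi> (coeff p i)" for p i by (rule coeff_map_poly) (rule hom(4))
  show "map_poly \<phi> (p * q) = map_poly \<phi> p * map_poly \<phi> q"
    by (rule poly_eqI) (simp add: c coeff_mult ring_aut_sum[OF \<phi>] hom(2))
  show "map_poly \<phi> (p + q) = map_poly \<phi> p + map_poly \<phi> q"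
    by (rule poly_eqI) (simp add: c hom(1))
  show d: "degree (map_poly \<phi> p) = degree p"
    by (rule degree_map_poly) (simp add: hom(5))
  show "map_poly \<phi> 1 = 1" by (simp add: one_pCons map_poly_pCons hom(3,4))
  show "lead_coeff (map_poly \<phi> p) = 1" if "lead_coeff p = 1"
    unfolding d c that by (rule hom(3))
qed

lemma map_poly_prod_aut:
  fixes \<phi> :: "'f::field \<Rightarrow> 'f"
  assumes \<phi>: "ring_aut \<phi>"
  shows "map_poly \<phi> (\<Prod>i\<in>S. f i) = (\<Prod>i\<in>S. map_poly \<phi> (f i))"
  by (induction S rule: infinite_finite_induct) (simp_all add: map_poly_mult_aut[OF \<phi>])

text \<open>The extension of the ideal \<open>P\<close> to the larger ring \<open>S\<close>, written
  as finite sums; it is applied to a prime of the center and \<Lambda>.\<close>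

inductive_set ideal_gen :: "'r::comm_ring_1 set \<Rightarrow> 'r set \<Rightarrow> 'r set" for P S where
  zero: "0 \<in> ideal_gen P S"
| add: "p \<in> P \<Longrightarrow> l \<in> S \<Longrightarrow> x \<in> ideal_gen P S \<Longrightarrow> p * l + x \<in> ideal_gen P S"

lemma ideal_gen_mult:
  assumes "x \<in> ideal_gen P S" "l \<in> S" "\<And>a b. a \<in> S \<Longrightarrow> b \<in> S \<Longrightarrow> a * b \<in> S"
  shows "x * l \<in> ideal_gen P S"
  using assms(1)
proof induction
  case (add p k x)
  then have "p * (k * l) + x * l \<in> ideal_gen P S"
    using assms by (intro ideal_gen.add) auto
  then show ?case by (simp add: algebra_simps)
qed (simp add: ideal_gen.zero)

lemma ideal_gen_add:
  assumes "x \<in> ideal_gen P S" "y \<in> ideal_gen P S"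
  shows "x + y \<in> ideal_gen P S"
  using assms(1)
proof induction
  case (add p k x)
  then show ?case using ideal_gen.add[OF add(1,2) add(4)] by (simp add: add.assoc)
qed (simp add: assms)

lemma ideal_gen_subset:
  assumes "P \<subseteq> S" "nonunital_subring S"
  shows "ideal_gen P S \<subseteq> S"
proof
  fix x assume "x \<in> ideal_gen P S"
  then show "x \<in> S"
    by induction (use assms nonunital_subringD[OF assms(2)] in auto)
qed

lemma nonunital_subring_ideal_gen:
  assumes "P \<subseteq> S" "nonunital_subring S" "1 \<in> S"
  shows "nonunital_subring (ideal_gen P S)"
proof -
  note S = nonunital_subringD[OF assms(2)]
  have "- x \<in> ideal_gen P S" if "x \<in> ideal_gen P S" for x
    using ideal_gen_mult[OF that S(4)[OF assms(3)] S(3)] by simp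
  moreover have "x * y \<in> ideal_gen P S" if "x \<in> ideal_gen P S" "y \<in> ideal_gen P S" for x y
    using ideal_gen_mult[OF that(1) _ S(3)] ideal_gen_subset[OF assms(1,2)] that(2) by blast
  ultimately show ?thesis
    unfolding nonunital_subring_def using ideal_gen.zero ideal_gen_add by blast
qed

text \<open>Each product \<open>p l\<close> is integral with coefficients in \<open>P\<close>, and
  such elements are closed under sums. This will show that the extension of a prime to \<Lambda>
  meets the invariants in the prime itself.\<close>

lemma integral_at_ideal_gen:
  assumes A: "nonunital_subring A" "1 \<in> A" and P: "nonunital_subring P" "\<And>p a. p \<in> P \<Longrightarrow> a \<in> A \<Longrightarrow> p * a \<in> P"
    and S: "\<And>l. l \<in> S \<Longrightarrow> integral_at A l" and x: "x \<in> ideal_gen P S"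
  shows "integral_at P x"
  using x
proof induction
  case zero
  show ?case by (rule integral_at_elem[OF P(1) nonunital_subringD(1)[OF P(1)]])
next
  case (add p l x)
  have "integral_at P (p * l)" by (rule integral_at_ideal_mult[OF S[OF add(2)] add(1) P(2)[OF add(1)]])
  then show ?case by (rule integral_at_add[OF P(1) _ add.IH])
qed

section \<open>Norms over M and equations with invariant coefficients\<close>

context galois_order_data
begin

abbreviation LL :: "'a fract set" where "LL \<equiv> range to_fract"

text \<open>A copy inside \<open>L\<close> of what turns out to be the center of \<open>U\<close>
  when \<Lambda> is integrally closed, see \<open>center_RU\<close>.\<close>

definition invariants :: "'a fract set" where
  "invariants = {x \<in> LL. (\<forall>g\<in>G. fract_ext g x = x) \<and> (\<forall>\<mu>\<in>M. fract_ext \<mu> x = x)}"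

lemma nonunital_subring_LL: "nonunital_subring LL" "1 \<in> LL"
proof -
  have "to_fract x + to_fract y \<in> LL" "to_fract x * to_fract y \<in> LL" "- to_fract x \<in> LL" for x y :: 'a
    by (metis rangeI to_fract_add, metis rangeI to_fract_mult, metis rangeI to_fract_uminus)
  moreover have "0 \<in> LL" "1 \<in> LL" by (metis rangeI to_fract_0, metis rangeI to_fract_1)
  ultimately show "nonunital_subring LL" "1 \<in> LL" by (auto simp: nonunital_subring_def)
qed

lemma fract_ext_LL: "ring_aut \<phi> \<Longrightarrow> x \<in> LL \<Longrightarrow> fract_ext \<phi> x \<in> LL"
  using fract_ext_to_fract by fastforce

lemma nonunital_subring_invariants: "nonunital_subring invariants" "1 \<in> invariants"
proof -
  note hom = ring_autD(4-7)[OF ring_aut_fract_ext] ring_aut_minus[OF ring_aut_fract_ext]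
  show "nonunital_subring invariants" "1 \<in> invariants"
    using nonunital_subringD[OF nonunital_subring_LL(1)] nonunital_subring_LL(2) G_aut M_aut
    by (auto simp: nonunital_subring_def invariants_def hom)
qed

lemma invariants_LL: "invariants \<subseteq> LL" and invariants_G: "x \<in> invariants \<Longrightarrow> g \<in> G \<Longrightarrow> fract_ext g x = x"
  and invariants_M: "x \<in> invariants \<Longrightarrow> \<mu> \<in> M \<Longrightarrow> fract_ext \<mu> x = x"
  by (auto simp: invariants_def)

lemma bij_betw_M: "\<nu> \<in> M \<Longrightarrow> bij_betw (\<lambda>\<mu>. \<nu> \<circ> \<mu>) M M"
  by (rule bij_betw_byWitness[where f' = "\<lambda>\<mu>. finv \<nu> \<circ> \<mu>"])
    (auto simp: M_comp M_inv comp_assoc[symmetric] ring_autD(11,12)[OF M_aut])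

lemma bij_betw_conj_M:
  assumes "g \<in> G"
  shows "bij_betw (\<lambda>\<mu>. g \<circ> \<mu> \<circ> finv g) M M"
proof (rule bij_betw_byWitness[where f' = "\<lambda>\<mu>. finv g \<circ> \<mu> \<circ> g"])
  have gg: "g \<circ> finv g = id" "finv g \<circ> g = id" "finv (finv g) = g"
    using ring_autD(1,11,12)[OF G_aut[OF assms]] by (auto simp: inv_inv_eq)
  have e: "finv g \<circ> (g \<circ> \<mu> \<circ> finv g) \<circ> g = \<mu>" "g \<circ> (finv g \<circ> \<mu> \<circ> g) \<circ> finv g = \<mu>" for \<mu>
    using gg(1,2) by (auto simp: fun_eq_iff)
  show "\<forall>\<mu>\<in>M. finv g \<circ> (g \<circ> \<mu> \<circ> finv g) \<circ> g = \<mu>" "\<forall>\<mu>\<in>M. g \<circ> (finv g \<circ> \<mu> \<circ> g) \<circ> finv g = \<mu>"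
    using e by blast+
  show "(\<lambda>\<mu>. g \<circ> \<mu> \<circ> finv g) ` M \<subseteq> M" using conj_M[OF assms] by blast
  show "(\<lambda>\<mu>. finv g \<circ> \<mu> \<circ> g) ` M \<subseteq> M" using conj_M[OF G_inv[OF assms]] gg(3) by auto
qed

lemma map_poly_fract_ext_comp:
  "ring_aut \<phi> \<Longrightarrow> ring_aut \<psi> \<Longrightarrow> map_poly (fract_ext (\<phi> \<circ> \<psi>)) p = map_poly (fract_ext \<phi>) (map_poly (fract_ext \<psi>) p)"
  by (rule poly_eqI) (simp add: map_poly_mult_aut(5)[OF ring_aut_fract_ext] ring_aut_comp fract_ext_comp)

definition orbit_poly :: "'a fract poly \<Rightarrow> 'a fract poly" where
  "orbit_poly c = (\<Prod>\<mu>\<in>M. map_poly (fract_ext \<mu>) c)"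

lemma orbit_poly_dvd: "c dvd orbit_poly c"
proof -
  have "map_poly (fract_ext id) c = c" by (rule poly_eqI) (simp add: coeff_map_poly)
  then have "orbit_poly c = c * (\<Prod>\<mu>\<in>M - {id}. map_poly (fract_ext \<mu>) c)"
    unfolding orbit_poly_def using fin_M by (subst prod.remove[of _ id]) auto
  then show ?thesis by simp
qed

text \<open>An element of \<open>M\<close> permutes the factors by left translation. An element
  \<open>g\<close> of \<open>G\<close> carries the factor of \<open>\<mu>\<close> to that of
  \<open>g \<mu> g^-1\<close>, because the inverse of \<open>g\<close> fixes
  \<open>c\<close>.\<close>

lemma orbit_poly_monic_over:
  assumes J: "nonunital_subring J" "J \<subseteq> LL" "\<And>\<mu> x. \<mu> \<in> M \<Longrightarrow> x \<in> J \<Longrightarrow> fract_ext \<mu> x \<in> J"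
    and c: "monic_over J c" "\<And>g. g \<in> G \<Longrightarrow> map_poly (fract_ext g) c = c"
  shows "monic_over (J \<inter> invariants) (orbit_poly c)"
proof -
  have m: "monic_over J (orbit_poly c)"
    unfolding orbit_poly_def
  proof (rule monic_over_prod[OF J(1)])
    fix \<mu> assume \<mu>: "\<mu> \<in> M"
    show "monic_over J (map_poly (fract_ext \<mu>) c)"
      using c(1) J(3)[OF \<mu>] map_poly_mult_aut(3,5)[OF ring_aut_fract_ext[OF M_aut[OF \<mu>]]]
        ring_autD(6)[OF ring_aut_fract_ext[OF M_aut[OF \<mu>]]]
      by (simp add: monic_over_def)
  qed
  have M: "map_poly (fract_ext \<nu>) (orbit_poly c) = orbit_poly c" if \<nu>: "\<nu> \<in> M" for \<nu>
  proof -
    have "map_poly (fract_ext \<nu>) (orbit_poly c) = (\<Prod>\<mu>\<in>M. map_poly (fract_ext (\<nu> \<circ> \<mu>)) c)"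
      unfolding orbit_poly_def using M_aut \<nu>
      by (simp add: map_poly_prod_aut ring_aut_fract_ext map_poly_fract_ext_comp)
    then show ?thesis
      using prod.reindex_bij_betw[OF bij_betw_M[OF \<nu>], of "\<lambda>\<mu>. map_poly (fract_ext \<mu>) c"] by (simp add: orbit_poly_def)
  qed
  have G: "map_poly (fract_ext g) (orbit_poly c) = orbit_poly c" if g: "g \<in> G" for g
  proof -
    have "map_poly (fract_ext g) (orbit_poly c) = (\<Prod>\<mu>\<in>M. map_poly (fract_ext (g \<circ> \<mu>)) c)"
      unfolding orbit_poly_def using M_aut G_aut[OF g]
      by (simp add: map_poly_prod_aut ring_aut_fract_ext map_poly_fract_ext_comp)
    also have "\<dots> = (\<Prod>\<mu>\<in>M. map_poly (fract_ext (g \<circ> \<mu> \<circ> finv g)) c)"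
    proof (rule prod.cong[OF refl])
      fix \<mu> assume \<mu>: "\<mu> \<in> M"
      have "map_poly (fract_ext (g \<circ> \<mu> \<circ> finv g)) c = map_poly (fract_ext (g \<circ> \<mu>)) (map_poly (fract_ext (finv g)) c)"
        using G_aut[OF g] M_aut[OF \<mu>] by (intro map_poly_fract_ext_comp ring_aut_comp ring_aut_inv)
      then show "map_poly (fract_ext (g \<circ> \<mu>)) c = map_poly (fract_ext (g \<circ> \<mu> \<circ> finv g)) c"
        using c(2)[OF G_inv[OF g]] by simp
    qed
    finally show ?thesis
      using prod.reindex_bij_betw[OF bij_betw_conj_M[OF g], of "\<lambda>\<mu>. map_poly (fract_ext \<mu>) c"] by (simp add: orbit_poly_def)
  qed
  have "fract_ext g (coeff (orbit_poly c) i) = coeff (orbit_poly c) i" if "g \<in> G \<or> g \<in> M" for g i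
    using that G M map_poly_mult_aut(5)[OF ring_aut_fract_ext] G_aut M_aut by metis
  then have "coeff (orbit_poly c) i \<in> J \<inter> invariants" if "i < degree (orbit_poly c)" for i
    using m that J(2) by (auto simp: monic_over_def invariants_def)
  then show ?thesis using m by (simp add: monic_over_def)
qed

text \<open>The product of the \<open>t - g x\<close> over \<open>G\<close> is fixed by
  \<open>G\<close>, so its norm over \<open>M\<close> has invariant coefficients. Taking the two
  norms in turn avoids the group generated by \<open>G\<close> and \<open>M\<close>.\<close>

lemma LL_integral_over_invariants:
  assumes "x \<in> LL"
  shows "integral_at invariants x"
proof -
  define c where "c = (\<Prod>g\<in>G. [:- fract_ext g x, 1:])"
  have c: "monic_over LL c"
    unfolding c_def
    by (intro monic_over_prod[OF nonunital_subring_LL(1)])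
      (auto simp: monic_over_def coeff_pCons intro!: nonunital_subringD(4)[OF nonunital_subring_LL(1)] fract_ext_LL[OF G_aut] assms)
  have G: "map_poly (fract_ext h) c = c" if h: "h \<in> G" for h
  proof -
    have "map_poly (fract_ext h) [:- fract_ext g x, 1:] = [:- fract_ext (h \<circ> g) x, 1:]" if "g \<in> G" for g
      using ring_autD(6,7)[OF ring_aut_fract_ext[OF G_aut[OF h]]] ring_aut_minus[OF ring_aut_fract_ext[OF G_aut[OF h]]]
        fract_ext_comp[OF G_aut[OF h] G_aut[OF that], of x]
      by (simp add: map_poly_pCons)
    then have "map_poly (fract_ext h) c = (\<Prod>g\<in>G. [:- fract_ext (h \<circ> g) x, 1:])"
      unfolding c_def by (simp add: map_poly_prod_aut ring_aut_fract_ext G_aut[OF h])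
    then show ?thesis
      using prod.reindex_bij_betw[OF bij_betw_G[OF h], of "\<lambda>g. [:- fract_ext g x, 1:]"] by (simp add: c_def)
  qed
  have "monic_over (LL \<inter> invariants) (orbit_poly c)"
    using c G fract_ext_LL[OF M_aut] by (intro orbit_poly_monic_over nonunital_subring_LL) auto
  then have m: "monic_over invariants (orbit_poly c)" by (rule monic_over_mono[rotated]) blast
  have "poly c x = (\<Prod>g\<in>G. x - fract_ext g x)" by (simp add: c_def poly_prod)
  also have "\<dots> = 0" using fin_G by (auto simp: prod_zero_iff intro: bexI[of _ id])
  finally have "poly (orbit_poly c) x = 0"
    using orbit_poly_dvd[of c] by (auto simp: dvd_def)
  then show ?thesis by (rule root_imp_integral_at[OF nonunital_subring_invariants m])
qed

text \<open>Cayley-Hamilton for right multiplication by \<open>y\<close> on the finitely generated left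
  \<open>\<Gamma>\<close>-module \<open>U\<close>, followed by the norm over \<open>M\<close>, which moves the coefficients into the
  center.\<close>

lemma monic_equation:
  fixes n :: nat and w :: "nat \<Rightarrow> 'a skew"
  assumes J: "nonunital_subring J" "J \<subseteq> LL" "\<And>\<mu> x. \<mu> \<in> M \<Longrightarrow> x \<in> J \<Longrightarrow> fract_ext \<mu> x \<in> J"
    and y: "y \<in> U"
    and gen: "\<forall>u\<in>U. \<exists>c. (\<forall>i<n. c i \<in> \<Gamma>) \<and> u = (\<Sum>i<n. skew_mult (skew_embed (to_fract (c i))) (w i))"
    and entries: "\<And>i. i < n \<Longrightarrow> \<exists>a. (\<forall>j<n. a j \<in> J \<inter> to_fract ` \<Gamma>) \<and>
      skew_mult (w i) y = (\<Sum>j<n. skew_mult (skew_embed (a j)) (w j))"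
  obtains f where "monic_over (J \<inter> invariants) f" "skew_right.act y f (skew_embed 1) = 0"
proof -
  obtain a where a: "\<And>i j. i < n \<Longrightarrow> j < n \<Longrightarrow> a i j \<in> J \<inter> to_fract ` \<Gamma>"
    "\<And>i. i < n \<Longrightarrow> skew_mult (w i) y = (\<Sum>j<n. skew_mult (skew_embed (a i j)) (w j))"
    using entries by metis
  have "nonunital_subring (to_fract ` \<Gamma>)"
  proof -
    have "to_fract x + to_fract z \<in> to_fract ` \<Gamma>" "to_fract x * to_fract z \<in> to_fract ` \<Gamma>" "- to_fract x \<in> to_fract ` \<Gamma>"
      if "x \<in> \<Gamma>" "z \<in> \<Gamma>" for x z
      using that \<Gamma>_closed(3-5)[of x] by (simp_all flip: to_fract_add to_fract_mult to_fract_uminus)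
    moreover have "0 \<in> to_fract ` \<Gamma>" using imageI[OF \<Gamma>_closed(2), of to_fract] by simp
    ultimately show ?thesis by (auto simp: nonunital_subring_def)
  qed
  then have I: "nonunital_subring (J \<inter> to_fract ` \<Gamma>)"
    using J(1) by (auto simp: nonunital_subring_def)
  obtain c where c: "monic_over (J \<inter> to_fract ` \<Gamma>) c" "degree c = n" "\<And>k. k < n \<Longrightarrow> skew_right.act y c (w k) = 0"
    using skew_right.cayley_hamilton[OF I a] by blast
  obtain k where k: "skew_embed 1 = (\<Sum>i<n. skew_mult (skew_embed (to_fract (k i))) (w i))"
    using gen U_closed(2) by blast
  have c1: "skew_right.act y c (skew_embed 1) = 0"
    unfolding k by (simp add: skew_right.act_sum_right skew_right.act_scale c(3))
  have "map_poly (fract_ext g) c = c" if "g \<in> G" for g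
  proof (rule poly_eqI)
    fix i
    have "fract_ext g (coeff c i) = coeff c i"
    proof (cases "i < degree c")
      case True
      then have "coeff c i \<in> to_fract ` \<Gamma>" using c(1) by (simp add: monic_over_def)
      then show ?thesis using fract_ext_to_fract[OF G_aut[OF that]] fixedD[OF _ that] by auto
    next
      case False
      then have "coeff c i = 0 \<or> coeff c i = 1"
        using c(1) by (cases "i = degree c") (auto simp: monic_over_def coeff_eq_0)
      then show ?thesis using ring_autD(6,7)[OF ring_aut_fract_ext[OF G_aut[OF that]]] by auto
    qed
    then show "coeff (map_poly (fract_ext g) c) i = coeff c i"
      by (simp add: map_poly_mult_aut(5)[OF ring_aut_fract_ext[OF G_aut[OF that]]])
  qed
  then have m: "monic_over (J \<inter> invariants) (orbit_poly c)"
    using c(1) by (intro orbit_poly_monic_over[OF J]) (auto intro: monic_over_mono[rotated])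
  \<comment> \<open>The coefficients of \<open>c\<close> need not commute with \<open>y\<close>, yet
    multiplying polynomials composes their actions, so the multiple \<open>orbit_poly c\<close>
    still kills \<open>1\<close>.\<close>
  obtain d where "orbit_poly c = d * c" using orbit_poly_dvd[of c] by (auto simp: dvd_def mult.commute)
  then have "skew_right.act y (orbit_poly c) (skew_embed 1) = 0"
    by (simp add: skew_right.act_mult c1)
  then show thesis using that m by blast
qed

lemma eval_eq_act:
  assumes u: "u \<in> U" and p: "\<And>i. coeff p i \<in> invariants"
  shows "ring.eval RU (map skew_embed (rev (coeffs p))) u = skew_right.act u p (skew_embed 1)"
  using p
proof (induction p)
  case 0
  show ?case by (simp add: ring.eval.simps[OF ring_RU])
next
  case (pCons a p)
  interpret RU: ring RU by (rule ring_RU)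
  have emb: "skew_embed x \<in> U" if x: "x \<in> invariants" for x
  proof -
    obtain z where z: "x = to_fract z" using x invariants_LL by blast
    have "g z = z" if "g \<in> G" for g
      using invariants_G[OF \<open>x \<in> invariants\<close> that] fract_ext_to_fract[OF G_aut[OF that], of z] z by simp
    then show ?thesis unfolding z by (intro embed_U) (simp add: fixed_subring_def)
  qed
  have coeff: "a \<in> invariants" "\<And>i. coeff p i \<in> invariants"
    using pCons.prems[of 0] pCons.prems[of "Suc _"] by simp_all
  have IH: "RU.eval (map skew_embed (rev (coeffs p))) u = skew_right.act u p (skew_embed 1)"
    by (rule pCons.IH) (rule coeff(2))
  have "set (map skew_embed (rev (coeffs p))) \<subseteq> carrier RU"
    using coeff(2) emb by (auto simp: coeffs_def)
  then have "RU.eval (map skew_embed (rev (coeffs p)) @ [skew_embed a]) u =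
      skew_mult (RU.eval (map skew_embed (rev (coeffs p))) u) u + skew_embed a"
    using RU.eval_append_aux[of "map skew_embed (rev (coeffs p))" "skew_embed a" u] u emb[OF coeff(1)] by simp
  moreover have "skew_right.act u p (skew_mult (skew_embed 1) u) = skew_mult (skew_right.act u p (skew_embed 1)) u"
    by (rule skew_right.act_T)
  then have "skew_right.act u (pCons a p) (skew_embed 1) =
      skew_embed a + skew_mult (skew_right.act u p (skew_embed 1)) u"
    by (simp add: skew_mult_embed_embed)
  ultimately show ?case
    using pCons.hyps IH by (auto simp: cCons_def add.commute)
qed

end

text \<open>An element of least degree in the ideal of \<open>h\<close> and \<open>f\<close>. The
  Bezout form is used twice: \<open>d\<close> annihilates what both polynomials annihilate, and an
  automorphism that fixes \<open>h\<close> and \<open>f\<close> fixes \<open>d\<close>.\<close>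

lemma monic_gcd_bezout:
  fixes h f :: "'f::field poly"
  assumes "h \<noteq> 0"
  obtains d r s where "lead_coeff d = 1" "d = r * h + s * f" "d dvd h" "d dvd f"
proof -
  define K where "K = {r * h + s * f |r s. True}"
  have K_mult: "a * q \<in> K" if q: "q \<in> K" for a q
  proof -
    obtain r s where "q = r * h + s * f" using q by (auto simp: K_def)
    then have "a * q = (a * r) * h + (a * s) * f" by (simp add: algebra_simps)
    then show ?thesis unfolding K_def by blast
  qed
  have K_diff: "q - q' \<in> K" if qq: "q \<in> K" "q' \<in> K" for q q'
  proof -
    obtain r s r' s' where "q = r * h + s * f" "q' = r' * h + s' * f" using qq by (auto simp: K_def)
    then have "q - q' = (r - r') * h + (s - s') * f" by (simp add: algebra_simps)
    then show ?thesis unfolding K_def by blast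
  qed
  have "h = 1 * h + 0 * f" "f = 0 * h + 1 * f" by simp_all
  then have hf: "h \<in> K" "f \<in> K" unfolding K_def by blast+
  obtain e where e: "e \<in> K" "e \<noteq> 0" "\<And>q. q \<in> K \<Longrightarrow> q \<noteq> 0 \<Longrightarrow> degree e \<le> degree q"
    using ex_has_least_nat[of "\<lambda>q. q \<in> K \<and> q \<noteq> 0" h degree] hf(1) assms by auto
  define d where "d = [:inverse (lead_coeff e):] * e"
  have d: "d \<in> K" unfolding d_def by (rule K_mult[OF e(1)])
  have "lead_coeff d = 1" "degree d = degree e" using e(2) by (auto simp: d_def)
  note d = d this
  have dvd: "d dvd q" if q: "q \<in> K" for q
  proof -
    have "q mod d = q - (q div d) * d" by (simp add: minus_div_mult_eq_mod)
    then have "q mod d \<in> K" using K_diff[OF q K_mult[OF d(1)]] by simp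
    moreover have "q mod d = 0 \<or> degree (q mod d) < degree d"
      using d(2) by (intro degree_mod_less) auto
    ultimately have "q mod d = 0" using e(3)[of "q mod d"] d(3) by (metis not_less)
    then show ?thesis by (simp add: dvd_eq_mod_eq_0)
  qed
  obtain r s where "d = r * h + s * f" using d(1) by (auto simp: K_def)
  then show thesis using that d(2) dvd hf by blast
qed

lemma skew_embed_add: "skew_embed (x + y) = skew_embed x + skew_embed y"
  by (simp add: skew_embed_def single_add)

lemma skew_embed_zero: "skew_embed 0 = 0"
  by (simp add: skew_embed_def)

section \<open>The center of U and integrality over it\<close>

context galois_order_data
begin

lemma lookup_mult_skew_embed:
  assumes "keys f \<subseteq> M"
  shows "lookup (skew_mult f (skew_embed x)) \<nu> = lookup f \<nu> * fract_ext \<nu> x"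
proof (cases "x = 0")
  case True
  have "fract_ext \<nu> 0 = 0" if "\<nu> \<in> keys f"
    using that assms fract_ext_simps(4)[OF M_aut] by blast
  then show ?thesis using True by (auto simp: skew_mult_def skew_embed_def in_keys_iff)
next
  case False
  have "skew_mult f (skew_embed x) = (\<Sum>\<mu>\<in>keys f. Poly_Mapping.single \<mu> (lookup f \<mu> * fract_ext \<mu> x))"
    using False by (simp add: skew_mult_def skew_embed_def)
  then have "lookup (skew_mult f (skew_embed x)) \<nu> = (\<Sum>\<mu>\<in>keys f. if \<mu> = \<nu> then lookup f \<mu> * fract_ext \<mu> x else 0)"
    by (auto simp: lookup_sum lookup_single when_def intro!: sum.cong)
  also have "\<dots> = lookup f \<nu> * fract_ext \<nu> x" by (simp add: in_keys_iff)
  finally show ?thesis .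
qed

lemma invariants_commute:
  assumes "x \<in> invariants" "keys f \<subseteq> M"
  shows "skew_mult f (skew_embed x) = skew_mult (skew_embed x) f"
proof (rule poly_mapping_eqI)
  fix \<nu>
  show "lookup (skew_mult f (skew_embed x)) \<nu> = lookup (skew_mult (skew_embed x) f) \<nu>"
  proof (cases "\<nu> \<in> keys f")
    case True
    then have "fract_ext \<nu> x = x" using invariants_M[OF assms(1)] assms(2) by blast
    then show ?thesis using assms(2) by (simp add: lookup_mult_skew_embed lookup_skew_embed_mult)
  qed (use assms(2) in \<open>simp add: lookup_mult_skew_embed lookup_skew_embed_mult in_keys_iff\<close>)
qed

lemma invariants_\<Gamma>:
  assumes "x \<in> invariants"
  obtains z where "z \<in> \<Gamma>" "x = to_fract z"
proof -
  obtain z where z: "x = to_fract z" using assms invariants_LL by blast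
  have "g z = z" if "g \<in> G" for g
    using invariants_G[OF assms that] fract_ext_to_fract[OF G_aut[OF that], of z] z by simp
  then have "z \<in> \<Gamma>" unfolding fixed_subring_def by blast
  then show thesis using z by (rule that)
qed

lemma embed_invariants_U: "x \<in> invariants \<Longrightarrow> skew_embed x \<in> U"
  using invariants_\<Gamma> embed_U by metis

lemma integral_equation:
  assumes u: "u \<in> U"
  obtains f where "monic_over invariants f" "skew_right.act u f (skew_embed 1) = 0"
proof -
  obtain n :: nat and w where w: "\<forall>i<n. w i \<in> U"
    "\<forall>u\<in>U. \<exists>c. (\<forall>i<n. c i \<in> \<Gamma>) \<and> u = (\<Sum>i<n. skew_mult (skew_embed (to_fract (c i))) (w i))"
    using U_finitely_generated by blast
  have entries: "\<exists>a. (\<forall>j<n. a j \<in> LL \<inter> to_fract ` \<Gamma>) \<and> skew_mult (w i) u = (\<Sum>j<n. skew_mult (skew_embed (a j)) (w j))"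
    if "i < n" for i
  proof -
    have "skew_mult (w i) u \<in> U" using w(1) that u by (intro U_closed(4)) auto
    then obtain c where "\<forall>j<n. c j \<in> \<Gamma>" "skew_mult (w i) u = (\<Sum>j<n. skew_mult (skew_embed (to_fract (c j))) (w j))"
      using w(2) by blast
    then show ?thesis by (intro exI[of _ "\<lambda>j. to_fract (c j)"]) auto
  qed
  obtain f where "monic_over (LL \<inter> invariants) f" "skew_right.act u f (skew_embed 1) = 0"
    using monic_equation[OF nonunital_subring_LL(1) subset_refl _ u w(2) entries] fract_ext_LL[OF M_aut] by blast
  then show thesis using that monic_over_mono[of "LL \<inter> invariants" invariants] by blast
qed

lemma act_skew_embed: "skew_right.act (skew_embed x) p (skew_embed y) = skew_embed (poly p x * y)"
proof (induction p arbitrary: y)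
  case (pCons a p)
  then show ?case
    by (simp add: skew_mult_embed_embed skew_embed_add algebra_simps)
qed (simp add: skew_embed_zero)

end

locale closed_galois_order = galois_order_data +
  assumes int_closed: "integrally_closed TYPE('a)"
begin

lemma root_in_LL:
  assumes f: "monic_over LL f" "poly f x = 0"
  shows "x \<in> LL"
proof -
  define p where "p = map_poly (inv_into UNIV to_fract) f"
  have inv: "to_fract (inv_into UNIV to_fract y) = y" if "y \<in> LL" for y :: "'a fract"
    using that by (rule f_inv_into_f)
  have inj: "inv_into UNIV to_fract (to_fract y) = y" for y :: 'a
    by (rule inv_into_f_f) (auto simp: inj_def)
  have "inv_into UNIV to_fract (0 :: 'a fract) = 0" using inj[of 0] by simp
  then have coeff: "to_fract (coeff p i) = coeff f i" for i
    using inv[OF monic_over_coeff[OF f(1) nonunital_subringD(1)[OF nonunital_subring_LL(1)] nonunital_subring_LL(2)]]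
    by (simp add: p_def coeff_map_poly)
  have pf: "fract_poly p = f" by (rule poly_eqI) (simp add: coeff_map_poly coeff)
  have "degree p = degree f" using pf degree_map_poly[of to_fract p] by simp
  then have "to_fract (lead_coeff p) = 1" using coeff[of "degree f"] f(1) by (simp add: monic_over_def)
  then have "lead_coeff p = 1" by (metis to_fract_1 to_fract_eq_iff)
  then show ?thesis using int_closed pf f(2) unfolding integrally_closed_def by blast
qed

text \<open>Integral closedness passes from \<Lambda> to the invariants: an integral element lies in
  \<Lambda>, and a fixed element of \<Lambda> is invariant.\<close>

lemma integral_fixed_in_invariants:
  assumes "integral_at invariants x" "\<And>\<sigma>. \<sigma> \<in> G \<union> M \<Longrightarrow> fract_ext \<sigma> x = x"
  shows "x \<in> invariants"
proof -
  obtain p where "monic_over invariants p" "poly p x = 0"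
    using integral_at_imp_root[OF nonunital_subring_invariants(1) assms(1)] by blast
  then have "x \<in> LL" using root_in_LL monic_over_mono[OF invariants_LL] by blast
  then show ?thesis using assms(2) by (auto simp: invariants_def)
qed

text \<open>Commuting with \<Gamma> confines the support of \<open>z\<close> to \<open>id\<close>,
  because \<Gamma> separates \<open>M\<close>. Commuting with an element of \<open>U\<close> that
  has a nonzero coefficient at \<open>\<mu>\<close> makes the remaining coefficient fixed by
  \<open>\<mu>\<close>. An integral equation together with integral closedness puts it into
  \<Lambda>.\<close>

lemma center_RU: "center RU = skew_embed ` invariants"
proof (intro equalityI subsetI)
  fix z assume "z \<in> skew_embed ` invariants"
  then obtain x where x: "x \<in> invariants" "z = skew_embed x" by blast
  then show "z \<in> center RU"
    using embed_invariants_U invariants_commute[OF x(1) U_keys] by (simp add: center_def)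
next
  fix z assume "z \<in> center RU"
  then have z: "z \<in> U" "\<And>u. u \<in> U \<Longrightarrow> skew_mult z u = skew_mult u z" by (auto simp: center_def)
  have zM: "keys z \<subseteq> M" by (rule U_keys[OF z(1)])
  define a where "a = lookup z id"
  have off: "lookup z \<mu> = 0" if "\<mu> \<noteq> id" for \<mu>
  proof (rule ccontr)
    assume n: "lookup z \<mu> \<noteq> 0"
    then have \<mu>: "\<mu> \<in> M" using zM by (auto simp: in_keys_iff)
    obtain x where x: "x \<in> \<Gamma>" "\<mu> x \<noteq> id x" using separating[OF \<mu> M_id \<open>\<mu> \<noteq> id\<close>] by blast
    have "lookup (skew_mult z (skew_embed (to_fract x))) \<mu> = lookup (skew_mult (skew_embed (to_fract x)) z) \<mu>"
      using z(2)[OF embed_U[OF x(1)]] by simp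
    then have "lookup z \<mu> * to_fract (\<mu> x) = lookup z \<mu> * to_fract x"
      using zM by (simp add: lookup_mult_skew_embed lookup_skew_embed_mult fract_ext_to_fract[OF M_aut[OF \<mu>]] mult.commute)
    then show False using n x(2) by simp
  qed
  have za: "z = skew_embed a"
    by (rule poly_mapping_eqI) (use off in \<open>auto simp: skew_embed_def lookup_single when_def a_def\<close>)
  have G: "fract_ext g a = a" if g: "g \<in> G" for g
  proof -
    have "skew_embed (fract_ext g a) = skew_embed a"
      using U_KK[OF z(1)] skew_action_embed[OF g, of a] g by (simp add: KK_carrier za)
    then show ?thesis by (metis lookup_single_eq skew_embed_def)
  qed
  have M: "fract_ext \<mu> a = a" if \<mu>: "\<mu> \<in> M" for \<mu>
  proof -
    have k: "keys (Poly_Mapping.single \<mu> (1 :: 'a fract)) \<subseteq> M" "\<mu> \<in> keys (Poly_Mapping.single \<mu> (1 :: 'a fract))"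
      using \<mu> by (auto simp: keys_single)
    \<comment> \<open>The trace of a suitable multiple \<open>b \<mu>\<close>, with its denominator
      cleared, is an element of \<open>U\<close> with a nonzero coefficient at
      \<open>\<mu>\<close>.\<close>
    obtain b where b: "lookup (skew_trace (skew_mult (skew_embed (to_fract b)) (Poly_Mapping.single \<mu> 1))) \<mu> \<noteq> 0"
      using skew_trace_nonzero[OF k] by blast
    define t where "t = skew_trace (skew_mult (skew_embed (to_fract b)) (Poly_Mapping.single \<mu> 1))"
    have "t \<in> carrier KK"
      unfolding t_def using keys_skew_embed_mult k(1) by (intro skew_trace_in_KK) blast
    then obtain c where c: "c \<in> \<Gamma>" "c \<noteq> 0" "skew_mult (skew_embed (to_fract c)) t \<in> U" by (rule clear_denominator)
    define u where "u = skew_mult (skew_embed (to_fract c)) t"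
    have u: "u \<in> U" "lookup u \<mu> \<noteq> 0"
      using b c by (simp_all add: u_def t_def lookup_skew_embed_mult)
    have "lookup (skew_mult z u) \<mu> = lookup (skew_mult u z) \<mu>" using z(2)[OF u(1)] by simp
    then have "a * lookup u \<mu> = lookup u \<mu> * fract_ext \<mu> a"
      unfolding za using U_keys[OF u(1)] by (simp add: lookup_mult_skew_embed lookup_skew_embed_mult)
    then show ?thesis using u(2) by simp
  qed
  obtain f where f: "monic_over invariants f" "skew_right.act z f (skew_embed 1) = 0"
    by (rule integral_equation[OF z(1)])
  have "skew_embed (poly f a) = skew_embed 0"
    using f(2) act_skew_embed[of a f 1] by (simp add: za) (simp add: skew_embed_def)
  then have "poly f a = 0" by (metis lookup_single_eq skew_embed_def)
  then have "a \<in> LL" using root_in_LL monic_over_mono[OF invariants_LL f(1)] by blast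
  then have "a \<in> invariants" using G M by (simp add: invariants_def)
  then show "z \<in> skew_embed ` invariants" using za by blast
qed

lemma integral_extension_RU: "integral_extension RU (center RU)"
proof (intro integral_extension.intro integral_extension_axioms.intro ring_RU)
  interpret RU: ring RU by (rule ring_RU)
  note inv = nonunital_subringD[OF nonunital_subring_invariants(1)]
  note emb = skew_embed_add[symmetric]
  show "subring (center RU) RU"
  proof (rule RU.subringI)
    show c: "center RU \<subseteq> carrier RU" by (auto simp: center_def)
    show "\<one>\<^bsub>RU\<^esub> \<in> center RU" using nonunital_subring_invariants(2) by (simp add: center_RU)
    show mult: "h1 \<otimes>\<^bsub>RU\<^esub> h2 \<in> center RU" if "h1 \<in> center RU" "h2 \<in> center RU" for h1 h2
      using that inv(3) by (auto simp: center_RU skew_mult_embed_embed)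
    show "h1 \<oplus>\<^bsub>RU\<^esub> h2 \<in> center RU" if "h1 \<in> center RU" "h2 \<in> center RU" for h1 h2
      using that inv(2) by (auto simp: center_RU emb)
    show "\<ominus>\<^bsub>RU\<^esub> h \<in> center RU" if h: "h \<in> center RU" for h
    proof -
      obtain x where x: "x \<in> invariants" "h = skew_embed x" using h center_RU by auto
      have m: "skew_embed (- x) \<in> center RU" using inv(4)[OF x(1)] center_RU by auto
      have "skew_embed (- x) \<oplus>\<^bsub>RU\<^esub> h = \<zero>\<^bsub>RU\<^esub>" by (simp add: x(2) emb) (simp add: skew_embed_def)
      then have "\<ominus>\<^bsub>RU\<^esub> h = skew_embed (- x)"
        using c h m by (intro RU.minus_equality) auto
      then show ?thesis using m by simp
    qed
  qed
  show "z \<otimes>\<^bsub>RU\<^esub> r = r \<otimes>\<^bsub>RU\<^esub> z" if "z \<in> center RU" "r \<in> carrier RU" for z r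
    using that by (auto simp: center_def)
  show "integral_over RU (center RU)"
    unfolding integral_over_def
  proof
    fix u assume "u \<in> carrier RU"
    then have u: "u \<in> U" by simp
    obtain f where f: "monic_over invariants f" "skew_right.act u f (skew_embed 1) = 0"
      by (rule integral_equation[OF u])
    have c: "coeff f i \<in> invariants" for i
      by (rule monic_over_coeff[OF f(1) inv(1) nonunital_subring_invariants(2)])
    have "f \<noteq> 0" "lead_coeff f = 1" using f(1) by (auto simp: monic_over_def)
    then have "rev (coeffs f) = 1 # tl (rev (coeffs f))"
      by (metis coeffs_eq_Nil hd_rev last_coeffs_eq_coeff_degree list.collapse rev_is_Nil_conv)
    then have "map skew_embed (rev (coeffs f)) = skew_embed 1 # map skew_embed (tl (rev (coeffs f)))"
      by (metis list.simps(9))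
    moreover have "RU.eval (map skew_embed (rev (coeffs f))) u = 0"
      using eval_eq_act[OF u c] f(2) by simp
    ultimately have "RU.eval (\<one>\<^bsub>RU\<^esub> # map skew_embed (tl (rev (coeffs f)))) u = \<zero>\<^bsub>RU\<^esub>"
      by (simp del: RU.eval.simps)
    moreover have "set (map skew_embed (tl (rev (coeffs f)))) \<subseteq> center RU"
    proof -
      have "set (tl (rev (coeffs f))) \<subseteq> set (coeffs f)"
        by (metis list.set_sel(2) rev.simps(1) set_rev subsetI tl_Nil)
      also have "\<dots> \<subseteq> invariants" using c by (auto simp: coeffs_def)
      finally show ?thesis by (auto simp: center_RU)
    qed
    ultimately show "\<exists>cs. set cs \<subseteq> center RU \<and> RU.eval (\<one>\<^bsub>RU\<^esub> # cs) u = \<zero>\<^bsub>RU\<^esub>" by blast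
  qed
qed

text \<open>Each right multiplication by \<open>\<alpha> u\<close> is one by \<open>u\<close> and a
  central factor \<open>\<alpha>\<close> that moves to the left, where the variable absorbs it:
  \<open>p\<close> becomes \<open>p(\<alpha> t)\<close>.\<close>

lemma act_pcompose_linear:
  assumes \<alpha>: "\<alpha> \<in> invariants" and u: "u \<in> U"
  shows "v \<in> U \<Longrightarrow> skew_right.act (skew_mult (skew_embed \<alpha>) u) p v = skew_right.act u (pcompose p [:0, \<alpha>:]) v"
proof (induction p arbitrary: v)
  case (pCons a p)
  have "skew_mult v (skew_mult (skew_embed \<alpha>) u) = skew_mult (skew_mult v (skew_embed \<alpha>)) u"
    using pCons.prems u by (simp add: skew_mult_assoc U_keys keys_skew_embed)
  also have "\<dots> = skew_mult (skew_embed \<alpha>) (skew_mult v u)"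
    using pCons.prems u by (simp add: invariants_commute[OF \<alpha> U_keys] skew_mult_assoc U_keys keys_skew_embed)
  finally have eq: "skew_mult v (skew_mult (skew_embed \<alpha>) u) = skew_mult (skew_embed \<alpha>) (skew_mult v u)" .
  have "skew_mult (skew_embed \<alpha>) (skew_mult v u) \<in> U"
    using pCons.prems u embed_invariants_U[OF \<alpha>] by (intro U_closed(4))
  then have IH: "skew_right.act (skew_mult (skew_embed \<alpha>) u) p (skew_mult (skew_embed \<alpha>) (skew_mult v u)) =
    skew_right.act u (pcompose p [:0, \<alpha>:]) (skew_mult (skew_embed \<alpha>) (skew_mult v u))" by (rule pCons.IH)
  have lin: "skew_right.act u [:0, \<alpha>:] v = skew_mult (skew_embed \<alpha>) (skew_mult v u)" by simp
  have "skew_right.act u (pcompose (pCons a p) [:0, \<alpha>:]) v =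
     skew_mult (skew_embed a) v + skew_right.act u (pcompose p [:0, \<alpha>:]) (skew_mult (skew_embed \<alpha>) (skew_mult v u))"
    unfolding pcompose_pCons mult.commute[of "[:0, \<alpha>:]"] skew_right.act_add_left skew_right.act_mult lin by simp
  then show ?case using IH by (simp add: eq)
qed simp

end

section \<open>Going down: equations modulo a prime of the center\<close>

lemma (in galois_order_data) prime_of_center:
  assumes ext: "integral_extension RU (center RU)" and cen: "center RU = skew_embed ` invariants"
    and \<pp>: "\<pp> \<in> Spec (RU\<lparr>carrier := center RU\<rparr>)"
  defines "PP \<equiv> {x \<in> invariants. skew_embed x \<in> \<pp>}"
  shows "\<pp> = skew_embed ` PP" "nonunital_subring PP" "1 \<notin> PP"
    "\<And>a x. a \<in> invariants \<Longrightarrow> x \<in> PP \<Longrightarrow> a * x \<in> PP"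
    "\<And>a b. a \<in> invariants \<Longrightarrow> b \<in> invariants \<Longrightarrow> a * b \<in> PP \<Longrightarrow> a \<in> PP \<or> b \<in> PP"
proof -
  interpret Z: integral_extension RU "center RU" by (rule ext)
  note p = Z.Spec_centerD[OF \<pp>]
  note inv = nonunital_subringD[OF nonunital_subring_invariants(1)]
  have Z: "skew_embed x \<in> center RU" if "x \<in> invariants" for x using that cen by blast
  show "\<pp> = skew_embed ` PP" using p(1) cen by (auto simp: PP_def)
  show "1 \<notin> PP" using p(3) by (simp add: PP_def)
  show mult: "a * x \<in> PP" if "a \<in> invariants" "x \<in> PP" for a x
    using that p(6)[OF _ Z, of "skew_embed x" a] inv(3)[of a x] by (simp add: PP_def skew_mult_embed_embed)
  show "a \<in> PP \<or> b \<in> PP" if "a \<in> invariants" "b \<in> invariants" "a * b \<in> PP" for a b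
    using that p(8)[OF Z Z, of a b] by (simp add: PP_def skew_mult_embed_embed)
  have "0 \<in> PP" using p(2) inv(1) by (simp add: PP_def skew_embed_def)
  moreover have "x + y \<in> PP" if "x \<in> PP" "y \<in> PP" for x y
    using that p(4)[of "skew_embed x" "skew_embed y"] inv(2)[of x y] by (simp add: PP_def skew_embed_add)
  moreover have "- x \<in> PP" if "x \<in> PP" for x
    using mult[OF inv(4)[OF nonunital_subring_invariants(2)] that] by simp
  ultimately show "nonunital_subring PP"
    using mult by (auto simp: nonunital_subring_def PP_def)
qed

context closed_galois_order
begin

text \<open>Right multiplication by an element of \<open>\<pp> U\<close> has a matrix with entries
  in the extended ideal \<open>J\<close>, so \<open>monic_equation\<close> yields lower coefficients
  that are invariant and lie in \<open>J\<close>. An invariant element of \<open>J\<close> is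
  integral with coefficients in the prime; hence some power of it, and then the element itself, lies
  in the prime.\<close>

lemma equation_in_prime:
  assumes \<pp>: "\<pp> \<in> Spec (RU\<lparr>carrier := center RU\<rparr>)" and y: "y \<in> \<pp> \<cdot>\<^bsub>RU\<^esub> carrier RU"
  obtains f where "monic_over {x \<in> invariants. skew_embed x \<in> \<pp>} f" "skew_right.act y f (skew_embed 1) = 0"
proof -
  interpret Z: integral_extension RU "center RU" by (rule integral_extension_RU)
  define PP where "PP = {x \<in> invariants. skew_embed x \<in> \<pp>}"
  note PP = prime_of_center[OF integral_extension_RU center_RU \<pp>, folded PP_def]
  note PD = nonunital_subringD[OF PP(2)]
  have PPinv: "PP \<subseteq> invariants" by (auto simp: PP_def)
  have PPLL: "PP \<subseteq> LL" using PPinv invariants_LL by blast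
  \<comment> \<open>The prime is extended to \<Lambda> and not just to \<Gamma>: the norm over
    \<open>M\<close> requires an \<open>M\<close>-stable coefficient set, and \<open>M\<close> need
    not preserve \<Gamma>.\<close>
  define J where "J = ideal_gen PP LL"
  have J: "nonunital_subring J" "J \<subseteq> LL"
    unfolding J_def using nonunital_subring_ideal_gen[OF PPLL nonunital_subring_LL] ideal_gen_subset[OF PPLL nonunital_subring_LL(1)]
    by blast+
  have JM: "fract_ext \<mu> x \<in> J" if \<mu>: "\<mu> \<in> M" and x: "x \<in> J" for \<mu> x
    using x unfolding J_def
  proof induction
    case zero
    show ?case using fract_ext_simps(4)[OF M_aut[OF \<mu>]] by (simp add: ideal_gen.zero)
  next
    case (add p l x)
    have "fract_ext \<mu> (p * l + x) = p * fract_ext \<mu> l + fract_ext \<mu> x"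
      using ring_autD(4,5)[OF ring_aut_fract_ext[OF M_aut[OF \<mu>]]] invariants_M[OF _ \<mu>, of p] add(1) PPinv by auto
    then show ?case using ideal_gen.add[OF add(1) fract_ext_LL[OF M_aut[OF \<mu>] add(2)] add.IH] by simp
  qed
  obtain n :: nat and w where w: "\<forall>i<n. w i \<in> U"
    "\<forall>u\<in>U. \<exists>c. (\<forall>i<n. c i \<in> \<Gamma>) \<and> u = (\<Sum>i<n. skew_mult (skew_embed (to_fract (c i))) (w i))"
    using U_finitely_generated by blast
  have yU: "y \<in> U" using ideal.Icarr[OF Z.ideal_prod_center_ideal[OF \<pp>] y] by simp
  have I: "a + b \<in> J \<inter> to_fract ` \<Gamma>" if ab: "a \<in> J \<inter> to_fract ` \<Gamma>" "b \<in> J \<inter> to_fract ` \<Gamma>" for a b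
  proof -
    obtain x z where "x \<in> \<Gamma>" "a = to_fract x" "z \<in> \<Gamma>" "b = to_fract z" using ab by blast
    then have "a + b = to_fract (x + z)" "x + z \<in> \<Gamma>" by simp_all
    then show ?thesis using nonunital_subringD(2)[OF J(1)] ab by blast
  qed
  have entries: "\<exists>e. (\<forall>j<n. e j \<in> J \<inter> to_fract ` \<Gamma>) \<and> skew_mult x y = (\<Sum>j<n. skew_mult (skew_embed (e j)) (w j))"
    if x: "x \<in> U" for x
    using y
  proof induction
    case (prod i v)
    then obtain p where p: "p \<in> PP" "i = skew_embed p" using PP(1) by blast
    then obtain z where z: "z \<in> \<Gamma>" "p = to_fract z" using invariants_\<Gamma> PPinv by blast
    have v: "v \<in> U" using prod by simp
    have "skew_mult x (skew_mult i v) = skew_mult (skew_mult x i) v"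
      using x v p(2) by (simp add: skew_mult_assoc U_keys keys_skew_embed)
    also have "skew_mult x i = skew_mult i x"
      unfolding p(2) using p(1) PPinv by (intro invariants_commute U_keys[OF x]) blast
    also have "skew_mult (skew_mult i x) v = skew_mult i (skew_mult x v)"
      using x v p(2) by (simp add: skew_mult_assoc U_keys keys_skew_embed)
    finally have eq: "skew_mult x (skew_mult i v) = skew_mult (skew_embed p) (skew_mult x v)" using p(2) by simp
    obtain c where c: "\<forall>j<n. c j \<in> \<Gamma>" "skew_mult x v = (\<Sum>j<n. skew_mult (skew_embed (to_fract (c j))) (w j))"
      using w(2) U_closed(4)[OF x v] by blast
    have "p * to_fract (c j) \<in> J \<inter> to_fract ` \<Gamma>" if "j < n" for j
    proof
      have "p * to_fract (c j) + 0 \<in> J" unfolding J_def by (intro ideal_gen.add ideal_gen.zero p) auto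
      then show "p * to_fract (c j) \<in> J" by simp
      have "z * c j \<in> \<Gamma>" using z c(1) that by simp
      then show "p * to_fract (c j) \<in> to_fract ` \<Gamma>" using z(2) by (metis imageI to_fract_mult)
    qed
    moreover have "skew_mult x (skew_mult i v) = (\<Sum>j<n. skew_mult (skew_embed (p * to_fract (c j))) (w j))"
      unfolding eq c(2) by (simp add: skew.scale_sum_right skew.scale_scale)
    ultimately show ?case by (intro exI[of _ "\<lambda>j. p * to_fract (c j)"]) simp
  next
    case (sum s1 s2)
    then obtain e1 e2 where e: "\<forall>j<n. e1 j \<in> J \<inter> to_fract ` \<Gamma>" "skew_mult x s1 = (\<Sum>j<n. skew_mult (skew_embed (e1 j)) (w j))"
      "\<forall>j<n. e2 j \<in> J \<inter> to_fract ` \<Gamma>" "skew_mult x s2 = (\<Sum>j<n. skew_mult (skew_embed (e2 j)) (w j))"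
      by blast
    have s: "s1 \<in> U" "s2 \<in> U"
      using sum(1,2) ideal.Icarr[OF Z.ideal_prod_center_ideal[OF \<pp>]] by auto
    have "skew_mult x (s1 + s2) = (\<Sum>j<n. skew_mult (skew_embed (e1 j + e2 j)) (w j))"
      using x s e(2,4) by (simp add: skew_mult_distrib(2) U_keys sum.distrib skew.scale_left_distrib)
    then show ?case
      using e(1,3) I by (intro exI[of _ "\<lambda>j. e1 j + e2 j"]) simp
  qed
  have "\<exists>e. (\<forall>j<n. e j \<in> J \<inter> to_fract ` \<Gamma>) \<and> skew_mult (w i) y = (\<Sum>j<n. skew_mult (skew_embed (e j)) (w j))"
    if "i < n" for i using entries w(1) that by blast
  then obtain f where f: "monic_over (J \<inter> invariants) f" "skew_right.act y f (skew_embed 1) = 0"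
    using monic_equation[OF J JM yU w(2)] by blast
  have "J \<inter> invariants \<subseteq> PP"
  proof
    fix x assume x: "x \<in> J \<inter> invariants"
    have "integral_at PP x"
    proof (rule integral_at_ideal_gen[OF nonunital_subring_invariants PP(2)])
      show "p * a \<in> PP" if "p \<in> PP" "a \<in> invariants" for p a
        using PP(4)[OF that(2,1)] by (simp add: mult.commute)
      show "integral_at invariants l" if "l \<in> LL" for l by (rule LL_integral_over_invariants[OF that])
      show "x \<in> ideal_gen PP LL" using x by (simp add: J_def)
    qed
    then obtain q where q: "monic_over PP q" "poly q x = 0"
      using integral_at_imp_root[OF PP(2)] by blast
    note inv = nonunital_subringD[OF nonunital_subring_invariants(1)]
    have pow: "x ^ i \<in> invariants" for i
      using x nonunital_subring_invariants(2) by (induction i) (auto intro: inv(3))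
    have "0 = (\<Sum>i<degree q. coeff q i * x ^ i) + x ^ degree q"
      using q by (simp add: poly_altdef monic_over_def flip: lessThan_Suc_atMost)
    moreover have "(\<Sum>i<degree q. coeff q i * x ^ i) \<in> PP"
      using q(1) PP(4)[OF pow] by (intro PD(6)) (auto simp: monic_over_def mult.commute)
    ultimately have xn: "x ^ degree q \<in> PP"
      using PD(4) by (metis add_eq_0_iff)
    have "x \<in> PP" if "x ^ k \<in> PP" for k
      using that
    proof (induction k)
      case 0
      then show ?case using PP(3) by simp
    next
      case (Suc k)
      then show ?case using PP(5)[of x "x ^ k"] x pow by auto
    qed
    then show "x \<in> PP" using xn by blast
  qed
  then show thesis using that f monic_over_mono unfolding PP_def by blast
qed

lemma map_poly_invariants:
  assumes "\<And>i. coeff f i \<in> invariants" "\<sigma> \<in> G \<union> M"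
  shows "map_poly (fract_ext \<sigma>) f = f"
proof -
  have \<sigma>: "ring_aut \<sigma>" using assms(2) G_aut M_aut by blast
  show ?thesis
    using assms invariants_G invariants_M
    by (intro poly_eqI) (auto simp: map_poly_mult_aut(5)[OF ring_aut_fract_ext[OF \<sigma>]])
qed

text \<open>Coefficients of a monic factor are integral over the invariants; being fixed, they
  return to the invariants by integral closedness.\<close>

lemma factor_in_invariants:
  assumes pq: "lead_coeff p = 1" "lead_coeff q = 1" "\<And>i. coeff (p * q) i \<in> invariants"
    and fixed: "\<And>\<sigma>. \<sigma> \<in> G \<union> M \<Longrightarrow> map_poly (fract_ext \<sigma>) p = p"
  shows "monic_over invariants p"
proof -
  have "coeff p i \<in> invariants" for i
  proof (rule integral_fixed_in_invariants)
    show "integral_at invariants (coeff p i)"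
      using pq by (intro integral_at_coeffs_of_factor[OF nonunital_subring_invariants pq(1,2)]) (simp add: coeffs_in_def)
    fix \<sigma> assume \<sigma>: "\<sigma> \<in> G \<union> M"
    then have aut: "ring_aut \<sigma>" using G_aut M_aut by blast
    have "coeff (map_poly (fract_ext \<sigma>) p) i = coeff p i" using fixed[OF \<sigma>] by simp
    then show "fract_ext \<sigma> (coeff p i) = coeff p i"
      by (simp add: map_poly_mult_aut(5)[OF ring_aut_fract_ext[OF aut]])
  qed
  then show ?thesis using pq(1) by (simp add: monic_over_def)
qed

text \<open>The common divisor \<open>d\<close> of an equation \<open>h\<close> of \<open>u\<close> over the center and of \<open>f(\<alpha> t)\<close>, where \<open>f\<close> is an
  equation of \<open>\<alpha> u\<close> with lower coefficients in the prime \<open>\<pp>\<close>: it has coefficients in the center because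
  the center is integrally closed, and they lie in \<open>\<pp>\<close> because \<open>f\<close> is a power of \<open>t\<close> modulo \<open>\<pp>\<close>.\<close>

lemma nilpotent_modulo_prime:
  assumes \<pp>: "\<pp> \<in> Spec (RU\<lparr>carrier := center RU\<rparr>)" and P: "P \<in> Spec RU" "\<pp> \<subseteq> P"
    and a: "a \<in> center RU - \<pp>" and u: "u \<in> carrier RU" and au: "a \<otimes>\<^bsub>RU\<^esub> u \<in> \<pp> \<cdot>\<^bsub>RU\<^esub> carrier RU"
  shows "\<exists>n::nat. u [^]\<^bsub>RU\<^esub> n \<in> P"
proof -
  interpret RU: ring RU by (rule ring_RU)
  define PP where "PP = {x \<in> invariants. skew_embed x \<in> \<pp>}"
  note PP = prime_of_center[OF integral_extension_RU center_RU \<pp>, folded PP_def]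
  note PD = nonunital_subringD[OF PP(2)] and inv = nonunital_subringD[OF nonunital_subring_invariants(1)]
  have PPinv: "PP \<subseteq> invariants" by (auto simp: PP_def)
  obtain \<alpha> where \<alpha>: "\<alpha> \<in> invariants" "a = skew_embed \<alpha>" using a center_RU by auto
  have \<alpha>P: "\<alpha> \<notin> PP" using a \<alpha> by (auto simp: PP_def)
  have \<alpha>0: "\<alpha> \<noteq> 0" using \<alpha>P PD(1) by auto
  have uU: "u \<in> U" using u by simp
  obtain f where f: "monic_over PP f" "skew_right.act (skew_mult (skew_embed \<alpha>) u) f (skew_embed 1) = 0"
    using equation_in_prime[OF \<pp> au, folded PP_def] \<alpha>(2) by auto
  obtain h where h: "monic_over invariants h" "skew_right.act u h (skew_embed 1) = 0"
    by (rule integral_equation[OF uU])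
  define f\<alpha> where "f\<alpha> = pcompose f [:0, \<alpha>:]"
  have f\<alpha>: "skew_right.act u f\<alpha> (skew_embed 1) = 0"
    unfolding f\<alpha>_def using act_pcompose_linear[OF \<alpha>(1) uU U_closed(2)] f(2) by simp
  have pow: "\<alpha> ^ i \<in> invariants" for i
    using \<alpha>(1) nonunital_subring_invariants(2) by (induction i) (auto intro: inv(3))
  have fc: "coeff f i \<in> invariants" for i
    by (rule monic_over_coeff[OF monic_over_mono[OF PPinv f(1)] inv(1) nonunital_subring_invariants(2)])
  have hc: "coeff h i \<in> invariants" for i
    by (rule monic_over_coeff[OF h(1) inv(1) nonunital_subring_invariants(2)])
  have f\<alpha>c: "coeff f\<alpha> i \<in> invariants" for i
    using pow fc inv(3) by (simp add: f\<alpha>_def coeff_pcompose_linear)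
  have lead: "lead_coeff f = 1" "lead_coeff h = 1" using f(1) h(1) by (auto simp: monic_over_def)
  then have "h \<noteq> 0" by auto
  then obtain d r s where d: "lead_coeff d = 1" "d = r * h + s * f\<alpha>" "d dvd h" "d dvd f\<alpha>"
    by (rule monic_gcd_bezout)
  have d_fixed: "map_poly (fract_ext \<sigma>) d = d" if \<sigma>: "\<sigma> \<in> G \<union> M" for \<sigma>
  proof -
    have "ring_aut \<sigma>" using \<sigma> G_aut M_aut by blast
    note hom = map_poly_mult_aut[OF ring_aut_fract_ext[OF this]]
    \<comment> \<open>By the Bezout form \<open>d\<close> divides its own image; both are monic of
      the same degree, so they agree.\<close>
    have "map_poly (fract_ext \<sigma>) d = map_poly (fract_ext \<sigma>) r * h + map_poly (fract_ext \<sigma>) s * f\<alpha>"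
      using map_poly_invariants[OF hc \<sigma>] map_poly_invariants[OF f\<alpha>c \<sigma>]
      by (subst d(2)) (simp add: hom(1,2))
    then have "d dvd map_poly (fract_ext \<sigma>) d" using d(3,4) by simp
    then obtain e where e: "map_poly (fract_ext \<sigma>) d = d * e" by (auto simp: dvd_def)
    have "d \<noteq> 0" using d(1) by auto
    then have "e \<noteq> 0" using e hom(3)[of d] hom(6)[OF d(1)] by auto
    then have "degree e = 0" using e hom(3)[of d] degree_mult_eq[OF \<open>d \<noteq> 0\<close>, of e] by simp
    moreover have "lead_coeff e = 1" using e hom(6)[OF d(1)] d(1) by (simp add: lead_coeff_mult)
    ultimately have "e = 1" by (metis degree_eq_zeroE lead_coeff_pCons(2) one_pCons)
    then show ?thesis using e by simp
  qed
  obtain q where q: "h = d * q" using d(3) by (auto simp: dvd_def)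
  have "monic_over invariants d"
  proof (rule factor_in_invariants[OF d(1) _ _ d_fixed])
    show "lead_coeff q = 1" using lead(2) d(1) by (simp add: q lead_coeff_mult)
    show "coeff (d * q) i \<in> invariants" for i using hc by (simp flip: q)
  qed
  then have dc: "coeff d i \<in> invariants" for i
    by (rule monic_over_coeff[OF _ inv(1) nonunital_subring_invariants(2)])
  define n where "n = degree d"
  \<comment> \<open>The inverse substitution, normalized: \<open>\<alpha>^n d(t / \<alpha>)\<close>
    is monic with coefficients \<open>\<alpha>^(n - i) d_i\<close>, and it divides \<open>f\<close>.
    The cofactor \<open>q'\<close> carries the opposite power of \<open>\<alpha>\<close>.\<close>
  define d' where "d' = smult (\<alpha> ^ n) (pcompose d [:0, inverse \<alpha>:])"
  have d'c: "coeff d' i = \<alpha> ^ (n - i) * coeff d i" for i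
  proof (cases "i \<le> n")
    case True
    then have "\<alpha> ^ n * inverse \<alpha> ^ i = \<alpha> ^ (n - i)" using \<alpha>0 by (simp add: power_diff power_inverse divide_inverse)
    then show ?thesis by (simp add: d'_def coeff_pcompose_linear flip: mult.assoc)
  qed (simp add: d'_def coeff_pcompose_linear coeff_eq_0 n_def)
  have deg_d': "degree d' = n" using \<alpha>0 by (simp add: d'_def degree_pcompose n_def)
  then have lead_d': "lead_coeff d' = 1" using d(1) by (simp add: d'c n_def)
  have d'inv: "coeff d' i \<in> invariants" for i using pow dc inv(3) by (simp add: d'c)
  obtain q2 where q2: "f\<alpha> = d * q2" using d(4) by (auto simp: dvd_def)
  define q' where "q' = smult (inverse \<alpha> ^ n) (pcompose q2 [:0, inverse \<alpha>:])"
  have f_eq: "f = d' * q'"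
  proof -
    have "f = pcompose f\<alpha> [:0, inverse \<alpha>:]"
      using \<alpha>0 by (intro poly_eqI) (simp add: f\<alpha>_def coeff_pcompose_linear flip: mult.assoc power_mult_distrib)
    then show ?thesis using \<alpha>0 by (simp add: q2 pcompose_mult d'_def q'_def flip: power_mult_distrib)
  qed
  have lead_q': "lead_coeff q' = 1" using lead(1) lead_d' by (simp add: f_eq lead_coeff_mult)
  have "d' \<noteq> 0" "q' \<noteq> 0" using lead_d' lead_q' by auto
  have mq': "monic_over invariants q'"
  proof (rule factor_in_invariants[OF lead_q' lead_d'])
    show "coeff (q' * d') i \<in> invariants" for i using fc by (simp add: f_eq mult.commute)
    fix \<sigma> assume \<sigma>: "\<sigma> \<in> G \<union> M"
    then have "ring_aut \<sigma>" using G_aut M_aut by blast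
    then have "d' * map_poly (fract_ext \<sigma>) q' = d' * q'"
      using map_poly_invariants[OF fc \<sigma>] map_poly_invariants[OF d'inv \<sigma>]
        map_poly_mult_aut(1)[OF ring_aut_fract_ext, of \<sigma> d' q'] by (simp add: f_eq)
    then show "map_poly (fract_ext \<sigma>) q' = q'" using \<open>d' \<noteq> 0\<close> by simp
  qed
  have "monic_over PP d'"
  proof (rule factor_lower_coeffs_in_prime[OF nonunital_subring_invariants PPinv PP(2,4,5,3) _ mq'])
    show "monic_over invariants d'" using lead_d' d'inv by (simp add: monic_over_def)
    show "monic_over PP (d' * q')" using f(1) f_eq by simp
    show "degree (d' * q') = degree d' + degree q'" by (rule degree_mult_eq) fact+
  qed
  then have d'P: "\<alpha> ^ (n - i) * coeff d i \<in> PP" if "i < n" for i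
    using that deg_d' by (metis d'c monic_over_def)
  have \<alpha>_pow: "\<alpha> ^ k \<notin> PP" for k
    using PP(3,5) \<alpha>(1) \<alpha>P pow by (induction k) auto
  \<comment> \<open>Powers of \<open>\<alpha>\<close> stay outside the prime, so they can be
    cancelled from \<open>\<alpha>^(n - i) d_i\<close>.\<close>
  have dP: "skew_embed (coeff d i) \<in> P" if "i < n" for i
    using PP(5)[OF pow dc d'P[OF that]] \<alpha>_pow P(2) by (auto simp: PP_def)
  have iP: "ideal P RU" using P(1) by (simp add: Spec_def)
  have T: "((\<lambda>f. skew_mult f u) ^^ i) (skew_embed 1) = u [^]\<^bsub>RU\<^esub> i" for i
    by (induction i) auto
  have uR: "u [^]\<^bsub>RU\<^esub> (i::nat) \<in> U" for i using RU.nat_pow_closed[OF u, of i] by simp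
  \<comment> \<open>\<open>d\<close> is a combination of two polynomials that annihilate
    \<open>1\<close>. So \<open>d(u) = 0\<close>, which expresses \<open>u^n\<close> through lower
    powers with coefficients in \<open>P\<close>.\<close>
  have "skew_right.act u d (skew_embed 1) = 0"
    by (subst d(2)) (simp add: skew_right.act_add_left skew_right.act_mult h(2) f\<alpha>)
  then have "(\<Sum>i\<le>n. skew_mult (skew_embed (coeff d i)) (u [^]\<^bsub>RU\<^esub> i)) = 0"
    unfolding skew_right.act_def n_def T .
  then have sum0: "(\<Sum>i<n. skew_mult (skew_embed (coeff d i)) (u [^]\<^bsub>RU\<^esub> i)) + u [^]\<^bsub>RU\<^esub> n = 0"
    using d(1) by (simp add: n_def flip: lessThan_Suc_atMost)
  have "(\<Sum>i\<in>S. skew_mult (skew_embed (coeff d i)) (u [^]\<^bsub>RU\<^esub> i)) \<in> P" if "finite S" "S \<subseteq> {..<n}" for S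
    using that
  proof (induction S rule: finite_induct)
    case empty
    then show ?case using RU.ideal_closed(2)[OF iP] by simp
  next
    case (insert i S)
    have "skew_mult (skew_embed (coeff d i)) (u [^]\<^bsub>RU\<^esub> i) \<in> P"
      using RU.ideal_closed(6)[OF iP dP, of i "u [^]\<^bsub>RU\<^esub> i"] insert.prems uR by auto
    then show ?case
      using insert RU.ideal_closed(3)[OF iP] by auto
  qed
  then have "(\<Sum>i<n. skew_mult (skew_embed (coeff d i)) (u [^]\<^bsub>RU\<^esub> i)) \<in> P" by blast
  then have "skew_mult (skew_embed (- 1)) (\<Sum>i<n. skew_mult (skew_embed (coeff d i)) (u [^]\<^bsub>RU\<^esub> i)) \<in> P"
    using RU.ideal_closed(5)[OF iP, of _ "skew_embed (- 1)"] embed_invariants_U[OF inv(4)[OF nonunital_subring_invariants(2)]]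
    by simp
  moreover have "skew_mult (skew_embed (- 1)) (\<Sum>i<n. skew_mult (skew_embed (coeff d i)) (u [^]\<^bsub>RU\<^esub> i)) = u [^]\<^bsub>RU\<^esub> n"
    using sum0 by (simp add: skew.scale_minus_left eq_neg_iff_add_eq_0 add.commute neg_eq_iff_add_eq_0)
  ultimately show ?thesis by auto
qed

end

theorem theorem4p15:
  fixes s :: "'k::field \<Rightarrow> 'a::idom \<Rightarrow> 'a"
    and G M :: "('a \<Rightarrow> 'a) set"
    and U :: "'a skew set"
    and R :: "'a skew ring"
    and Z :: "'a skew set"
    and Zr :: "'a skew ring"
  assumes "k_algebra s"
    and "integrally_closed TYPE('a)"
    and "subgroup G (aut_group s)" and "finite G"
    and "subgroup M (aut_group s)"
    and "\<exists>S. finite S \<and> S \<subseteq> M \<and> M = generate (aut_group s) S"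
    and "{\<mu> \<circ> inv_into UNIV \<nu> | \<mu> \<nu>. \<mu> \<in> M \<and> \<nu> \<in> M} \<inter> G = {id}"
    and "\<forall>g\<in>G. \<forall>\<mu>\<in>M. g \<circ> \<mu> \<circ> inv_into UNIV g \<in> M"
    and "noetherian_over (fixed_subring G)"
    and "R = (invariant_skew_ring G M)\<lparr>carrier := U\<rparr>"
    and "Z = center R"
    and "Zr = R\<lparr>carrier := Z\<rparr>"
    and "galois_ring G M U"
    and "prime_ring R"
    and "PI_algebra (skew_scalar s) R"
    and "galois_order G M U"
  shows "integral_over R Z \<and>
    (\<forall>\<pp>\<in>Spec Zr. \<exists>P\<in>Spec R. P \<inter> Z = \<pp>) \<and>
    (\<forall>\<pp>\<^sub>1\<in>Spec Zr. \<forall>\<pp>\<^sub>2\<in>Spec Zr. \<forall>P\<in>Spec R.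
       \<pp>\<^sub>1 \<subseteq> \<pp>\<^sub>2 \<longrightarrow> P \<inter> Z = \<pp>\<^sub>1 \<longrightarrow> (\<exists>Q\<in>Spec R. P \<subseteq> Q \<and> Q \<inter> Z = \<pp>\<^sub>2)) \<and>
    (\<forall>P\<in>Spec R. \<forall>Q\<in>Spec R. P \<subset> Q \<longrightarrow> P \<inter> Z \<subset> Q \<inter> Z) \<and>
    (\<forall>\<pp>\<^sub>1\<in>Spec Zr. \<forall>\<pp>\<^sub>2\<in>Spec Zr. \<forall>P\<in>Spec R.
       \<pp>\<^sub>2 \<subseteq> \<pp>\<^sub>1 \<longrightarrow> P \<inter> Z = \<pp>\<^sub>1 \<longrightarrow> (\<exists>Q\<in>Spec R. Q \<subseteq> P \<and> Q \<inter> Z = \<pp>\<^sub>2))"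
proof -
  have aut: "ring_aut \<phi>" "\<And>c x. \<phi> (s c x) = s c (\<phi> x)" if "\<phi> \<in> carrier (aut_group s)" for \<phi>
    using that by (auto simp: aut_group_def ring_aut_def Vector_Spaces.linear_iff)
  have sub: "(\<forall>\<phi>\<in>H. \<phi> \<in> carrier (aut_group s)) \<and> id \<in> H \<and> (\<forall>\<phi>\<in>H. \<forall>\<psi>\<in>H. \<phi> \<circ> \<psi> \<in> H) \<and> (\<forall>\<phi>\<in>H. finv \<phi> \<in> H)"
    if H: "subgroup H (aut_group s)" for H
  proof (intro conjI ballI)
    show "id \<in> H" using subgroup.one_closed[OF H] by (simp add: aut_group_def)
    show carr: "\<phi> \<in> carrier (aut_group s)" if "\<phi> \<in> H" for \<phi> using subgroup.subset[OF H] that by blast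
    show "\<phi> \<circ> \<psi> \<in> H" if "\<phi> \<in> H" "\<psi> \<in> H" for \<phi> \<psi>
      using subgroup.m_closed[OF H that] by (simp add: aut_group_def)
    show "finv \<phi> \<in> H" if \<phi>: "\<phi> \<in> H" for \<phi>
    proof -
      note r = ring_autD[OF aut(1)[OF carr[OF \<phi>]]]
      have lin: "finv \<phi> (s c x) = s c (finv \<phi> x)" for c x
        using aut(2)[OF carr[OF \<phi>], of c "finv \<phi> x"] r(9,10) by metis
      have c: "finv \<phi> \<in> carrier (aut_group s)"
        using ring_aut_inv[OF aut(1)[OF carr[OF \<phi>]]] carr[OF \<phi>] lin
        by (auto simp: aut_group_def ring_aut_def Vector_Spaces.linear_iff)
      have "m_inv (aut_group s) \<phi> = finv \<phi>"
        unfolding m_inv_def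
      proof (rule the_equality)
        show "finv \<phi> \<in> carrier (aut_group s) \<and> \<phi> \<otimes>\<^bsub>aut_group s\<^esub> finv \<phi> = \<one>\<^bsub>aut_group s\<^esub> \<and>
          finv \<phi> \<otimes>\<^bsub>aut_group s\<^esub> \<phi> = \<one>\<^bsub>aut_group s\<^esub>"
          using c r(11,12) by (simp add: aut_group_def)
        fix \<psi> assume "\<psi> \<in> carrier (aut_group s) \<and> \<phi> \<otimes>\<^bsub>aut_group s\<^esub> \<psi> = \<one>\<^bsub>aut_group s\<^esub> \<and>
          \<psi> \<otimes>\<^bsub>aut_group s\<^esub> \<phi> = \<one>\<^bsub>aut_group s\<^esub>"
        then have "\<psi> \<circ> \<phi> = id" by (simp add: aut_group_def)
        then have "(\<psi> \<circ> \<phi>) \<circ> finv \<phi> = finv \<phi>" by simp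
        then show "\<psi> = finv \<phi>" using r(11) by (simp add: comp_assoc)
      qed
      then show ?thesis using subgroup.m_inv_closed[OF H \<phi>] by simp
    qed
  qed
  note G = sub[OF assms(3)] and M = sub[OF assms(5)]
  interpret galois_ring_data G M U
  proof
    show "ring_aut g" if "g \<in> G" for g using G aut(1) that by blast
    show "ring_aut \<mu>" if "\<mu> \<in> M" for \<mu> using M aut(1) that by blast
    show "g \<circ> h \<in> G" if "g \<in> G" "h \<in> G" for g h using G that by blast
    show "g \<circ> h \<in> M" if "g \<in> M" "h \<in> M" for g h using M that by blast
    show "finv g \<in> G" if "g \<in> G" for g using G that by blast
    show "finv g \<in> M" if "g \<in> M" for g using M that by blast
    show "g \<circ> \<mu> \<circ> finv g \<in> M" if "g \<in> G" "\<mu> \<in> M" for g \<mu> using assms(8) that by blast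
  qed (use G M assms in blast)+
  have "finite M"
  \<comment> \<open>The scalar \<open>c\<close> is represented by its multiple of \<open>1\<close>
    in \<Lambda>, which every automorphism linear over the base field fixes.\<close>
  proof (rule finite_M_of_PI[of "\<lambda>c. s c 1"])
    have fixed: "\<phi> (s c 1) = s c 1" if "\<phi> \<in> carrier (aut_group s)" for \<phi> c
      using aut(2)[OF that, of c 1] ring_autD(6)[OF aut(1)[OF that]] by simp
    show "s c 1 \<in> \<Gamma>" for c using fixed G by (auto simp: fixed_subring_def)
    show "\<mu> (s c 1) = s c 1" if "\<mu> \<in> M" for c \<mu> using fixed M that by blast
    show "s 1 1 = 1" using assms(1) by (simp add: k_algebra_def vector_space_def)
    have "(\<lambda>c. skew_embed (to_fract (s c 1))) = skew_scalar s"
      by (rule ext) (simp add: skew_scalar_def)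
    then show "PI_algebra (\<lambda>c. skew_embed (to_fract (s c 1))) (KK\<lparr>carrier := U\<rparr>)"
      using assms(10,15) by simp
  qed
  then interpret closed_galois_order G M U
    by unfold_locales (use assms in simp_all)
  have R: "R = RU" and Z: "Z = center RU" and Zr: "Zr = RU\<lparr>carrier := center RU\<rparr>"
    using assms(10-12) by simp_all
  interpret Z: integral_extension RU "center RU" by (rule integral_extension_RU)
  note noeth = left_noetherian_RU
  show ?thesis
    unfolding R Z Zr
  proof (intro conjI ballI impI)
    show "integral_over RU (center RU)" by (rule Z.integral)
    fix \<pp> assume \<pp>: "\<pp> \<in> Spec (RU\<lparr>carrier := center RU\<rparr>)"
    show "\<exists>P\<in>Spec RU. P \<inter> center RU = \<pp>"
    proof (rule Z.exists_prime_over[OF noeth \<pp> Z.zeroideal])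
      show "{\<zero>\<^bsub>RU\<^esub>} \<inter> center RU \<subseteq> \<pp>" using Z.Spec_centerD(2)[OF \<pp>] by blast
    qed blast
  next
    fix \<pp>\<^sub>1 \<pp>\<^sub>2 P
    assume \<pp>: "\<pp>\<^sub>2 \<in> Spec (RU\<lparr>carrier := center RU\<rparr>)" and P: "P \<in> Spec RU" "\<pp>\<^sub>1 \<subseteq> \<pp>\<^sub>2" "P \<inter> center RU = \<pp>\<^sub>1"
    have "ideal P RU" using P(1) by (simp add: Spec_def)
    \<comment> \<open>Going up uses the lemma behind lying over, with \<open>P\<close> in place of
      the zero ideal.\<close>
    then show "\<exists>Q\<in>Spec RU. P \<subseteq> Q \<and> Q \<inter> center RU = \<pp>\<^sub>2"
      by (rule Z.exists_prime_over[OF noeth \<pp>]) (use P in blast)+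
  next
    fix P Q assume "P \<in> Spec RU" "Q \<in> Spec RU" "P \<subset> Q"
    then show "P \<inter> center RU \<subset> Q \<inter> center RU" by (rule Z.incomparability[OF noeth])
  next
    fix \<pp>\<^sub>1 \<pp>\<^sub>2 P
    assume \<pp>: "\<pp>\<^sub>2 \<in> Spec (RU\<lparr>carrier := center RU\<rparr>)" and P: "P \<in> Spec RU" "\<pp>\<^sub>2 \<subseteq> \<pp>\<^sub>1" "P \<inter> center RU = \<pp>\<^sub>1"
    have "\<pp>\<^sub>2 \<subseteq> P" using P by blast
    show "\<exists>Q\<in>Spec RU. Q \<subseteq> P \<and> Q \<inter> center RU = \<pp>\<^sub>2"
      by (rule Z.going_down[OF noeth \<pp> P(1) \<open>\<pp>\<^sub>2 \<subseteq> P\<close> nilpotent_modulo_prime[OF \<pp> P(1) \<open>\<pp>\<^sub>2 \<subseteq> P\<close>]]) blast+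
  qed
qed

end
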